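(* Suppose that $X$ and $Y$ are finitely generated unital operator spaces. Then $X$ and $Y$ are unitally completely isometric if and only if $\varphi^X=\varphi^Y$ for every universal $\mathcal{L}_{uOSp}$-sentence $\varphi$. In particular, the unital complete isometry relation for finitely generated unital operator spaces is smooth.
   Context: A unital operator space is a (closed) linear subspace $X$ of a unital C*-algebra containing the unit, with the induced norms on $M_n(X)$ for all $n$ and with the unit as distinguished element; it is finitely generated exactly when it is finite-dimensional. $X$ and $Y$ are unitally completely isometric if there is a linear bijection $u:X\to Y$ with $u(1)=1$ such that $[x_{ij}]\mapsto[u(x_{ij})]$ is an isometry $M_n(X)\to M_n(Y)$ for every $n$. The language $\mathcal{L}_{uOSp}$ (continuous logic for metric structures, several sorts). A unital operator space $X$ is regarded as a structure with one sort for each $n\ge1$, interpreted as $M_n(X)$ with metric $d(x,y)=\|x-y\|$; domains of quantification $D_{n,k}$ ($k\ge1$) interpreted as the closed ball of radius $k$ in $M_n(X)$; function symbols for addition and multiplication by scalars in $\mathbb{Q}(i)$ on each $M_n(X)$; constants for $0$ and for the unit $1\in X$; and function symbols $x\mapsto axb$ from $M_k(X)$ to $M_n(X)$ for $a\in M_{n,k}(\mathbb{Q}(i))$, $b\in M_{k,n}(\mathbb{Q}(i))$. Formulas are built from atomic formulas using continuous functions $\mathbb{R}^m\to\mathbb{R}$ as connectives and quantifiers $\sup_{x\in D_{n,k}}$, $\inf_{x\in D_{n,k}}$; a sentence is a formula without free variables, $\varphi^X\in\mathbb{R}$ is its value in $X$; a formula is universal if it only uses the quantifier $\sup$. Smoothness.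 Let $H$ be the separable infinite-dimensional Hilbert space, with $B(H)$ carrying the standard Borel structure in which $A$ is Borel iff its intersection with each ball $\{\|x\|\le n\}$ is Borel for the weak operator topology. Finitely generated unital operator spaces are parametrized by the Borel set of $\gamma\in B(H)^{\mathbb{N}}$ such that the linear span of $\{I\}\cup\{\gamma_n:n\in\mathbb{N}\}$, which is the unital operator space coded by $\gamma$, is finite-dimensional. An equivalence relation $E$ on a standard Borel space $Z$ is smooth if there are a Polish space $P$ and a Borel map $f:Z\to P$ with $z\,E\,z'\iff f(z)=f(z')$. *)

theory Defs
  imports "HOL-Analysis.Analysis" Jordan_Normal_Form.Matrix
begin

section \<open>Complex vector spaces, Hilbert spaces and C*-algebras\<close>

class scaleC = scaleR +
  fixes scaleC :: "complex \<Rightarrow> 'a \<Rightarrow> 'a" (infixr \<open>*\<^sub>C\<close> 75)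

class complex_vector = real_vector + scaleC +
  assumes scaleC_add_right: "c *\<^sub>C (x + y) = c *\<^sub>C x + c *\<^sub>C y"
    and scaleC_add_left: "(c + d) *\<^sub>C x = c *\<^sub>C x + d *\<^sub>C x"
    and scaleC_scaleC: "c *\<^sub>C d *\<^sub>C x = (c * d) *\<^sub>C x"
    and scaleR_scaleC: "r *\<^sub>R x = complex_of_real r *\<^sub>C x"

global_interpretation complex_vector: vector_space "scaleC :: complex \<Rightarrow> 'a \<Rightarrow> 'a :: complex_vector"
  defines csubspace = complex_vector.subspace
    and cspan = complex_vector.span
proof unfold_locales
  show "1 *\<^sub>C x = x" for x :: 'a
    using scaleR_scaleC[of 1 x] by simp
qed (simp_all add: scaleC_add_right scaleC_add_left scaleC_scaleC)

class complex_normed_vector = complex_vector + real_normed_vector +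
  assumes norm_scaleC: "norm (c *\<^sub>C x) = cmod c * norm x"

text \<open>The inner product is linear in the first argument.\<close>

class complex_hilbert_space = complex_normed_vector + real_inner + banach +
  fixes cinner :: "'a \<Rightarrow> 'a \<Rightarrow> complex"
  assumes cinner_commute: "cinner x y = cnj (cinner y x)"
    and cinner_add_left: "cinner (x + y) z = cinner x z + cinner y z"
    and cinner_scaleC_left: "cinner (c *\<^sub>C x) y = c * cinner x y"
    and inner_cinner: "inner x y = Re (cinner x y)"

class star =
  fixes star :: "'a \<Rightarrow> 'a"

text \<open>\<^class>\<open>monoid_mult\<close> provides the unit without demanding \<^prop>\<open>(0::'a::zero_neq_one) \<noteq> 1\<close>,
  so that the zero C*-algebra is not excluded.\<close>

class unital_cstar_algebra =
  complex_normed_vector + real_normed_algebra + banach + monoid_mult + star +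
  assumes mult_scaleC_left: "(c *\<^sub>C x) * y = c *\<^sub>C (x * y)"
    and mult_scaleC_right: "x * (c *\<^sub>C y) = c *\<^sub>C (x * y)"
    and star_star: "star (star x) = x"
    and star_add: "star (x + y) = star x + star y"
    and star_scaleC: "star (c *\<^sub>C x) = cnj c *\<^sub>C star x"
    and star_mult: "star (x * y) = star y * star x"
    and norm_star_mult: "norm (star x * x) = (norm x)\<^sup>2"

text \<open>A *-algebra carries at most one complete C*-norm, and for a C*-algebra \<open>A\<close> the *-algebra
  \<open>M\<^sub>n(A)\<close> does carry one. The class names this norm: the axioms say that \<open>mat_norm\<close> is a C*-norm
  on each \<open>M\<^sub>n(A)\<close>, and they determine it. Completeness of \<open>M\<^sub>n(A)\<close> is automatic, because
  every C*-norm on a C*-algebra agrees with its complete C*-norm. The matrix operations are written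
  out entrywise only because a class cannot assume properties of the overloaded operations on
  \<^typ>\<open>'a mat\<close>; the lemmas below restate the axioms with those operations.\<close>

class matricial_cstar_algebra = unital_cstar_algebra +
  fixes mat_norm :: "'a mat \<Rightarrow> real"
  assumes mat_norm_eq_0_iff': "x \<in> carrier_mat n n \<Longrightarrow>
          mat_norm x = 0 \<longleftrightarrow> x = mat n n (\<lambda>_. 0)"
    and mat_norm_triangle': "x \<in> carrier_mat n n \<Longrightarrow> y \<in> carrier_mat n n \<Longrightarrow>
          mat_norm (mat n n (\<lambda>(i, j). x $$ (i, j) + y $$ (i, j))) \<le> mat_norm x + mat_norm y"
    and mat_norm_scaleC': "x \<in> carrier_mat n n \<Longrightarrow>
          mat_norm (map_mat (scaleC c) x) = cmod c * mat_norm x"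
    and mat_norm_mult': "x \<in> carrier_mat n n \<Longrightarrow> y \<in> carrier_mat n n \<Longrightarrow>
          mat_norm (mat n n (\<lambda>(i, j). \<Sum>k<n. x $$ (i, k) * y $$ (k, j))) \<le> mat_norm x * mat_norm y"
    and mat_norm_star_mult': "x \<in> carrier_mat n n \<Longrightarrow>
          mat_norm (mat n n (\<lambda>(i, j). \<Sum>k<n. star (x $$ (k, i)) * x $$ (k, j))) = (mat_norm x)\<^sup>2"
    and mat_norm_1x1: "mat_norm (mat 1 1 (\<lambda>_. a)) = norm a"

definition mat_scaleC :: "complex \<Rightarrow> 'a::scaleC mat \<Rightarrow> 'a mat"
  where "mat_scaleC c x = map_mat (scaleC c) x"

definition mat_star :: "'a::star mat \<Rightarrow> 'a mat"
  where "mat_star x = mat (dim_col x) (dim_row x) (\<lambda>(i, j). star (x $$ (j, i)))"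

lemma mat_plus_entrywise:
  fixes x y :: "'a::plus mat"
  assumes "x \<in> carrier_mat n n" "y \<in> carrier_mat n n"
  shows "x + y = mat n n (\<lambda>(i, j). x $$ (i, j) + y $$ (i, j))"
  using assms by (intro eq_matI) auto

lemma mat_times_entrywise:
  fixes x y :: "'a::semiring_0 mat"
  assumes "x \<in> carrier_mat n n" "y \<in> carrier_mat n n"
  shows "x * y = mat n n (\<lambda>(i, j). \<Sum>k<n. x $$ (i, k) * y $$ (k, j))"
  using assms by (intro eq_matI) (auto simp: scalar_prod_def atLeast0LessThan)

lemma mat_norm_eq_0_iff: "x \<in> carrier_mat n n \<Longrightarrow> mat_norm x = 0 \<longleftrightarrow> x = 0\<^sub>m n n"
  for x :: "'a::matricial_cstar_algebra mat"
  using mat_norm_eq_0_iff'[of x n] by (simp add: zero_mat_def)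

lemma mat_norm_triangle:
  fixes x y :: "'a::matricial_cstar_algebra mat"
  assumes "x \<in> carrier_mat n n" "y \<in> carrier_mat n n"
  shows "mat_norm (x + y) \<le> mat_norm x + mat_norm y"
  using mat_norm_triangle'[OF assms] by (simp add: mat_plus_entrywise[OF assms])

lemma mat_norm_scaleC:
  fixes x :: "'a::matricial_cstar_algebra mat"
  assumes "x \<in> carrier_mat n n"
  shows "mat_norm (mat_scaleC c x) = cmod c * mat_norm x"
  using mat_norm_scaleC'[OF assms] by (simp add: mat_scaleC_def)

lemma mat_norm_mult:
  fixes x y :: "'a::matricial_cstar_algebra mat"
  assumes "x \<in> carrier_mat n n" "y \<in> carrier_mat n n"
  shows "mat_norm (x * y) \<le> mat_norm x * mat_norm y"
  using mat_norm_mult'[OF assms] by (simp add: mat_times_entrywise[OF assms])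

lemma mat_norm_star_mult:
  fixes x :: "'a::matricial_cstar_algebra mat"
  assumes "x \<in> carrier_mat n n"
  shows "mat_norm (mat_star x * x) = (mat_norm x)\<^sup>2"
proof -
  have s: "mat_star x \<in> carrier_mat n n"
    using assms by (simp add: mat_star_def)
  have "mat_star x * x = mat n n (\<lambda>(i, j). \<Sum>k<n. star (x $$ (k, i)) * x $$ (k, j))"
    unfolding mat_times_entrywise[OF s assms]
    using assms by (intro eq_matI) (auto simp: mat_star_def intro!: sum.cong)
  with mat_norm_star_mult'[OF assms] show ?thesis by simp
qed


section \<open>The C*-algebra \<open>B(H)\<close>\<close>

lemma cinner_add_right: "cinner x (y + z) = cinner x y + cinner x z"
  by (metis cinner_add_left cinner_commute complex_cnj_add)

lemma cinner_scaleC_right: "cinner x (c *\<^sub>C y) = cnj c * cinner x y"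
  by (metis cinner_scaleC_left cinner_commute complex_cnj_mult)

lemma cinner_sum_left: "cinner (sum f A) y = (\<Sum>i\<in>A. cinner (f i) y)"
proof (induction A rule: infinite_finite_induct)
  case empty
  show ?case using cinner_scaleC_left[of 0 0 y] by simp
next
  case (infinite A)
  then show ?case using cinner_scaleC_left[of 0 0 y] by simp
qed (simp add: cinner_add_left)

lemma cinner_sum_right: "cinner y (sum f A) = (\<Sum>i\<in>A. cinner y (f i))"
  by (subst (1 2) cinner_commute) (simp add: cinner_sum_left)

lemma cinner_zero_left [simp]: "cinner 0 y = 0"
  using cinner_scaleC_left[of 0 0 y] by simp

lemma cinner_uminus_left: "cinner (- x) y = - cinner x y"
  by (metis add.right_inverse add_eq_0_iff cinner_add_left cinner_zero_left)

lemma cinner_diff_left: "cinner (x - y) z = cinner x z - cinner y z"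
  using cinner_add_left[of x "- y" z] by (simp add: cinner_uminus_left)

lemma cinner_self: "cinner x x = complex_of_real ((norm x)\<^sup>2)"
proof -
  have "Im (cinner x x) = 0"
    using cinner_commute[of x x] by (simp add: complex_eq_iff)
  moreover have "Re (cinner x x) = (norm x)\<^sup>2"
    by (simp add: inner_cinner[symmetric] power2_norm_eq_inner)
  ultimately show ?thesis by (simp add: complex_eq_iff)
qed

lemma cinner_eqI:
  assumes "\<And>x. cinner x y = cinner x z"
  shows "y = z"
proof -
  have "inner x (y - z) = 0" for x
    using assms by (simp add: inner_diff_right) (simp add: inner_cinner)
  from this[of "y - z"] show ?thesis by simp
qed

lemma cinner_eqI_Re:
  assumes "\<And>x. Re (f x) = inner x y"
    and "\<And>c x. f (c *\<^sub>C x) = c * f x"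
  shows "f x = cinner x y"
proof -
  have "Im (f x) = Re (f ((- \<i>) *\<^sub>C x))"
    by (subst assms(2)) simp
  also have "\<dots> = Re (cinner ((- \<i>) *\<^sub>C x) y)"
    by (simp only: assms(1) inner_cinner)
  also have "\<dots> = Im (cinner x y)"
    by (subst cinner_scaleC_left) simp
  finally show ?thesis
    using assms(1)[of x] by (simp add: complex_eq_iff inner_cinner)
qed

lemma riesz_real:
  fixes g :: "'h::{real_inner, complete_space} \<Rightarrow> real"
  assumes g: "bounded_linear g"
  shows "\<exists>y. \<forall>x. g x = inner x y"
proof -
  interpret g: bounded_linear g by fact
  obtain K where K: "\<And>x. norm (g x) \<le> norm x * K"
    using g.bounded by blast
  define \<phi> where "\<phi> x = (norm x)\<^sup>2 / 2 - g x" for x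
  have low: "- (K\<^sup>2 / 2) \<le> \<phi> x" for x
  proof -
    have "g x \<le> norm x * K" using K[of x] by simp
    moreover have "0 \<le> (norm x - K)\<^sup>2" by simp
    ultimately show ?thesis
      by (simp add: \<phi>_def power2_eq_square algebra_simps)
  qed
  define m where "m = (INF x. \<phi> x)"
  have bdd: "bdd_below (range \<phi>)"
    using low by (intro bdd_belowI2)
  have m_le: "m \<le> \<phi> x" for x
    unfolding m_def by (intro cINF_lower bdd) auto
  have "\<exists>x. \<phi> x < m + 1 / real (Suc n)" for n
  proof -
    have "m < m + 1 / real (Suc n)" by simp
    then show ?thesis
      unfolding m_def[symmetric] using cINF_less_iff[OF _ bdd, of "m + 1 / real (Suc n)"]
      by (simp add: m_def)
  qed
  then obtain s where s: "\<And>n. \<phi> (s n) < m + 1 / real (Suc n)"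
    by metis
  have par: "(norm (x - y))\<^sup>2 = 4 * \<phi> x + 4 * \<phi> y - 8 * \<phi> ((1/2) *\<^sub>R (x + y))" for x y
    by (simp add: \<phi>_def g.add g.scaleR power_mult_distrib power_divide
        power2_norm_eq_inner inner_simps inner_commute field_simps)
  have dist: "(norm (s i - s j))\<^sup>2 < 4 / real (Suc i) + 4 / real (Suc j)" for i j
    using par[of "s i" "s j"] s[of i] s[of j] m_le[of "(1/2) *\<^sub>R (s i + s j)"] by linarith
  have "Cauchy s"
  proof (rule metric_CauchyI)
    fix e :: real assume e: "0 < e"
    obtain N where N: "8 / e\<^sup>2 < real N"
      using reals_Archimedean2 by blast
    have "dist (s i) (s j) < e" if "i \<ge> N" "j \<ge> N" for i j
    proof -
      have Npos: "0 < real N"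
        using N e by (meson divide_pos_pos less_trans zero_less_numeral zero_less_power)
      have "4 / real (Suc i) \<le> 4 / real N" "4 / real (Suc j) \<le> 4 / real N"
        using that Npos by (auto intro!: divide_left_mono)
      moreover have "8 / real N < e\<^sup>2"
        using N e Npos by (simp add: field_simps)
      ultimately have "(norm (s i - s j))\<^sup>2 < e\<^sup>2"
        using dist[of i j] by linarith
      then show ?thesis
        using e by (simp add: dist_norm power_less_imp_less_base)
    qed
    then show "\<exists>N. \<forall>i\<ge>N. \<forall>j\<ge>N. dist (s i) (s j) < e" by blast
  qed
  then obtain y where y: "s \<longlonglongrightarrow> y"
    using Cauchy_convergent_iff convergent_def by blast
  have "(\<lambda>n. \<phi> (s n)) \<longlonglongrightarrow> \<phi> y"
    unfolding \<phi>_def by (intro tendsto_intros y g.tendsto) simp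
  moreover have "(\<lambda>n. m + 1 / real (Suc n)) \<longlonglongrightarrow> m + 0"
    using tendsto_add[OF tendsto_const LIMSEQ_inverse_real_of_nat, of m] by (simp add: inverse_eq_divide)
  ultimately have "\<phi> y \<le> m + 0"
    by (rule LIMSEQ_le) (use s less_imp_le in blast)
  then have min: "\<phi> y \<le> \<phi> x" for x
    using m_le[of x] by simp
  have "g x = inner x y" for x
  proof -
    define a where "a = inner x y - g x"
    have q: "0 \<le> t * a + t\<^sup>2 * ((norm x)\<^sup>2 / 2)" for t
    proof -
      have "(norm (y + t *\<^sub>R x))\<^sup>2 = (norm y)\<^sup>2 + 2 * (t * inner x y) + t\<^sup>2 * (norm x)\<^sup>2"
        unfolding power2_norm_eq_inner
        by (simp add: inner_add_left inner_add_right inner_commute power2_eq_square)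
      then show ?thesis
        using min[of "y + t *\<^sub>R x"]
        by (simp add: \<phi>_def a_def g.add g.scaleR add_divide_distrib right_diff_distrib)
    qed
    have "a = 0"
    proof (rule ccontr)
      assume "a \<noteq> 0"
      define N where "N = (norm x)\<^sup>2 / 2 + 1"
      have N: "N > 0" by (simp add: N_def add_nonneg_pos)
      have "0 \<le> (- a / N) * a + (- a / N)\<^sup>2 * (N - 1)"
        using q[of "- a / N"] by (simp add: N_def)
      also have "\<dots> = - (a\<^sup>2 / N\<^sup>2)"
        using N by (simp add: field_simps power2_eq_square)
      also have "\<dots> < 0"
        using N \<open>a \<noteq> 0\<close> by simp
      finally show False by simp
    qed
    then show ?thesis by (simp add: a_def)
  qed
  then show ?thesis by blast
qed

lemma scaleC_complex_bounded_linear: "bounded_linear (scaleC c :: 'a::complex_normed_vector \<Rightarrow> 'a)"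
  by (rule bounded_linear_intro[where K = "cmod c"])
    (simp_all add: scaleC_add_right scaleR_scaleC scaleC_scaleC norm_scaleC mult.commute)

typedef (overloaded) 'h bop =
  "{T :: 'h::complex_hilbert_space \<Rightarrow>\<^sub>L 'h. \<forall>c x. blinfun_apply T (c *\<^sub>C x) = c *\<^sub>C blinfun_apply T x}"
  by (rule exI[of _ 0]) simp

setup_lifting type_definition_bop

lift_definition bop_apply :: "'h::complex_hilbert_space bop \<Rightarrow> 'h \<Rightarrow> 'h" is blinfun_apply .

lemma bop_eqI: "(\<And>x. bop_apply S x = bop_apply T x) \<Longrightarrow> S = T"
  by transfer (rule blinfun_eqI)

lemma bop_apply_scaleC: "bop_apply T (c *\<^sub>C x) = c *\<^sub>C bop_apply T x"
  by transfer simp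

lemma bop_apply_bounded_linear: "bounded_linear (bop_apply T)"
  by transfer (rule blinfun.bounded_linear_right)

lift_definition bop_of :: "('h::complex_hilbert_space \<Rightarrow> 'h) \<Rightarrow> 'h bop" is
  "\<lambda>f. if bounded_linear f \<and> (\<forall>c x. f (c *\<^sub>C x) = c *\<^sub>C f x) then Blinfun f else 0"
  by (simp add: bounded_linear_Blinfun_apply)

lemma bop_apply_bop_of:
  assumes "bounded_linear f" "\<And>c x. f (c *\<^sub>C x) = c *\<^sub>C f x"
  shows "bop_apply (bop_of f) = f"
  using assms by transfer (simp add: bounded_linear_Blinfun_apply)

instantiation bop :: (complex_hilbert_space) complex_normed_vector
begin

lift_definition zero_bop :: "'a bop" is 0 by simp
lift_definition plus_bop :: "'a bop \<Rightarrow> 'a bop \<Rightarrow> 'a bop" is "(+)"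
  by (simp add: blinfun.bilinear_simps scaleC_add_right)
lift_definition uminus_bop :: "'a bop \<Rightarrow> 'a bop" is uminus
  by (simp add: blinfun.bilinear_simps)
lift_definition minus_bop :: "'a bop \<Rightarrow> 'a bop \<Rightarrow> 'a bop" is "(-)"
  by (simp add: blinfun.bilinear_simps complex_vector.scale_right_diff_distrib)
lift_definition scaleR_bop :: "real \<Rightarrow> 'a bop \<Rightarrow> 'a bop" is scaleR
  by (simp add: blinfun.bilinear_simps scaleR_scaleC scaleC_scaleC mult.commute)
lift_definition scaleC_bop :: "complex \<Rightarrow> 'a bop \<Rightarrow> 'a bop" is
  "\<lambda>c T. Blinfun (\<lambda>x. c *\<^sub>C blinfun_apply T x)"
  by (subst (1 2) bounded_linear_Blinfun_apply)
    (auto intro: bounded_linear_compose[OF scaleC_complex_bounded_linear blinfun.bounded_linear_right]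
      simp: scaleC_scaleC mult.commute)
lift_definition norm_bop :: "'a bop \<Rightarrow> real" is norm .
definition dist_bop :: "'a bop \<Rightarrow> 'a bop \<Rightarrow> real" where "dist_bop S T = norm (S - T)"
definition sgn_bop :: "'a bop \<Rightarrow> 'a bop" where "sgn_bop T = scaleR (inverse (norm T)) T"
definition uniformity_bop :: "('a bop \<times> 'a bop) filter"
  where "uniformity_bop = (INF e\<in>{0<..}. principal {(x, y). dist x y < e})"
definition open_bop :: "'a bop set \<Rightarrow> bool"
  where "open_bop U = (\<forall>x\<in>U. \<forall>\<^sub>F (x', y) in uniformity. x' = x \<longrightarrow> y \<in> U)"

lemma bop_apply_simps:
  "bop_apply 0 x = 0"
  "bop_apply (S + T) x = bop_apply S x + bop_apply T x"
  "bop_apply (S - T) x = bop_apply S x - bop_apply T x"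
  "bop_apply (- T) x = - bop_apply T x"
  "bop_apply (r *\<^sub>R T) x = r *\<^sub>R bop_apply T x"
  "bop_apply (c *\<^sub>C T) x = c *\<^sub>C bop_apply T x"
proof -
  show "bop_apply (c *\<^sub>C T) x = c *\<^sub>C bop_apply T x"
    by transfer (simp add: bounded_linear_Blinfun_apply
      bounded_linear_compose[OF scaleC_complex_bounded_linear blinfun.bounded_linear_right])
qed (transfer, simp add: blinfun.bilinear_simps)+

lemma norm_bop_apply: "norm (bop_apply T x) \<le> norm T * norm x"
  by transfer (rule norm_blinfun)

lemma norm_bop_le:
  assumes "0 \<le> b" "\<And>x. norm (bop_apply T x) \<le> b * norm x"
  shows "norm T \<le> b"
  using assms by transfer (rule norm_blinfun_bound)

instance
proof
  fix x y z :: "'a bop" and a b :: real and c d :: complex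
  show "x + y + z = x + (y + z)" "x + y = y + x" "0 + x = x" "- x + x = 0" "x - y = x + - y"
    "a *\<^sub>R (x + y) = a *\<^sub>R x + a *\<^sub>R y" "(a + b) *\<^sub>R x = a *\<^sub>R x + b *\<^sub>R x"
    "a *\<^sub>R b *\<^sub>R x = (a * b) *\<^sub>R x" "1 *\<^sub>R x = x"
    by (auto intro!: bop_eqI simp: bop_apply_simps algebra_simps)
  show "c *\<^sub>C (x + y) = c *\<^sub>C x + c *\<^sub>C y" "(c + d) *\<^sub>C x = c *\<^sub>C x + d *\<^sub>C x"
    "c *\<^sub>C d *\<^sub>C x = (c * d) *\<^sub>C x" "a *\<^sub>R x = complex_of_real a *\<^sub>C x"
    by (auto intro!: bop_eqI simp: bop_apply_simps scaleC_add_left scaleC_add_right scaleC_scaleC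
        scaleR_scaleC)
  show "dist x y = norm (x - y)" by (rule dist_bop_def)
  show "sgn x = scaleR (inverse (norm x)) x" by (rule sgn_bop_def)
  show "uniformity = (INF e\<in>{0<..}. principal {(x :: 'a bop, y). dist x y < e})"
    by (rule uniformity_bop_def)
  show "open U = (\<forall>x\<in>U. \<forall>\<^sub>F (x', y) in uniformity. x' = x \<longrightarrow> y \<in> U)" for U :: "'a bop set"
    by (rule open_bop_def)
  show "norm x = 0 \<longleftrightarrow> x = 0" by transfer simp
  show "norm (x + y) \<le> norm x + norm y" by transfer (rule norm_triangle_ineq)
  show "norm (a *\<^sub>R x) = \<bar>a\<bar> * norm x" by transfer simp
  show "norm (c *\<^sub>C x) = cmod c * norm x"
  proof (cases "c = 0")
    case True
    have "0 *\<^sub>C x = 0" by (rule bop_eqI) (simp add: bop_apply_simps)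
    then show ?thesis using True by transfer simp
  next
    case False
    have le: "norm (d *\<^sub>C y) \<le> cmod d * norm y" for d and y :: "'a bop"
      by (rule norm_bop_le)
        (auto simp: bop_apply_simps norm_scaleC mult.assoc norm_bop_apply
          intro!: mult_left_mono mult_nonneg_nonneg, transfer, simp)
    have "inverse c *\<^sub>C c *\<^sub>C x = x"
      using False by (intro bop_eqI) (simp add: bop_apply_simps scaleC_scaleC)
    then have "norm x \<le> inverse (cmod c) * norm (c *\<^sub>C x)"
      using le[of "inverse c" "c *\<^sub>C x"] by (simp add: norm_inverse)
    then have "cmod c * norm x \<le> norm (c *\<^sub>C x)"
      using False by (simp add: field_simps)
    then show ?thesis using le[of c x] by simp
  qed
qed

end

lemma bop_apply_sum: "bop_apply (sum f A) x = (\<Sum>i\<in>A. bop_apply (f i) x)"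
  by (induction A rule: infinite_finite_induct) (auto simp: bop_apply_simps)

lemma bop_apply_tendsto:
  assumes "(f \<longlongrightarrow> T) F"
  shows "((\<lambda>n. bop_apply (f n) x) \<longlongrightarrow> bop_apply T x) F"
proof -
  have "bounded_linear (\<lambda>S. bop_apply S x)"
    by (rule bounded_linear_intro[where K = "norm x"]) (simp_all add: bop_apply_simps norm_bop_apply)
  from bounded_linear.tendsto[OF this assms] show ?thesis .
qed

lemma bop_adjoint_exists:
  fixes T :: "'h::complex_hilbert_space bop"
  shows "\<exists>S. \<forall>x y. cinner (bop_apply T x) y = cinner x (bop_apply S y)"
proof -
  interpret T: bounded_linear "bop_apply T" by (rule bop_apply_bounded_linear)
  have "\<exists>z. \<forall>x. cinner (bop_apply T x) y = cinner x z" for y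
  proof -
    have "bounded_linear (\<lambda>x. inner (bop_apply T x) y)"
      by (rule bounded_linear_compose[OF bounded_linear_inner_left bop_apply_bounded_linear])
    then obtain z where "\<forall>x. inner (bop_apply T x) y = inner x z"
      using riesz_real by blast
    then have "cinner (bop_apply T x) y = cinner x z" for x
      by (intro cinner_eqI_Re)
        (auto simp: inner_cinner bop_apply_scaleC cinner_scaleC_left)
    then show ?thesis by blast
  qed
  then obtain s where s: "\<And>x y. cinner (bop_apply T x) y = cinner x (s y)" by metis
  have add: "s (x + y) = s x + s y" for x y
    by (rule cinner_eqI) (simp add: s[symmetric] cinner_add_right)
  have scl: "s (c *\<^sub>C x) = c *\<^sub>C s x" for c x
    by (rule cinner_eqI) (simp add: s[symmetric] cinner_scaleC_right)
  have bound: "norm (s x) \<le> norm x * norm T" for x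
  proof (cases "s x = 0")
    case False
    have "norm (s x) * norm (s x) = inner (bop_apply T (s x)) x"
      using s[of "s x" x] by (simp add: inner_cinner cinner_self power2_eq_square)
    also have "\<dots> \<le> norm (bop_apply T (s x)) * norm x"
      by (rule norm_cauchy_schwarz)
    also have "\<dots> \<le> (norm T * norm (s x)) * norm x"
      by (intro mult_right_mono norm_bop_apply) simp
    finally have "norm (s x) * norm (s x) \<le> (norm x * norm T) * norm (s x)"
      by (simp add: ac_simps)
    with False show ?thesis by simp
  qed simp
  have "bounded_linear s"
    by (rule bounded_linear_intro[where K = "norm T"]) (simp_all add: add scaleR_scaleC scl bound)
  then have "bop_apply (bop_of s) = s"
    by (rule bop_apply_bop_of) (rule scl)
  with s show ?thesis by metis
qed

lemma norm_bop_compose: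
  assumes "\<And>x. bop_apply U x = bop_apply S (bop_apply T x)"
  shows "norm U \<le> norm S * norm T"
proof (rule norm_bop_le)
  show "norm (bop_apply U x) \<le> norm S * norm T * norm x" for x
    using norm_bop_apply[of S "bop_apply T x"]
      mult_left_mono[OF norm_bop_apply[of T x] norm_ge_zero[of S]]
    by (simp add: assms mult.assoc)
qed simp

lemma norm_bop_star_aux:
  assumes "\<And>x y. cinner (bop_apply T x) y = cinner x (bop_apply S y)"
    and "\<And>x. bop_apply U x = bop_apply S (bop_apply T x)"
  shows "(norm T)\<^sup>2 \<le> norm U"
proof -
  have "norm T \<le> sqrt (norm U)"
  proof (rule norm_bop_le)
    fix x
    have "complex_of_real ((norm (bop_apply T x))\<^sup>2) = cinner x (bop_apply U x)"
      using assms(1)[of x "bop_apply T x"] by (simp add: assms(2) cinner_self)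
    then have "(norm (bop_apply T x))\<^sup>2 = inner x (bop_apply U x)"
      by (metis Re_complex_of_real inner_cinner)
    also have "\<dots> \<le> norm x * norm (bop_apply U x)" by (rule norm_cauchy_schwarz)
    also have "\<dots> \<le> norm x * (norm U * norm x)" by (intro mult_left_mono norm_bop_apply) simp
    also have "\<dots> = (sqrt (norm U) * norm x)\<^sup>2" by (simp add: power_mult_distrib power2_eq_square)
    finally show "norm (bop_apply T x) \<le> sqrt (norm U) * norm x"
      by (rule power2_le_imp_le) simp
  qed simp
  then show ?thesis
    by (metis norm_ge_zero power_mono real_sqrt_pow2)
qed

instantiation bop :: (complex_hilbert_space) unital_cstar_algebra
begin

lift_definition one_bop :: "'a bop" is id_blinfun by simp
lift_definition times_bop :: "'a bop \<Rightarrow> 'a bop \<Rightarrow> 'a bop" is "(o\<^sub>L)" by simp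
definition star_bop :: "'a bop \<Rightarrow> 'a bop"
  where "star_bop T = (SOME S. \<forall>x y. cinner (bop_apply T x) y = cinner x (bop_apply S y))"

lemma bop_apply_one: "bop_apply 1 x = x"
  by transfer simp

lemma bop_apply_times: "bop_apply (S * T) x = bop_apply S (bop_apply T x)"
  by transfer simp

lemma cinner_star: "cinner (bop_apply T x) y = cinner x (bop_apply (star T) y)"
  unfolding star_bop_def using someI_ex[OF bop_adjoint_exists[of T]] by blast

lemma cinner_star': "cinner (bop_apply (star T) x) y = cinner x (bop_apply T y)"
  using cinner_star[of T y x] by (metis cinner_commute)

instance
proof
  fix x y z :: "'a bop" and r :: real and c :: complex
  show "x * y * z = x * (y * z)" "(x + y) * z = x * z + y * z" "1 * x = x" "x * 1 = x"
    by (rule bop_eqI, simp add: bop_apply_times bop_apply_simps bop_apply_one)+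
  interpret X: bounded_linear "bop_apply x" by (rule bop_apply_bounded_linear)
  show "x * (y + z) = x * y + x * z" "r *\<^sub>R x * y = r *\<^sub>R (x * y)" "x * r *\<^sub>R y = r *\<^sub>R (x * y)"
    by (rule bop_eqI, simp add: bop_apply_times bop_apply_simps X.add X.scaleR)+
  show "c *\<^sub>C x * y = c *\<^sub>C (x * y)" "x * c *\<^sub>C y = c *\<^sub>C (x * y)"
    by (rule bop_eqI, simp add: bop_apply_times bop_apply_simps bop_apply_scaleC)+
  show mul: "norm (x * y) \<le> norm x * norm y" for x y :: "'a bop"
    by (rule norm_bop_compose) (simp add: bop_apply_times)
  show "star (star x) = x" "star (x + y) = star x + star y" "star (c *\<^sub>C x) = cnj c *\<^sub>C star x"
    "star (x * y) = star y * star x"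
    by (rule bop_eqI, rule cinner_eqI, simp add: cinner_star[symmetric] cinner_star' bop_apply_simps
        bop_apply_times cinner_add_left cinner_add_right cinner_scaleC_left cinner_scaleC_right)+
  have le: "(norm T)\<^sup>2 \<le> norm (star T * T)" for T :: "'a bop"
    by (rule norm_bop_star_aux[of _ "star T"]) (simp_all add: cinner_star bop_apply_times)
  have "norm T \<le> norm (star T)" for T :: "'a bop"
  proof (cases "norm T = 0")
    case False
    have "norm T * norm T \<le> norm (star T) * norm T"
      using le[of T] mul[of "star T" T] unfolding power2_eq_square by linarith
    with False show ?thesis by simp
  qed simp
  from this[of "star x"] have "norm (star x) \<le> norm x" by (simp only: \<open>star (star x) = x\<close>)
  then have "norm (star x * x) \<le> norm x * norm x"
    using mul[of "star x" x] mult_right_mono[OF _ norm_ge_zero, of "norm (star x)" "norm x" x] by linarith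
  with le[of x] show "norm (star x * x) = (norm x)\<^sup>2"
    unfolding power2_eq_square by linarith
next
  fix X :: "nat \<Rightarrow> 'a bop"
  assume X: "Cauchy X"
  have nrm: "norm (Rep_bop S - Rep_bop T) = norm (S - T)" for S T :: "'a bop"
    by transfer simp
  from X nrm have "Cauchy (\<lambda>n. Rep_bop (X n))"
    by (simp only: Cauchy_def dist_norm)
  then obtain L where L: "(\<lambda>n. Rep_bop (X n)) \<longlonglongrightarrow> L"
    using Cauchy_convergent_iff convergent_def by blast
  have "blinfun_apply L (c *\<^sub>C x) = c *\<^sub>C blinfun_apply L x" for c x
  proof (rule LIMSEQ_unique)
    show "(\<lambda>n. blinfun_apply (Rep_bop (X n)) (c *\<^sub>C x)) \<longlonglongrightarrow> blinfun_apply L (c *\<^sub>C x)"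
      by (intro tendsto_intros L)
    have "(\<lambda>n. c *\<^sub>C blinfun_apply (Rep_bop (X n)) x) \<longlonglongrightarrow> c *\<^sub>C blinfun_apply L x"
      by (intro bounded_linear.tendsto[OF scaleC_complex_bounded_linear] tendsto_intros L)
    moreover have "blinfun_apply (Rep_bop (X n)) (c *\<^sub>C x) = c *\<^sub>C blinfun_apply (Rep_bop (X n)) x" for n
      by (rule Rep_bop[of "X n", unfolded mem_Collect_eq, rule_format])
    ultimately show "(\<lambda>n. blinfun_apply (Rep_bop (X n)) (c *\<^sub>C x)) \<longlonglongrightarrow> c *\<^sub>C blinfun_apply L x"
      by (simp only:)
  qed
  then have "Rep_bop (Abs_bop L) = L"
    by (intro Abs_bop_inverse CollectI allI)
  then have "norm (X n - Abs_bop L) = norm (Rep_bop (X n) - L)" for n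
    using nrm[of "X n" "Abs_bop L"] by (simp only:)
  with L have "X \<longlonglongrightarrow> Abs_bop L"
    by (simp only: LIMSEQ_iff)
  then show "convergent X" by (rule convergentI)
qed

end

text \<open>The norm of \<open>M\<^sub>n(B(H)) = B(H\<^sup>n)\<close>: the operator norm on the \<open>\<ell>\<^sup>2\<close>-direct sum of \<open>n\<close> copies of
  \<open>H\<close>, whose elements are represented by \<open>\<xi> 0, \<dots>, \<xi> (n - 1)\<close>.\<close>

definition bop_mat_apply :: "'h::complex_hilbert_space bop mat \<Rightarrow> (nat \<Rightarrow> 'h) \<Rightarrow> nat \<Rightarrow> 'h"
  where "bop_mat_apply A \<xi> i = (\<Sum>j<dim_col A. bop_apply (A $$ (i, j)) (\<xi> j))"

definition tuple_norm :: "nat \<Rightarrow> (nat \<Rightarrow> 'h::complex_hilbert_space) \<Rightarrow> real"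
  where "tuple_norm n \<xi> = sqrt (\<Sum>j<n. (norm (\<xi> j))\<^sup>2)"

definition bop_mat_norm :: "'h::complex_hilbert_space bop mat \<Rightarrow> real"
  where "bop_mat_norm A =
    (SUP \<xi>\<in>{\<xi>. tuple_norm (dim_col A) \<xi> \<le> 1}. tuple_norm (dim_row A) (bop_mat_apply A \<xi>))"

lemma tuple_norm_L2: "tuple_norm n \<xi> = L2_set (\<lambda>j. norm (\<xi> j)) {..<n}"
  by (simp add: tuple_norm_def L2_set_def)

lemma tuple_norm_ge_zero: "0 \<le> tuple_norm n \<xi>"
  by (simp add: tuple_norm_L2)

lemma norm_le_tuple_norm: "j < n \<Longrightarrow> norm (\<xi> j) \<le> tuple_norm n \<xi>"
  unfolding tuple_norm_L2 by (rule member_le_L2_set) auto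

lemma tuple_norm_le_sum: "tuple_norm n \<xi> \<le> (\<Sum>j<n. norm (\<xi> j))"
  unfolding tuple_norm_L2 by (rule L2_set_le_sum) simp

lemma tuple_norm_triangle: "tuple_norm n (\<lambda>i. \<xi> i + \<eta> i) \<le> tuple_norm n \<xi> + tuple_norm n \<eta>"
proof -
  have "L2_set (\<lambda>j. norm (\<xi> j + \<eta> j)) {..<n} \<le> L2_set (\<lambda>j. norm (\<xi> j) + norm (\<eta> j)) {..<n}"
    by (rule L2_set_mono) (auto intro: norm_triangle_ineq)
  also have "\<dots> \<le> L2_set (\<lambda>j. norm (\<xi> j)) {..<n} + L2_set (\<lambda>j. norm (\<eta> j)) {..<n}"
    by (rule L2_set_triangle_ineq)
  finally show ?thesis by (simp only: tuple_norm_L2)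
qed

lemma tuple_norm_scaleC: "tuple_norm n (\<lambda>i. c *\<^sub>C \<xi> i) = cmod c * tuple_norm n \<xi>"
  unfolding tuple_norm_L2 norm_scaleC by (simp add: L2_set_right_distrib)

lemma tuple_norm_cong: "(\<And>i. i < n \<Longrightarrow> \<xi> i = \<eta> i) \<Longrightarrow> tuple_norm n \<xi> = tuple_norm n \<eta>"
  by (simp add: tuple_norm_def)

lemma cinner_tuple_le:
  "cmod (\<Sum>i<n. cinner (\<xi> i) (\<eta> i)) \<le> tuple_norm n \<xi> * tuple_norm n \<eta>"
proof -
  have CS: "cmod (cinner x y) \<le> norm x * norm y" for x y :: 'a
  proof (cases "cinner x y = 0")
    case False
    define c where "c = cnj (cinner x y) / complex_of_real (cmod (cinner x y))"
    have c: "cmod c = 1" using False by (simp add: c_def norm_divide)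
    have "cinner (c *\<^sub>C x) y = complex_of_real (cmod (cinner x y))"
    proof -
      have "cnj (cinner x y) * cinner x y =
          complex_of_real (cmod (cinner x y)) * complex_of_real (cmod (cinner x y))"
        by (metis complex_norm_square mult.commute of_real_power power2_eq_square)
      then show ?thesis
        using False unfolding cinner_scaleC_left c_def by (simp add: field_simps)
    qed
    then have "cmod (cinner x y) = inner (c *\<^sub>C x) y"
      unfolding inner_cinner by simp
    also have "\<dots> \<le> norm (c *\<^sub>C x) * norm y" by (rule norm_cauchy_schwarz)
    finally show ?thesis by (simp add: norm_scaleC c)
  qed simp
  have "cmod (\<Sum>i<n. cinner (\<xi> i) (\<eta> i)) \<le> (\<Sum>i<n. \<bar>norm (\<xi> i)\<bar> * \<bar>norm (\<eta> i)\<bar>)"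
    using CS by (intro sum_norm_le) simp
  also have "\<dots> \<le> tuple_norm n \<xi> * tuple_norm n \<eta>"
    unfolding tuple_norm_L2 by (rule L2_set_mult_ineq)
  finally show ?thesis .
qed

lemma bop_mat_apply_scaleC: "bop_mat_apply A (\<lambda>j. c *\<^sub>C \<xi> j) = (\<lambda>i. c *\<^sub>C bop_mat_apply A \<xi> i)"
  by (rule ext) (simp add: bop_mat_apply_def bop_apply_scaleC complex_vector.scale_sum_right)

lemma bop_mat_norm_bdd:
  "bdd_above ((\<lambda>\<xi>. tuple_norm (dim_row A) (bop_mat_apply A \<xi>)) ` {\<xi>. tuple_norm (dim_col A) \<xi> \<le> 1})"
proof (rule bdd_aboveI2)
  fix \<xi> :: "nat \<Rightarrow> 'a" assume "\<xi> \<in> {\<xi>. tuple_norm (dim_col A) \<xi> \<le> 1}"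
  then have \<xi>: "norm (\<xi> j) \<le> 1" if "j < dim_col A" for j
    using norm_le_tuple_norm[OF that, of \<xi>] by simp
  have "tuple_norm (dim_row A) (bop_mat_apply A \<xi>) \<le> (\<Sum>i<dim_row A. norm (bop_mat_apply A \<xi> i))"
    by (rule tuple_norm_le_sum)
  also have "\<dots> \<le> (\<Sum>i<dim_row A. \<Sum>j<dim_col A. norm (A $$ (i, j)))"
  proof (intro sum_mono)
    fix i
    show "norm (bop_mat_apply A \<xi> i) \<le> (\<Sum>j<dim_col A. norm (A $$ (i, j)))"
      unfolding bop_mat_apply_def
    proof (rule sum_norm_le)
      fix j assume "j \<in> {..<dim_col A}"
      then have "norm (A $$ (i, j)) * norm (\<xi> j) \<le> norm (A $$ (i, j)) * 1"
        using \<xi>[of j] by (intro mult_left_mono) auto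
      then show "norm (bop_apply (A $$ (i, j)) (\<xi> j)) \<le> norm (A $$ (i, j))"
        using norm_bop_apply[of "A $$ (i, j)" "\<xi> j"] by linarith
    qed
  qed
  finally show "tuple_norm (dim_row A) (bop_mat_apply A \<xi>) \<le> (\<Sum>i<dim_row A. \<Sum>j<dim_col A. norm (A $$ (i, j)))" .
qed

lemma tuple_norm_zero: "tuple_norm n (\<lambda>_. 0) = 0"
  by (simp add: tuple_norm_def)

lemma bop_mat_norm_ge_zero: "0 \<le> bop_mat_norm A"
  unfolding bop_mat_norm_def
  by (rule cSUP_upper2[OF bop_mat_norm_bdd, of "\<lambda>_. 0"]) (simp_all add: tuple_norm_zero tuple_norm_ge_zero)

lemma bop_mat_norm_apply:
  "tuple_norm (dim_row A) (bop_mat_apply A \<xi>) \<le> bop_mat_norm A * tuple_norm (dim_col A) \<xi>"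
proof (cases "tuple_norm (dim_col A) \<xi> = 0")
  case True
  then have "norm (\<xi> j) = 0" if "j < dim_col A" for j
    using norm_le_tuple_norm[OF that, of \<xi>] by (metis norm_le_zero_iff norm_zero)
  then have "bop_mat_apply A \<xi> i = 0" for i
    unfolding bop_mat_apply_def
    by (intro sum.neutral) (auto simp: bounded_linear.linear[OF bop_apply_bounded_linear] linear_0)
  then have "tuple_norm (dim_row A) (bop_mat_apply A \<xi>) = 0"
    by (simp add: tuple_norm_def)
  then show ?thesis by (simp only: True)
next
  case False
  define t where "t = tuple_norm (dim_col A) \<xi>"
  have t: "t > 0" using False tuple_norm_ge_zero[of "dim_col A" \<xi>] by (simp add: t_def)
  define c where "c = complex_of_real (inverse t)"
  have c: "cmod c = inverse t" using t unfolding c_def norm_of_real by simp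
  have "tuple_norm (dim_row A) (bop_mat_apply A (\<lambda>j. c *\<^sub>C \<xi> j)) \<le> bop_mat_norm A"
    unfolding bop_mat_norm_def
    by (rule cSUP_upper[OF _ bop_mat_norm_bdd]) (use t in \<open>simp add: tuple_norm_scaleC c t_def[symmetric]\<close>)
  then have "inverse t * tuple_norm (dim_row A) (bop_mat_apply A \<xi>) \<le> bop_mat_norm A"
    by (simp add: bop_mat_apply_scaleC tuple_norm_scaleC c)
  then show ?thesis using t by (simp add: t_def[symmetric] field_simps)
qed

lemma bop_mat_norm_le:
  fixes A :: "'h::complex_hilbert_space bop mat"
  assumes "0 \<le> b"
    and "\<And>\<xi>. tuple_norm (dim_row A) (bop_mat_apply A \<xi>) \<le> b * tuple_norm (dim_col A) \<xi>"
  shows "bop_mat_norm A \<le> b"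
  unfolding bop_mat_norm_def
proof (rule cSUP_least)
  show "{\<xi>. tuple_norm (dim_col A) \<xi> \<le> 1} \<noteq> {}"
    using tuple_norm_zero[of "dim_col A"] by (metis (mono_tags) empty_iff mem_Collect_eq zero_le_one)
next
  fix \<xi> :: "nat \<Rightarrow> 'h" assume "\<xi> \<in> {\<xi>. tuple_norm (dim_col A) \<xi> \<le> 1}"
  then have "b * tuple_norm (dim_col A) \<xi> \<le> b * 1"
    using assms(1) by (intro mult_left_mono) auto
  with assms(2)[of \<xi>] show "tuple_norm (dim_row A) (bop_mat_apply A \<xi>) \<le> b" by simp
qed

lemma bop_mat_apply_times:
  assumes "i < n"
  shows "bop_mat_apply (mat n n (\<lambda>(i, j). \<Sum>k<n. f i k * g k j)) \<xi> i =
    bop_mat_apply (mat n n (\<lambda>(i, j). f i j)) (bop_mat_apply (mat n n (\<lambda>(i, j). g i j)) \<xi>) i"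
proof -
  have "bop_mat_apply (mat n n (\<lambda>(i, j). \<Sum>k<n. f i k * g k j)) \<xi> i =
      (\<Sum>j<n. \<Sum>k<n. bop_apply (f i k) (bop_apply (g k j) (\<xi> j)))"
    using assms by (simp add: bop_mat_apply_def bop_apply_sum bop_apply_times)
  also have "\<dots> = (\<Sum>k<n. \<Sum>j<n. bop_apply (f i k) (bop_apply (g k j) (\<xi> j)))"
    by (rule sum.swap)
  also have "\<dots> = (\<Sum>k<n. bop_apply (f i k) (\<Sum>j<n. bop_apply (g k j) (\<xi> j)))"
    by (simp add: linear_sum[OF bounded_linear.linear[OF bop_apply_bounded_linear]])
  finally show ?thesis
    using assms by (simp add: bop_mat_apply_def)
qed

lemma mat_entries: "x \<in> carrier_mat n n \<Longrightarrow> mat n n (($$) x) = x"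
  by (intro eq_matI) auto

lemma bop_mat_norm_times:
  assumes "x \<in> carrier_mat n n" "y \<in> carrier_mat n n"
  shows "bop_mat_norm (mat n n (\<lambda>(i, j). \<Sum>k<n. x $$ (i, k) * y $$ (k, j))) \<le> bop_mat_norm x * bop_mat_norm y"
    (is "bop_mat_norm ?z \<le> _")
proof (rule bop_mat_norm_le)
  fix \<xi>
  have "tuple_norm n (bop_mat_apply ?z \<xi>) = tuple_norm n (bop_mat_apply x (bop_mat_apply y \<xi>))"
    by (rule tuple_norm_cong) (simp add: bop_mat_apply_times mat_entries[OF assms(1)] mat_entries[OF assms(2)])
  also have "\<dots> \<le> bop_mat_norm x * tuple_norm n (bop_mat_apply y \<xi>)"
    using bop_mat_norm_apply[of x] assms by auto
  also have "\<dots> \<le> bop_mat_norm x * (bop_mat_norm y * tuple_norm n \<xi>)"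
    using bop_mat_norm_apply[of y] assms by (intro mult_left_mono bop_mat_norm_ge_zero) auto
  finally show "tuple_norm (dim_row ?z) (bop_mat_apply ?z \<xi>) \<le>
      bop_mat_norm x * bop_mat_norm y * tuple_norm (dim_col ?z) \<xi>"
    by (simp add: mult.assoc)
qed (simp add: bop_mat_norm_ge_zero)

lemma bop_mat_norm_square_le:
  assumes x: "x \<in> carrier_mat n n"
  shows "(bop_mat_norm x)\<^sup>2 \<le> bop_mat_norm (mat n n (\<lambda>(i, j). \<Sum>k<n. star (x $$ (k, i)) * x $$ (k, j)))"
    (is "_ \<le> bop_mat_norm ?z")
proof -
  have "bop_mat_norm x \<le> sqrt (bop_mat_norm ?z)"
  proof (rule bop_mat_norm_le)
    fix \<xi>
    define \<eta> where "\<eta> = bop_mat_apply x \<xi>"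
    have z: "bop_mat_apply ?z \<xi> j = (\<Sum>k<n. bop_apply (star (x $$ (k, j))) (\<eta> k))" if "j < n" for j
      using bop_mat_apply_times[OF that, of "\<lambda>i k. star (x $$ (k, i))" "\<lambda>i j. x $$ (i, j)" \<xi>]
      by (simp add: mat_entries[OF x] \<eta>_def[symmetric] bop_mat_apply_def[of "mat n n (\<lambda>(i, j). star (x $$ (j, i)))"] that)
    have "complex_of_real ((tuple_norm n \<eta>)\<^sup>2) = (\<Sum>k<n. cinner (\<eta> k) (\<eta> k))"
      by (simp add: tuple_norm_def cinner_self real_sqrt_pow2 sum_nonneg)
    also have "\<dots> = (\<Sum>k<n. \<Sum>j<n. cinner (bop_apply (x $$ (k, j)) (\<xi> j)) (\<eta> k))"
    proof (rule sum.cong[OF refl])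
      fix k
      have "\<eta> k = (\<Sum>j<n. bop_apply (x $$ (k, j)) (\<xi> j))"
        using x by (simp add: \<eta>_def bop_mat_apply_def)
      then show "cinner (\<eta> k) (\<eta> k) = (\<Sum>j<n. cinner (bop_apply (x $$ (k, j)) (\<xi> j)) (\<eta> k))"
        by (metis cinner_sum_left)
    qed
    also have "\<dots> = (\<Sum>j<n. \<Sum>k<n. cinner (\<xi> j) (bop_apply (star (x $$ (k, j))) (\<eta> k)))"
      unfolding cinner_star by (rule sum.swap)
    also have "\<dots> = (\<Sum>j<n. cinner (\<xi> j) (bop_mat_apply ?z \<xi> j))"
      by (intro sum.cong refl) (simp add: z cinner_sum_right)
    finally have "(tuple_norm n \<eta>)\<^sup>2 = cmod (\<Sum>j<n. cinner (\<xi> j) (bop_mat_apply ?z \<xi> j))"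
      by (metis norm_of_real abs_power2)
    also have "\<dots> \<le> tuple_norm n \<xi> * tuple_norm n (bop_mat_apply ?z \<xi>)"
      by (rule cinner_tuple_le)
    also have "\<dots> \<le> tuple_norm n \<xi> * (bop_mat_norm ?z * tuple_norm n \<xi>)"
      using bop_mat_norm_apply[of ?z \<xi>] by (intro mult_left_mono tuple_norm_ge_zero) simp
    also have "\<dots> = (sqrt (bop_mat_norm ?z) * tuple_norm n \<xi>)\<^sup>2"
      by (simp add: power_mult_distrib power2_eq_square bop_mat_norm_ge_zero)
    finally have "tuple_norm n \<eta> \<le> sqrt (bop_mat_norm ?z) * tuple_norm n \<xi>"
      by (rule power2_le_imp_le) (simp add: bop_mat_norm_ge_zero tuple_norm_ge_zero)
    then show "tuple_norm (dim_row x) (bop_mat_apply x \<xi>) \<le> sqrt (bop_mat_norm ?z) * tuple_norm (dim_col x) \<xi>"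
      using x by (simp add: \<eta>_def)
  qed (simp add: bop_mat_norm_ge_zero)
  then have "(bop_mat_norm x)\<^sup>2 \<le> (sqrt (bop_mat_norm ?z))\<^sup>2"
    by (intro power_mono bop_mat_norm_ge_zero)
  then show ?thesis by (simp only: real_sqrt_pow2[OF bop_mat_norm_ge_zero])
qed

lemma bop_mat_norm_star_times:
  assumes x: "x \<in> carrier_mat n n"
  shows "bop_mat_norm (mat n n (\<lambda>(i, j). \<Sum>k<n. star (x $$ (k, i)) * x $$ (k, j))) = (bop_mat_norm x)\<^sup>2"
proof -
  have star_mult: "bop_mat_norm (mat n n (\<lambda>(i, j). \<Sum>k<n. star (y $$ (k, i)) * y $$ (k, j))) \<le>
      bop_mat_norm (mat_star y) * bop_mat_norm y" if y: "y \<in> carrier_mat n n" for y :: "'a bop mat"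
  proof -
    have "mat_star y \<in> carrier_mat n n" using y by (simp add: mat_star_def)
    moreover have "mat n n (\<lambda>(i, j). \<Sum>k<n. mat_star y $$ (i, k) * y $$ (k, j)) =
        mat n n (\<lambda>(i, j). \<Sum>k<n. star (y $$ (k, i)) * y $$ (k, j))"
      using y by (intro eq_matI) (auto simp: mat_star_def intro!: sum.cong)
    ultimately show ?thesis using bop_mat_norm_times[of "mat_star y" n y] y by simp
  qed
  have le: "bop_mat_norm y \<le> bop_mat_norm (mat_star y)" if y: "y \<in> carrier_mat n n" for y :: "'a bop mat"
  proof (cases "bop_mat_norm y = 0")
    case False
    then have "0 < bop_mat_norm y" using bop_mat_norm_ge_zero[of y] by linarith
    moreover have "bop_mat_norm y * bop_mat_norm y \<le> bop_mat_norm (mat_star y) * bop_mat_norm y"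
      using bop_mat_norm_square_le[OF y] star_mult[OF y] unfolding power2_eq_square by linarith
    ultimately show ?thesis by simp
  qed (simp add: bop_mat_norm_ge_zero)
  have "mat_star (mat_star x) = x"
    by (intro eq_matI) (auto simp: mat_star_def star_star)
  moreover have "mat_star x \<in> carrier_mat n n" using x by (simp add: mat_star_def)
  ultimately have "bop_mat_norm (mat_star x) \<le> bop_mat_norm x" using le[of "mat_star x"] by simp
  then have "bop_mat_norm (mat_star x) * bop_mat_norm x \<le> (bop_mat_norm x)\<^sup>2"
    unfolding power2_eq_square by (intro mult_right_mono bop_mat_norm_ge_zero)
  with star_mult[OF x] bop_mat_norm_square_le[OF x] show ?thesis by linarith
qed

lemma bop_mat_norm_entry_le:
  fixes x :: "'h::complex_hilbert_space bop mat"
  assumes "x \<in> carrier_mat n n" "i < n" "j < n"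
  shows "norm (x $$ (i, j)) \<le> bop_mat_norm x"
proof (rule norm_bop_le)
  fix v :: 'h
  define \<xi> where "\<xi> k = (if k = j then v else 0)" for k
  have "bop_apply (x $$ (i, k)) (\<xi> k) = (if k = j then bop_apply (x $$ (i, j)) v else 0)" for k
    by (simp add: \<xi>_def linear_0[OF bounded_linear.linear[OF bop_apply_bounded_linear]])
  then have "bop_mat_apply x \<xi> i = (\<Sum>k<n. if k = j then bop_apply (x $$ (i, j)) v else 0)"
    using assms unfolding bop_mat_apply_def by auto
  also have "\<dots> = bop_apply (x $$ (i, j)) v"
    using assms by simp
  finally have "norm (bop_apply (x $$ (i, j)) v) \<le> tuple_norm n (bop_mat_apply x \<xi>)"
    using norm_le_tuple_norm[OF assms(2), of "bop_mat_apply x \<xi>"] by simp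
  also have "\<dots> \<le> bop_mat_norm x * tuple_norm n \<xi>"
    using bop_mat_norm_apply[of x \<xi>] assms by auto
  also have "tuple_norm n \<xi> = norm v"
    using assms by (simp add: tuple_norm_def \<xi>_def if_distrib[of norm] if_distrib[of "\<lambda>r. r\<^sup>2"] cong: if_cong)
  finally show "norm (bop_apply (x $$ (i, j)) v) \<le> bop_mat_norm x * norm v" .
qed (rule bop_mat_norm_ge_zero)

instantiation bop :: (complex_hilbert_space) matricial_cstar_algebra
begin

definition mat_norm_bop :: "'a bop mat \<Rightarrow> real"
  where "mat_norm_bop = bop_mat_norm"

instance
proof
  fix x y :: "'a bop mat" and n :: nat and c :: complex and a :: "'a bop"
  show "mat_norm (mat 1 1 (\<lambda>_. a)) = norm a"
  proof (rule antisym)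
    show "mat_norm (mat 1 1 (\<lambda>_. a)) \<le> norm a"
      unfolding mat_norm_bop_def
      by (rule bop_mat_norm_le) (simp_all add: tuple_norm_def bop_mat_apply_def norm_bop_apply)
    show "norm a \<le> mat_norm (mat 1 1 (\<lambda>_. a))"
      unfolding mat_norm_bop_def
      using bop_mat_norm_entry_le[of "mat 1 1 (\<lambda>_. a)" 1 0 0] by simp
  qed
  assume x: "x \<in> carrier_mat n n"
  have zero: "bop_mat_norm (mat n n (\<lambda>_. 0 :: 'a bop)) = 0"
    by (intro antisym bop_mat_norm_le bop_mat_norm_ge_zero)
      (simp_all add: tuple_norm_def bop_mat_apply_def bop_apply_simps)
  show "mat_norm x = 0 \<longleftrightarrow> x = mat n n (\<lambda>_. 0)"
  proof
    assume "mat_norm x = 0"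
    then have "x $$ (i, j) = 0" if "i < n" "j < n" for i j
      using bop_mat_norm_entry_le[OF x that] by (simp add: mat_norm_bop_def)
    then show "x = mat n n (\<lambda>_. 0)" using x by (intro eq_matI) auto
  qed (simp add: mat_norm_bop_def zero)
  have scale: "bop_mat_norm (map_mat (scaleC d) z) \<le> cmod d * bop_mat_norm z"
    if z: "z \<in> carrier_mat n n" for d and z :: "'a bop mat"
  proof (rule bop_mat_norm_le)
    fix \<xi> :: "nat \<Rightarrow> 'a"
    have "tuple_norm n (bop_mat_apply (map_mat (scaleC d) z) \<xi>) = tuple_norm n (\<lambda>i. d *\<^sub>C bop_mat_apply z \<xi> i)"
      using z by (intro tuple_norm_cong)
        (simp add: bop_mat_apply_def bop_apply_simps complex_vector.scale_sum_right)
    also have "\<dots> \<le> cmod d * (bop_mat_norm z * tuple_norm n \<xi>)"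
      unfolding tuple_norm_scaleC using bop_mat_norm_apply[of z \<xi>] z by (intro mult_left_mono) auto
    finally show "tuple_norm (dim_row (map_mat (scaleC d) z)) (bop_mat_apply (map_mat (scaleC d) z) \<xi>) \<le>
        cmod d * bop_mat_norm z * tuple_norm (dim_col (map_mat (scaleC d) z)) \<xi>"
      using z by (simp add: mult.assoc)
  qed (simp add: bop_mat_norm_ge_zero)
  show "mat_norm (map_mat (scaleC c) x) = cmod c * mat_norm x"
    unfolding mat_norm_bop_def
  proof (rule antisym[OF scale[OF x]])
    show "cmod c * bop_mat_norm x \<le> bop_mat_norm (map_mat (scaleC c) x)"
    proof (cases "c = 0")
      case False
      have "map_mat (scaleC (inverse c)) (map_mat (scaleC c) x) = x"
        using False by (intro eq_matI) (auto simp: scaleC_scaleC)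
      then have "bop_mat_norm x \<le> inverse (cmod c) * bop_mat_norm (map_mat (scaleC c) x)"
        using scale[of "map_mat (scaleC c) x" "inverse c"] x by (simp add: norm_inverse)
      with False show ?thesis by (simp add: field_simps)
    qed (simp add: bop_mat_norm_ge_zero)
  qed
  show "mat_norm (mat n n (\<lambda>(i, j). \<Sum>k<n. star (x $$ (k, i)) * x $$ (k, j))) = (mat_norm x)\<^sup>2"
    unfolding mat_norm_bop_def by (rule bop_mat_norm_star_times[OF x])
  assume y: "y \<in> carrier_mat n n"
  show "mat_norm (mat n n (\<lambda>(i, j). \<Sum>k<n. x $$ (i, k) * y $$ (k, j))) \<le> mat_norm x * mat_norm y"
    unfolding mat_norm_bop_def by (rule bop_mat_norm_times[OF x y])
  show "mat_norm (mat n n (\<lambda>(i, j). x $$ (i, j) + y $$ (i, j))) \<le> mat_norm x + mat_norm y"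
    unfolding mat_norm_bop_def
  proof (rule bop_mat_norm_le)
    fix \<xi> :: "nat \<Rightarrow> 'a"
    let ?z = "mat n n (\<lambda>(i, j). x $$ (i, j) + y $$ (i, j))"
    have "tuple_norm n (bop_mat_apply ?z \<xi>) = tuple_norm n (\<lambda>i. bop_mat_apply x \<xi> i + bop_mat_apply y \<xi> i)"
      using x y by (intro tuple_norm_cong) (simp add: bop_mat_apply_def bop_apply_simps sum.distrib)
    also have "\<dots> \<le> tuple_norm n (bop_mat_apply x \<xi>) + tuple_norm n (bop_mat_apply y \<xi>)"
      by (rule tuple_norm_triangle)
    also have "\<dots> \<le> bop_mat_norm x * tuple_norm n \<xi> + bop_mat_norm y * tuple_norm n \<xi>"
      using bop_mat_norm_apply[of x \<xi>] bop_mat_norm_apply[of y \<xi>] x y by (intro add_mono) auto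
    finally show "tuple_norm (dim_row ?z) (bop_mat_apply ?z \<xi>) \<le>
        (bop_mat_norm x + bop_mat_norm y) * tuple_norm (dim_col ?z) \<xi>"
      by (simp add: distrib_right)
  qed (simp add: bop_mat_norm_ge_zero)
qed

end


section \<open>Unital operator spaces\<close>

definition unital_operator_space :: "'a::matricial_cstar_algebra set \<Rightarrow> bool"
  where "unital_operator_space X \<longleftrightarrow> csubspace X \<and> closed X \<and> 1 \<in> X"

definition finitely_generated :: "'a::complex_vector set \<Rightarrow> bool"
  where "finitely_generated X \<longleftrightarrow> (\<exists>B. finite B \<and> X = cspan B)"

definition matrices_over :: "'a set \<Rightarrow> nat \<Rightarrow> 'a mat set"
  where "matrices_over X n = {x \<in> carrier_mat n n. elements_mat x \<subseteq> X}"

definition unitally_completely_isometric ::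
    "'a::matricial_cstar_algebra set \<Rightarrow> 'b::matricial_cstar_algebra set \<Rightarrow> bool"
  where "unitally_completely_isometric X Y \<longleftrightarrow>
    (\<exists>u. bij_betw u X Y \<and>
         (\<forall>x\<in>X. \<forall>y\<in>X. u (x + y) = u x + u y) \<and>
         (\<forall>c. \<forall>x\<in>X. u (c *\<^sub>C x) = c *\<^sub>C u x) \<and>
         u 1 = 1 \<and>
         (\<forall>n\<ge>1. \<forall>x\<in>matrices_over X n. mat_norm (map_mat u x) = mat_norm x))"


section \<open>The language of unital operator spaces\<close>

text \<open>\<open>Var n i\<close> is the \<open>i\<close>-th variable of sort \<open>n\<close>; \<open>Compr a t b\<close> is the term \<open>a t b\<close>.\<close>

datatype uosp_term =
    Var nat nat
  | Zero nat
  | Unit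
  | Plus uosp_term uosp_term
  | Scale complex uosp_term
  | Compr "complex mat" uosp_term "complex mat"

definition gauss_rat :: "complex set"
  where "gauss_rat = {z. Re z \<in> \<rat> \<and> Im z \<in> \<rat>}"

inductive has_sort :: "uosp_term \<Rightarrow> nat \<Rightarrow> bool" where
  "n \<ge> 1 \<Longrightarrow> has_sort (Var n i) n"
| "n \<ge> 1 \<Longrightarrow> has_sort (Zero n) n"
| "has_sort Unit 1"
| "has_sort s n \<Longrightarrow> has_sort t n \<Longrightarrow> has_sort (Plus s t) n"
| "q \<in> gauss_rat \<Longrightarrow> has_sort t n \<Longrightarrow> has_sort (Scale q t) n"
| "n \<ge> 1 \<Longrightarrow> has_sort t k \<Longrightarrow>
     a \<in> carrier_mat n k \<Longrightarrow> elements_mat a \<subseteq> gauss_rat \<Longrightarrow>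
     b \<in> carrier_mat k n \<Longrightarrow> elements_mat b \<subseteq> gauss_rat \<Longrightarrow> has_sort (Compr a t b) n"

text \<open>\<open>Conn f [\<phi>\<^sub>1, \<dots>, \<phi>\<^sub>m]\<close> applies the connective \<open>f : \<real>\<^sup>m \<rightarrow> \<real>\<close>, where \<open>\<real>\<^sup>m\<close> is the
  topological space \<^term>\<open>powertop_real {..<m}\<close>. \<open>SupQ n k i \<phi>\<close> and \<open>InfQ n k i \<phi>\<close> let the variable
  \<open>Var n i\<close> range over the domain \<open>D\<^bsub>n,k\<^esub>\<close>. The metrics are the only predicate symbols.\<close>

datatype uosp_formula =
    Dist uosp_term uosp_term
  | Conn "(nat \<Rightarrow> real) \<Rightarrow> real" "uosp_formula list"
  | SupQ nat nat nat uosp_formula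
  | InfQ nat nat nat uosp_formula

inductive wf_formula :: "uosp_formula \<Rightarrow> bool" where
  "has_sort s n \<Longrightarrow> has_sort t n \<Longrightarrow> wf_formula (Dist s t)"
| "continuous_map (powertop_real {..<length \<phi>s}) euclideanreal f \<Longrightarrow>
     (\<And>\<phi>. \<phi> \<in> set \<phi>s \<Longrightarrow> wf_formula \<phi>) \<Longrightarrow> wf_formula (Conn f \<phi>s)"
| "n \<ge> 1 \<Longrightarrow> k \<ge> 1 \<Longrightarrow> wf_formula \<phi> \<Longrightarrow> wf_formula (SupQ n k i \<phi>)"
| "n \<ge> 1 \<Longrightarrow> k \<ge> 1 \<Longrightarrow> wf_formula \<phi> \<Longrightarrow> wf_formula (InfQ n k i \<phi>)"

fun term_vars :: "uosp_term \<Rightarrow> (nat \<times> nat) set" where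
  "term_vars (Var n i) = {(n, i)}"
| "term_vars (Zero n) = {}"
| "term_vars Unit = {}"
| "term_vars (Plus s t) = term_vars s \<union> term_vars t"
| "term_vars (Scale q t) = term_vars t"
| "term_vars (Compr a t b) = term_vars t"

fun free_vars :: "uosp_formula \<Rightarrow> (nat \<times> nat) set" where
  "free_vars (Dist s t) = term_vars s \<union> term_vars t"
| "free_vars (Conn f \<phi>s) = (\<Union>\<phi>\<in>set \<phi>s. free_vars \<phi>)"
| "free_vars (SupQ n k i \<phi>) = free_vars \<phi> - {(n, i)}"
| "free_vars (InfQ n k i \<phi>) = free_vars \<phi> - {(n, i)}"

definition uosp_sentence :: "uosp_formula \<Rightarrow> bool"
  where "uosp_sentence \<phi> \<longleftrightarrow> wf_formula \<phi> \<and> free_vars \<phi> = {}"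

fun universal :: "uosp_formula \<Rightarrow> bool" where
  "universal (Dist s t) \<longleftrightarrow> True"
| "universal (Conn f \<phi>s) \<longleftrightarrow> (\<forall>\<phi>\<in>set \<phi>s. universal \<phi>)"
| "universal (SupQ n k i \<phi>) \<longleftrightarrow> universal \<phi>"
| "universal (InfQ n k i \<phi>) \<longleftrightarrow> False"

definition compress :: "complex mat \<Rightarrow> 'a::complex_vector mat \<Rightarrow> complex mat \<Rightarrow> 'a mat"
  where "compress a x b = mat (dim_row a) (dim_col b)
    (\<lambda>(i, j). \<Sum>p<dim_row x. \<Sum>q<dim_col x. (a $$ (i, p) * b $$ (q, j)) *\<^sub>C x $$ (p, q))"

fun term_value :: "(nat \<times> nat \<Rightarrow> 'a mat) \<Rightarrow> uosp_term \<Rightarrow> 'a::matricial_cstar_algebra mat" where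
  "term_value v (Var n i) = v (n, i)"
| "term_value v (Zero n) = 0\<^sub>m n n"
| "term_value v Unit = 1\<^sub>m 1"
| "term_value v (Plus s t) = term_value v s + term_value v t"
| "term_value v (Scale q t) = mat_scaleC q (term_value v t)"
| "term_value v (Compr a t b) = compress a (term_value v t) b"

definition dom_ball :: "'a::matricial_cstar_algebra set \<Rightarrow> nat \<Rightarrow> nat \<Rightarrow> 'a mat set"
  where "dom_ball X n k = {x \<in> matrices_over X n. mat_norm x \<le> real k}"

fun formula_value ::
    "'a::matricial_cstar_algebra set \<Rightarrow> (nat \<times> nat \<Rightarrow> 'a mat) \<Rightarrow> uosp_formula \<Rightarrow> real" where
  "formula_value X v (Dist s t) = mat_norm (term_value v s - term_value v t)"
| "formula_value X v (Conn f \<phi>s) =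
     f (\<lambda>i\<in>{..<length \<phi>s}. map (\<lambda>\<phi>. formula_value X v \<phi>) \<phi>s ! i)"
| "formula_value X v (SupQ n k i \<phi>) =
     (SUP x\<in>dom_ball X n k. formula_value X (v((n, i) := x)) \<phi>)"
| "formula_value X v (InfQ n k i \<phi>) =
     (INF x\<in>dom_ball X n k. formula_value X (v((n, i) := x)) \<phi>)"

text \<open>For sentences the choice of the assignment is immaterial.\<close>

definition sentence_value :: "'a::matricial_cstar_algebra set \<Rightarrow> uosp_formula \<Rightarrow> real"
  where "sentence_value X \<phi> = formula_value X (\<lambda>(n, i). 0\<^sub>m n n) \<phi>"


section \<open>Coding by operators and smoothness\<close>

definition borel_of :: "'a topology \<Rightarrow> 'a measure"
  where "borel_of T = sigma (topspace T) {U. openin T U}"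

text \<open>The weak operator topology: the coarsest topology for which all the maps
  \<open>A \<mapsto> \<langle>A \<xi>, \<eta>\<rangle>\<close> are continuous.\<close>

definition wot :: "'h::complex_hilbert_space bop topology"
  where "wot = topology_generated_by
    {(\<lambda>A. cinner (bop_apply A \<xi>) \<eta>) -` U | \<xi> \<eta> U. open U}"

text \<open>Balls are closed in the weak operator topology, so Borel in the ball with the relative topology
  is the same as Borel in \<^term>\<open>wot\<close>.\<close>

definition bop_borel_sets :: "'h::complex_hilbert_space bop set set"
  where "bop_borel_sets =
    {S. \<forall>n::nat. S \<inter> cball 0 (real n) \<in> sets (borel_of (subtopology wot (cball 0 (real n))))}"

definition bop_borel :: "'h::complex_hilbert_space bop measure"
  where "bop_borel = sigma UNIV bop_borel_sets"

lemma topspace_wot: "topspace wot = UNIV"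
  unfolding wot_def topology_generated_by_topspace
  using vimage_UNIV open_UNIV by blast

lemma sets_borel_of: "sets (borel_of T) = sigma_sets (topspace T) {U. openin T U}"
  unfolding borel_of_def by (rule sets_measure_of) (auto dest: openin_subset)

lemma space_borel_of: "space (borel_of T) = topspace T"
  unfolding borel_of_def by (rule space_measure_of) (auto dest: openin_subset)

lemma sigma_algebra_bop_borel_sets: "sigma_algebra UNIV bop_borel_sets"
proof -
  let ?B = "\<lambda>n. cball 0 (real n) :: 'a bop set"
  let ?M = "\<lambda>n. borel_of (subtopology wot (?B n))"
  have sp: "space (?M n) = ?B n" for n
    by (simp add: space_borel_of topspace_wot)
  show ?thesis
    unfolding sigma_algebra_iff2
  proof (intro conjI ballI allI impI)
    show "{} \<in> bop_borel_sets" by (simp add: bop_borel_sets_def)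
  next
    fix S assume S: "S \<in> (bop_borel_sets :: 'a bop set set)"
    have "(UNIV - S) \<inter> ?B n = space (?M n) - S \<inter> ?B n" for n
      by (auto simp: sp)
    moreover have "space (?M n) - S \<inter> ?B n \<in> sets (?M n)" for n
      using S by (intro sets.compl_sets) (simp add: bop_borel_sets_def)
    ultimately show "UNIV - S \<in> bop_borel_sets"
      by (simp add: bop_borel_sets_def)
  next
    fix A :: "nat \<Rightarrow> 'a bop set" assume A: "range A \<subseteq> bop_borel_sets"
    have "(\<Union>i. A i) \<inter> ?B n = (\<Union>i. A i \<inter> ?B n)" for n by blast
    moreover have "(\<Union>i. A i \<inter> ?B n) \<in> sets (?M n)" for n
      using A by (intro sets.countable_UN) (auto simp: bop_borel_sets_def)
    ultimately show "(\<Union>i. A i) \<in> bop_borel_sets"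
      by (simp add: bop_borel_sets_def)
  qed simp
qed

lemma space_bop_borel: "space bop_borel = UNIV"
  by (simp add: bop_borel_def)

lemma sets_bop_borel: "sets bop_borel = bop_borel_sets"
  unfolding bop_borel_def
  using sigma_algebra.sigma_sets_eq[OF sigma_algebra_bop_borel_sets] by simp

definition coded_space :: "(nat \<Rightarrow> 'h::complex_hilbert_space bop) \<Rightarrow> 'h bop set"
  where "coded_space \<gamma> = cspan ({1} \<union> range \<gamma>)"

definition fg_codes :: "(nat \<Rightarrow> 'h::complex_hilbert_space bop) set"
  where "fg_codes = {\<gamma>. finitely_generated (coded_space \<gamma>)}"

definition fg_code_space :: "(nat \<Rightarrow> 'h::complex_hilbert_space bop) measure"
  where "fg_code_space = restrict_space (\<Pi>\<^sub>M i\<in>UNIV. bop_borel) fg_codes"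

definition uci_relation ::
    "((nat \<Rightarrow> 'h::complex_hilbert_space bop) \<times> (nat \<Rightarrow> 'h bop)) set"
  where "uci_relation = {(\<gamma>, \<gamma>'). \<gamma> \<in> fg_codes \<and> \<gamma>' \<in> fg_codes \<and>
    unitally_completely_isometric (coded_space \<gamma>) (coded_space \<gamma>')}"

definition Polish_space :: "'a topology \<Rightarrow> bool"
  where "Polish_space T \<longleftrightarrow> completely_metrizable_space T \<and> separable_space T"

text \<open>A Polish space has at most continuum many points, so up to homeomorphism its points may be
  taken from \<^typ>\<open>nat \<Rightarrow> real\<close>; the topology \<open>T\<close> and its carrier \<^term>\<open>topspace T\<close> are arbitrary.\<close>

definition smooth_relation :: "'z measure \<Rightarrow> ('z \<times> 'z) set \<Rightarrow> bool"
  where "smooth_relation Z E \<longleftrightarrow> equiv (space Z) E \<and>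
    (\<exists>(T :: (nat \<Rightarrow> real) topology) f. Polish_space T \<and> f \<in> Z \<rightarrow>\<^sub>M borel_of T \<and>
       (\<forall>z\<in>space Z. \<forall>z'\<in>space Z. (z, z') \<in> E \<longleftrightarrow> f z = f z'))"

definition separable_infinite_dimensional :: "'h::complex_hilbert_space itself \<Rightarrow> bool"
  where "separable_infinite_dimensional _ \<longleftrightarrow>
    separable_space (euclidean :: 'h topology) \<and> \<not> finitely_generated (UNIV :: 'h set)"

end

(* A finite-dimensional unital operator space X with spanning tuple e, e 0 = 1, is determined up to
   unital complete isometry by the numbers ||a_0 (x) e 0 + ... + a_{d-1} (x) e (d-1)|| for square
   matrices a_i, and by continuity Gaussian rational a_i suffice. If for every finite set of such
   tests some tuple in Y has almost the same norms as e, then, balls of Y being compact, a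
   diagonal argument yields a tuple in Y with exactly the same norms, that is, a completely
   isometric unital embedding of X into Y; embeddings in both directions are onto because the
   dimensions agree. "Almost the same norms as e" is expressed by the universal sentence
   sup_x -(sum_j | ||test_j(x)|| - r_j |), whose value in X is 0. Replacing tuples in the coded
   space by Gaussian rational combinations of the generators turns the same condition into a
   countable family of Borel conditions on the code, which is a complete invariant in 2^N. *)
theory Submission
  imports Defs
begin

section \<open>Matrix norms and finite-dimensional subspaces\<close>

text \<open>That some tuple of Y comes close to prescribed norms is an existential statement,
  naturally an infimum; negating the deviation before quantifying turns it into a supremum, which
  keeps the sentence universal. The quantified tuple lives in sort 1 only. Matrices enter as
  coefficients, through the maps x |-> axb that lead from sort 1 to sort n. Coordinate 0 is the
  constant for the unit and never a variable, so unitality is exact at every stage of the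
  approximation.

  Spanning tuples may be dependent. Coefficients are then ambiguous, so compactness rests on a
  choice of bounded coefficients, and the map between the spans is well defined because the norms
  agree already at n = 1.

  Sentences and codes meet in \<open>approximately_embeds\<close>, which compares finitely many test
  norms up to an error. Equal values of universal sentences imply it, and so does equality of the
  Borel invariants; both equivalences then share one compactness argument.\<close>

lemma mat_norm_zero: "mat_norm (mat n n (\<lambda>_. 0) :: 'a::matricial_cstar_algebra mat) = 0"
  using mat_norm_eq_0_iff'[of "mat n n (\<lambda>_. 0)" n] by simp

lemma mat_norm_add_le:
  fixes f g :: "nat \<Rightarrow> nat \<Rightarrow> 'a::matricial_cstar_algebra"
  shows "mat_norm (mat n n (\<lambda>(p, q). f p q + g p q)) \<le>
    mat_norm (mat n n (\<lambda>(p, q). f p q)) + mat_norm (mat n n (\<lambda>(p, q). g p q))"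
proof -
  have "mat n n (\<lambda>(p, q). f p q + g p q) = mat n n (\<lambda>(p, q). f p q) + mat n n (\<lambda>(p, q). g p q)"
    by (intro eq_matI) auto
  then show ?thesis by (simp add: mat_norm_triangle[where n = n])
qed

lemma mat_norm_scale:
  fixes f :: "nat \<Rightarrow> nat \<Rightarrow> 'a::matricial_cstar_algebra"
  shows "mat_norm (mat n n (\<lambda>(p, q). c *\<^sub>C f p q)) = cmod c * mat_norm (mat n n (\<lambda>(p, q). f p q))"
proof -
  have "mat n n (\<lambda>(p, q). c *\<^sub>C f p q) = map_mat (scaleC c) (mat n n (\<lambda>(p, q). f p q))"
    by (intro eq_matI) auto
  then show ?thesis by (simp add: mat_norm_scaleC'[where n = n])
qed

lemma mat_norm_sum_le:
  fixes g :: "'i \<Rightarrow> nat \<Rightarrow> nat \<Rightarrow> 'a::matricial_cstar_algebra"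
  assumes "finite I"
  shows "mat_norm (mat n n (\<lambda>(p, q). \<Sum>i\<in>I. w i *\<^sub>C g i p q)) \<le>
    (\<Sum>i\<in>I. cmod (w i) * mat_norm (mat n n (\<lambda>(p, q). g i p q)))"
  using assms
proof (induction I rule: finite_induct)
  case empty
  then show ?case using mat_norm_zero[of n, where 'a = 'a] by (simp add: case_prod_unfold)
next
  case (insert i I)
  then show ?case
    using mat_norm_add_le[of n "\<lambda>p q. w i *\<^sub>C g i p q" "\<lambda>p q. \<Sum>i\<in>I. w i *\<^sub>C g i p q"]
    by (simp add: mat_norm_scale)
qed

lemma mat_norm_dist_le:
  fixes f g :: "nat \<Rightarrow> nat \<Rightarrow> 'a::matricial_cstar_algebra"
  shows "\<bar>mat_norm (mat n n (\<lambda>(p, q). f p q)) - mat_norm (mat n n (\<lambda>(p, q). g p q))\<bar> \<le>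
    mat_norm (mat n n (\<lambda>(p, q). f p q - g p q))"
proof -
  have m: "(-1) *\<^sub>C y = - y" for y :: 'a
    by (metis complex_vector.scale_minus_left complex_vector.scale_one)
  have s: "mat_norm (mat n n (\<lambda>(p, q). g p q - f p q)) = mat_norm (mat n n (\<lambda>(p, q). f p q - g p q))"
    using mat_norm_scale[of n "-1" "\<lambda>p q. f p q - g p q"] unfolding m by simp
  show ?thesis
    using mat_norm_add_le[of n "\<lambda>p q. f p q - g p q" g] mat_norm_add_le[of n "\<lambda>p q. g p q - f p q" f]
    by (simp add: s)
qed

text \<open>Only scalar weights vary over a fixed finite family of matrices, so the triangle
  inequality suffices and no topology on the matrices is involved. The two limits for
  \<open>tensor_sum\<close> are instances.\<close>

lemma mat_norm_tendsto:
  fixes g :: "'i \<Rightarrow> nat \<Rightarrow> nat \<Rightarrow> 'a::matricial_cstar_algebra"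
  assumes "finite I" "\<And>i. i \<in> I \<Longrightarrow> ((\<lambda>N. w N i) \<longlongrightarrow> w' i) F"
  shows "((\<lambda>N. mat_norm (mat n n (\<lambda>(p, q). \<Sum>i\<in>I. w N i *\<^sub>C g i p q))) \<longlongrightarrow>
    mat_norm (mat n n (\<lambda>(p, q). \<Sum>i\<in>I. w' i *\<^sub>C g i p q))) F"
proof (rule metric_tendsto_imp_tendsto)
  have "((\<lambda>N. \<Sum>i\<in>I. cmod (w N i - w' i) * mat_norm (mat n n (\<lambda>(p, q). g i p q))) \<longlongrightarrow>
      (\<Sum>i\<in>I. cmod (w' i - w' i) * mat_norm (mat n n (\<lambda>(p, q). g i p q)))) F"
    by (intro tendsto_intros assms(2))
  then show "((\<lambda>N. \<Sum>i\<in>I. cmod (w N i - w' i) * mat_norm (mat n n (\<lambda>(p, q). g i p q))) \<longlongrightarrow> 0) F"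
    by simp
next
  have "dist (mat_norm (mat n n (\<lambda>(p, q). \<Sum>i\<in>I. w N i *\<^sub>C g i p q)))
      (mat_norm (mat n n (\<lambda>(p, q). \<Sum>i\<in>I. w' i *\<^sub>C g i p q))) \<le>
      dist (\<Sum>i\<in>I. cmod (w N i - w' i) * mat_norm (mat n n (\<lambda>(p, q). g i p q))) 0" for N
  proof -
    have "(\<Sum>i\<in>I. w N i *\<^sub>C g i p q) - (\<Sum>i\<in>I. w' i *\<^sub>C g i p q) = (\<Sum>i\<in>I. (w N i - w' i) *\<^sub>C g i p q)" for p q
      by (simp add: complex_vector.scale_left_diff_distrib sum_subtractf)
    then show ?thesis
      using mat_norm_dist_le[of n "\<lambda>p q. \<Sum>i\<in>I. w N i *\<^sub>C g i p q" "\<lambda>p q. \<Sum>i\<in>I. w' i *\<^sub>C g i p q"]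
        mat_norm_sum_le[OF assms(1), of n "\<lambda>i. w N i - w' i" g]
      by (simp add: dist_real_def)
  qed
  then show "\<forall>\<^sub>F N in F. dist (mat_norm (mat n n (\<lambda>(p, q). \<Sum>i\<in>I. w N i *\<^sub>C g i p q)))
      (mat_norm (mat n n (\<lambda>(p, q). \<Sum>i\<in>I. w' i *\<^sub>C g i p q)))
      \<le> dist (\<Sum>i\<in>I. cmod (w N i - w' i) * mat_norm (mat n n (\<lambda>(p, q). g i p q))) 0"
    by simp
qed

lemma mat_norm_elt: "mat_norm (mat 1 1 (\<lambda>(p, q). x)) = norm (x :: 'a::matricial_cstar_algebra)"
  using mat_norm_1x1[of x] by (simp add: case_prod_unfold)

section \<open>Tensor sums and the continuity of their norms\<close>

text \<open>The element a_0 \<otimes> x_0 + ... + a_{d-1} \<otimes> x_{d-1}, where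
  \<open>a i\<close> is read as the i-th scalar coefficient matrix.\<close>

definition tensor_sum ::
    "nat \<Rightarrow> nat \<Rightarrow> (nat \<Rightarrow> nat \<Rightarrow> nat \<Rightarrow> complex) \<Rightarrow> (nat \<Rightarrow> 'a::complex_vector) \<Rightarrow> 'a mat"
  where "tensor_sum n d a x = mat n n (\<lambda>(p, q). \<Sum>i<d. a i p q *\<^sub>C x i)"

lemma tensor_sum_carrier [simp]: "tensor_sum n d a x \<in> carrier_mat n n"
  by (simp add: tensor_sum_def)

lemma tensor_sum_cong: "(\<And>i. i < d \<Longrightarrow> x i = y i) \<Longrightarrow> tensor_sum n d a x = tensor_sum n d a y"
  unfolding tensor_sum_def by (intro eq_matI) auto

lemma tendsto_tensor_sum_coeff:
  fixes x :: "nat \<Rightarrow> 'a::matricial_cstar_algebra"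
  assumes "\<And>i p q. i < d \<Longrightarrow> p < n \<Longrightarrow> q < n \<Longrightarrow> ((\<lambda>N. a N i p q) \<longlongrightarrow> b i p q) F"
  shows "((\<lambda>N. mat_norm (tensor_sum n d (a N) x)) \<longlongrightarrow> mat_norm (tensor_sum n d b x)) F"
proof -
  let ?I = "{..<d} \<times> {..<n} \<times> {..<n}"
  \<comment> \<open>\<open>g (i, r, s)\<close> is E_{rs} \<otimes> x_i for the matrix unit E_{rs};
    the entries of the coefficient matrices thereby become the scalar weights.\<close>
  define g :: "nat \<times> nat \<times> nat \<Rightarrow> nat \<Rightarrow> nat \<Rightarrow> 'a"
    where "g = (\<lambda>(i, r, s) p q. if r = p \<and> s = q then x i else 0)"
  have e: "tensor_sum n d c x = mat n n (\<lambda>(p, q). \<Sum>t\<in>?I. (case t of (i, r, s) \<Rightarrow> c i r s) *\<^sub>C g t p q)" for c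
  proof -
    have "(\<Sum>i<d. c i p q *\<^sub>C x i) = (\<Sum>t\<in>?I. (case t of (i, r, s) \<Rightarrow> c i r s) *\<^sub>C g t p q)"
      if "p < n" "q < n" for p q
    proof -
      have "(\<Sum>t\<in>?I. (case t of (i, r, s) \<Rightarrow> c i r s) *\<^sub>C g t p q) =
          (\<Sum>i<d. \<Sum>t\<in>{..<n} \<times> {..<n}. if t = (p, q) then c i p q *\<^sub>C x i else 0)"
        by (subst sum.cartesian_product', intro sum.cong refl) (auto simp: g_def split: if_splits)
      also have "\<dots> = (\<Sum>i<d. c i p q *\<^sub>C x i)"
        using that by (intro sum.cong refl) simp
      finally show ?thesis ..
    qed
    then show ?thesis
      unfolding tensor_sum_def by (intro eq_matI) auto
  qed
  show ?thesis
    unfolding e by (rule mat_norm_tendsto) (auto intro!: assms)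
qed

text \<open>The fixed matrices are a_i \<otimes> f_k, and the weights are the coordinates of the
  vectors with respect to f.\<close>

lemma tendsto_tensor_sum_vec:
  fixes f :: "nat \<Rightarrow> 'a::matricial_cstar_algebra"
  assumes "\<And>i k. i < d \<Longrightarrow> k < m \<Longrightarrow> ((\<lambda>N. s N i k) \<longlongrightarrow> t i k) F"
  shows "((\<lambda>N. mat_norm (tensor_sum n d a (\<lambda>i. \<Sum>k<m. s N i k *\<^sub>C f k))) \<longlongrightarrow>
    mat_norm (tensor_sum n d a (\<lambda>i. \<Sum>k<m. t i k *\<^sub>C f k))) F"
proof -
  let ?I = "{..<d} \<times> {..<m}"
  have e: "tensor_sum n d a (\<lambda>i. \<Sum>k<m. c i k *\<^sub>C f k) =
      mat n n (\<lambda>(p, q). \<Sum>t\<in>?I. (case t of (i, k) \<Rightarrow> c i k) *\<^sub>C (case t of (i, k) \<Rightarrow> \<lambda>p q. a i p q *\<^sub>C f k) p q)" for c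
    unfolding tensor_sum_def
    by (intro eq_matI)
      (auto simp: sum.cartesian_product' complex_vector.scale_sum_right scaleC_scaleC mult.commute intro!: sum.cong)
  show ?thesis
    unfolding e by (rule mat_norm_tendsto) (auto intro!: assms)
qed

lemma tendsto_scaleC_left:
  fixes x :: "'a::complex_normed_vector"
  assumes "(c \<longlongrightarrow> c') F"
  shows "((\<lambda>N. c N *\<^sub>C x) \<longlongrightarrow> c' *\<^sub>C x) F"
proof -
  have "bounded_linear (\<lambda>c. c *\<^sub>C x)"
    by (rule bounded_linear_intro[where K = "norm x"])
      (simp_all add: scaleC_add_left scaleR_scaleC scaleC_scaleC norm_scaleC scaleR_conv_of_real)
  from bounded_linear.tendsto[OF this assms] show ?thesis .
qed

section \<open>Compactness in finite-dimensional spans\<close>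

text \<open>Bolzano-Weierstrass in the functions from a finite set to the complex numbers. Since
  \<open>compact_lemma_general\<close> is applied to functions, projection is evaluation and
  unprojection the identity.\<close>

lemma finite_family_convergent_subseq:
  fixes c :: "nat \<Rightarrow> 'i \<Rightarrow> complex"
  assumes "finite I" "\<And>N i. i \<in> I \<Longrightarrow> cmod (c N i) \<le> R"
  obtains r l where "strict_mono (r :: nat \<Rightarrow> nat)" "\<And>i. i \<in> I \<Longrightarrow> (\<lambda>N. c (r N) i) \<longlonglongrightarrow> l i"
proof -
  have "\<forall>J\<subseteq>I. \<exists>l. \<exists>r. strict_mono r \<and>
      (\<forall>e>0. \<forall>\<^sub>F N in sequentially. \<forall>i\<in>J. dist (c (r N) i) (l i) < e)"
    by (rule compact_lemma_general[where proj = "\<lambda>x i. x i" and unproj = "\<lambda>x. x"])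
      (use assms in \<open>auto simp: bounded_iff\<close>)
  then obtain l r where "strict_mono r"
    and "\<And>e. e > 0 \<Longrightarrow> \<forall>\<^sub>F N in sequentially. \<forall>i\<in>I. dist (c (r N) i) (l i) < e"
    by blast
  then show ?thesis
    by (intro that[of r l] tendstoI) (force elim: eventually_mono)+
qed

text \<open>The form that equivalence of norms takes for a possibly dependent family: not every
  representation of a vector is small, but some representation \<open>c'\<close> is bounded by the
  norm of the vector. The induction either drops \<open>f m\<close> as redundant or uses its
  positive distance from the span of its predecessors.\<close>

lemma bounded_coefficients:
  fixes f :: "nat \<Rightarrow> 'a::complex_normed_vector"
  shows "\<exists>K\<ge>0. \<forall>c. \<exists>c'. (\<Sum>k<m. c k *\<^sub>C f k) = (\<Sum>k<m. c' k *\<^sub>C f k) \<and>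
    (\<forall>k<m. cmod (c' k) \<le> K * norm (\<Sum>k<m. c k *\<^sub>C f k))"
proof (induction m)
  case 0
  then show ?case by auto
next
  case (Suc m)
  then obtain K where K: "K \<ge> 0" "\<And>c. \<exists>c'. (\<Sum>k<m. c k *\<^sub>C f k) = (\<Sum>k<m. c' k *\<^sub>C f k) \<and>
    (\<forall>k<m. cmod (c' k) \<le> K * norm (\<Sum>k<m. c k *\<^sub>C f k))"
    by blast
  show ?case
  proof (cases "\<exists>b. f m = (\<Sum>k<m. b k *\<^sub>C f k)")
    case True
    then obtain b where b: "f m = (\<Sum>k<m. b k *\<^sub>C f k)" ..
    have "\<exists>c'. (\<Sum>k<Suc m. c k *\<^sub>C f k) = (\<Sum>k<Suc m. c' k *\<^sub>C f k) \<and>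
      (\<forall>k<Suc m. cmod (c' k) \<le> K * norm (\<Sum>k<Suc m. c k *\<^sub>C f k))" for c
    proof -
      have "(\<Sum>k<Suc m. c k *\<^sub>C f k) = (\<Sum>k<m. (c k + c m * b k) *\<^sub>C f k)"
        unfolding sum.lessThan_Suc
        by (subst b) (simp add: complex_vector.scale_sum_right scaleC_scaleC scaleC_add_left sum.distrib)
      moreover obtain c' where "(\<Sum>k<m. (c k + c m * b k) *\<^sub>C f k) = (\<Sum>k<m. c' k *\<^sub>C f k)"
        "\<forall>k<m. cmod (c' k) \<le> K * norm (\<Sum>k<m. (c k + c m * b k) *\<^sub>C f k)"
        using K(2)[of "\<lambda>k. c k + c m * b k"] by blast
      ultimately show ?thesis
        using K(1) by (intro exI[of _ "c'(m := 0)"]) (auto simp: less_Suc_eq)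
    qed
    with K(1) show ?thesis by (intro exI[of _ K] conjI allI)
  next
    case False
    \<comment> \<open>By the induction hypothesis, balls of the span of the first \<open>m\<close> vectors are compact, so \<open>f m\<close> has
      positive distance from it.\<close>
    have "\<exists>\<delta>>0. \<forall>c. \<delta> \<le> norm (f m - (\<Sum>k<m. c k *\<^sub>C f k))"
    proof (rule ccontr)
      assume "\<not> ?thesis"
      then have "\<forall>\<delta>>0. \<exists>c. norm (f m - (\<Sum>k<m. c k *\<^sub>C f k)) < \<delta>"
        by (simp add: not_le)
      then have "\<exists>c. norm (f m - (\<Sum>k<m. c k *\<^sub>C f k)) < 1 / real (Suc N)" for N
        by simp
      then obtain c0 where c0: "\<And>N. norm (f m - (\<Sum>k<m. c0 N k *\<^sub>C f k)) < 1 / real (Suc N)"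
        by metis
      obtain c where c: "\<And>N. (\<Sum>k<m. c0 N k *\<^sub>C f k) = (\<Sum>k<m. c N k *\<^sub>C f k)"
        "\<And>N k. k < m \<Longrightarrow> cmod (c N k) \<le> K * norm (\<Sum>k<m. c0 N k *\<^sub>C f k)"
      proof -
        have "\<forall>N. \<exists>c'. (\<Sum>k<m. c0 N k *\<^sub>C f k) = (\<Sum>k<m. c' k *\<^sub>C f k) \<and>
            (\<forall>k<m. cmod (c' k) \<le> K * norm (\<Sum>k<m. c0 N k *\<^sub>C f k))"
          using K(2) by blast
        from choice[OF this] show ?thesis using that by blast
      qed
      have cR: "cmod (c N k) \<le> K * (norm (f m) + 1)" if "k < m" for N k
      proof -
        have "norm (f m - (\<Sum>k<m. c0 N k *\<^sub>C f k)) \<le> 1"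
          using less_le_trans[OF c0[of N], of 1] by simp
        then have "norm (\<Sum>k<m. c0 N k *\<^sub>C f k) \<le> norm (f m) + 1"
          using norm_triangle_ineq3[of "\<Sum>k<m. c0 N k *\<^sub>C f k" "f m"] by (simp add: norm_minus_commute)
        then show ?thesis
          using c(2)[OF that, of N] K(1) by (meson mult_left_mono order_trans)
      qed
      have "cmod (c N k) \<le> K * (norm (f m) + 1)" if "k \<in> {..<m}" for N k
        using cR that by simp
      from finite_family_convergent_subseq[of "{..<m}" c "K * (norm (f m) + 1)", OF finite_lessThan this]
      obtain r l where r: "strict_mono (r :: nat \<Rightarrow> nat)"
        and l: "\<And>k. k \<in> {..<m} \<Longrightarrow> (\<lambda>N. c (r N) k) \<longlonglongrightarrow> l k" by blast
      have lim: "(\<lambda>N. \<Sum>k<m. c (r N) k *\<^sub>C f k) \<longlonglongrightarrow> (\<Sum>k<m. l k *\<^sub>C f k)"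
        by (intro tendsto_sum tendsto_scaleC_left l)
      have "(\<lambda>N. \<Sum>k<m. c (r N) k *\<^sub>C f k) \<longlonglongrightarrow> f m"
      proof -
        have "(\<lambda>N. f m - (f m - (\<Sum>k<m. c0 N k *\<^sub>C f k))) \<longlonglongrightarrow> f m - 0"
          by (intro tendsto_diff tendsto_const LIMSEQ_norm_0 c0)
        then have "(\<lambda>N. \<Sum>k<m. c N k *\<^sub>C f k) \<longlonglongrightarrow> f m"
          by (simp add: c(1))
        from LIMSEQ_subseq_LIMSEQ[OF this r] show ?thesis by (simp add: comp_def)
      qed
      from LIMSEQ_unique[OF this lim] have "f m = (\<Sum>k<m. l k *\<^sub>C f k)" .
      with False show False by blast
    qed
    then obtain \<delta> where \<delta>: "\<delta> > 0" "\<And>c. \<delta> \<le> norm (f m - (\<Sum>k<m. c k *\<^sub>C f k))" by blast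
    \<comment> \<open>The remainder y - c_m f_m has norm at most (1 + ||f_m|| / \<delta>) ||y||, and
      the induction hypothesis multiplies this by K; the summand 1 / \<delta> bounds c_m
      itself.\<close>
    define K' where "K' = K * (1 + norm (f m) / \<delta>) + 1 / \<delta>"
    have "\<exists>c'. (\<Sum>k<Suc m. c k *\<^sub>C f k) = (\<Sum>k<Suc m. c' k *\<^sub>C f k) \<and>
      (\<forall>k<Suc m. cmod (c' k) \<le> K' * norm (\<Sum>k<Suc m. c k *\<^sub>C f k))" for c
    proof -
      define y where "y = (\<Sum>k<Suc m. c k *\<^sub>C f k)"
      have y: "y = (\<Sum>k<m. c k *\<^sub>C f k) + c m *\<^sub>C f m" by (simp add: y_def)
      have m: "\<delta> * cmod (c m) \<le> norm y"
      proof (cases "c m = 0")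
        case False
        \<comment> \<open>Factoring out c_m leaves f_m minus a combination of its predecessors,
          whose norm is at least \<delta>.\<close>
        have "y = c m *\<^sub>C (f m - (\<Sum>k<m. (- c k / c m) *\<^sub>C f k))"
          using False by (simp add: y complex_vector.scale_right_diff_distrib complex_vector.scale_sum_right
            scaleC_scaleC sum_negf complex_vector.scale_minus_left scaleC_add_right)
        then have *: "norm y = cmod (c m) * norm (f m - (\<Sum>k<m. (- c k / c m) *\<^sub>C f k))"
          by (simp only: norm_scaleC)
        have "cmod (c m) * \<delta> \<le> norm y"
          unfolding * by (intro mult_left_mono \<delta>(2) norm_ge_zero)
        then show ?thesis by (simp only: mult.commute)
      qed simp
      then have m': "cmod (c m) \<le> norm y / \<delta>" using \<delta>(1) by (simp add: field_simps)
      obtain c' where c': "(\<Sum>k<m. c k *\<^sub>C f k) = (\<Sum>k<m. c' k *\<^sub>C f k)"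
        "\<And>k. k < m \<Longrightarrow> cmod (c' k) \<le> K * norm (\<Sum>k<m. c k *\<^sub>C f k)"
        using K(2)[of c] by blast
      have "norm (\<Sum>k<m. c k *\<^sub>C f k) \<le> norm y + cmod (c m) * norm (f m)"
        using norm_triangle_ineq4[of y "c m *\<^sub>C f m"] by (simp add: y norm_scaleC)
      also have "\<dots> \<le> norm y + norm y / \<delta> * norm (f m)"
        using m' by (intro add_left_mono mult_right_mono) auto
      finally have "K * norm (\<Sum>k<m. c k *\<^sub>C f k) \<le> K * (norm y + norm y / \<delta> * norm (f m))"
        using K(1) by (rule mult_left_mono)
      also have "\<dots> \<le> K' * norm y"
        using \<delta>(1) by (simp add: K'_def algebra_simps)
      finally have 1: "cmod (c' k) \<le> K' * norm y" if "k < m" for k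
        using c'(2)[OF that] by linarith
      have "norm y / \<delta> \<le> K' * norm y"
        using \<delta>(1) K(1) by (simp add: K'_def algebra_simps)
      with m' have 2: "cmod (c m) \<le> K' * norm y" by linarith
      show ?thesis
        using 1 2 c'(1) unfolding y_def[symmetric]
        by (intro exI[of _ "c'(m := c m)"]) (auto simp: less_Suc_eq y)
    qed
    moreover have "K' \<ge> 0" using K(1) \<delta>(1) by (simp add: K'_def)
    ultimately show ?thesis by (intro exI[of _ K'] conjI allI)
  qed
qed

section \<open>Matricial tests\<close>

definition gauss :: "rat \<times> rat \<Rightarrow> complex"
  where "gauss z = Complex (of_rat (fst z)) (of_rat (snd z))"

lemma rat_seq_tendsto: "\<exists>q. (\<lambda>N. real_of_rat (q N)) \<longlonglongrightarrow> x"
proof -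
  have "\<forall>N. \<exists>q. x - 1 / real (Suc N) < of_rat q \<and> of_rat q < x"
    by (intro allI of_rat_dense) simp
  from choice[OF this] obtain q
    where q: "\<forall>N. x - 1 / real (Suc N) < of_rat (q N) \<and> of_rat (q N) < x" ..
  have "norm (x - of_rat (q N)) < 1 / real (Suc N)" for N
    using q[rule_format, of N] unfolding real_norm_def by linarith
  then have "(\<lambda>N. x - (x - of_rat (q N))) \<longlonglongrightarrow> x - 0"
    by (intro tendsto_diff tendsto_const LIMSEQ_norm_0)
  then have "(\<lambda>N. real_of_rat (q N)) \<longlonglongrightarrow> x" by simp
  then show ?thesis by (rule exI[of _ q])
qed

lemma gauss_dense: "\<exists>s. (\<lambda>N. gauss (s N)) \<longlonglongrightarrow> z"
proof -
  obtain q where q: "(\<lambda>N. real_of_rat (q N)) \<longlonglongrightarrow> Re z" using rat_seq_tendsto ..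
  obtain q' where q': "(\<lambda>N. real_of_rat (q' N)) \<longlonglongrightarrow> Im z" using rat_seq_tendsto ..
  from tendsto_Complex[OF q q'] have "(\<lambda>N. gauss (q N, q' N)) \<longlonglongrightarrow> z"
    by (simp add: gauss_def)
  then show ?thesis by (rule exI[of _ "\<lambda>N. (q N, q' N)"])
qed

text \<open>Nested lists form a countable type, which makes the set of all tests below countable; reading
  a list beyond its end yields an unspecified entry, but still a Gaussian rational.\<close>

definition coeffs :: "(rat \<times> rat) list list list \<Rightarrow> nat \<Rightarrow> nat \<Rightarrow> nat \<Rightarrow> complex"
  where "coeffs l i p q = gauss (l ! i ! p ! q)"

type_synonym test = "nat \<times> (rat \<times> rat) list list list"

text \<open>The matrix size is stored decreased by one, so that every element of the countable type
  \<open>test\<close> is a test of size at least 1.\<close>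

definition test_norm :: "nat \<Rightarrow> test \<Rightarrow> (nat \<Rightarrow> 'a::matricial_cstar_algebra) \<Rightarrow> real"
  where "test_norm d \<tau> x = mat_norm (tensor_sum (Suc (fst \<tau>)) d (coeffs (snd \<tau>)) x)"

lemma test_norm_cong: "(\<And>i. i < d \<Longrightarrow> x i = y i) \<Longrightarrow> test_norm d \<tau> x = test_norm d \<tau> y"
  unfolding test_norm_def by (simp cong: tensor_sum_cong)

lemma coeffs_dense:
  "\<exists>l. \<forall>i<d. \<forall>p<n. \<forall>q<n. (\<lambda>N. coeffs (l N) i p q) \<longlonglongrightarrow> a i p q"
proof -
  have "\<forall>z. \<exists>s. (\<lambda>N. gauss (s N)) \<longlonglongrightarrow> z"
    by (intro allI gauss_dense)
  from choice[OF this] obtain S where S: "\<forall>z. (\<lambda>N. gauss (S z N)) \<longlonglongrightarrow> z" ..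
  show ?thesis
    by (intro exI[of _ "\<lambda>N. map (\<lambda>i. map (\<lambda>p. map (\<lambda>q. S (a i p q) N) [0..<n]) [0..<n]) [0..<d]"])
      (simp add: coeffs_def S)
qed

text \<open>The 1 x 1 test that reads off the norm of coordinate i. Adding these tests to a finite
  set makes any approximating tuple bounded.\<close>

definition coord_test :: "nat \<Rightarrow> nat \<Rightarrow> test"
  where "coord_test d i = (0, map (\<lambda>j. [[if j = i then (1, 0) else (0, 0)]]) [0..<d])"

lemma tensor_sum_1: "mat_norm (tensor_sum 1 d (\<lambda>i p q. c i) x) = norm (\<Sum>i<d. c i *\<^sub>C x i)"
  unfolding tensor_sum_def by (rule mat_norm_elt)

lemma test_norm_coord_test:
  assumes "i < d"
  shows "test_norm d (coord_test d i) x = norm (x i)"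
proof -
  have g: "gauss (1, 0) = 1" "gauss (0, 0) = 0"
    by (simp_all add: gauss_def complex_eq_iff)
  have "tensor_sum 1 d (coeffs (snd (coord_test d i))) x = tensor_sum 1 d (\<lambda>j p q. if j = i then 1 else 0) x"
    unfolding tensor_sum_def by (intro eq_matI) (auto simp: coeffs_def coord_test_def g intro!: sum.cong)
  moreover have "(\<Sum>j<d. (if j = i then 1 else 0) *\<^sub>C x j) = x i"
  proof -
    have "(\<Sum>j<d. (if j = i then 1 else 0) *\<^sub>C x j) = (\<Sum>j<d. if j = i then x i else 0)"
      by (intro sum.cong) auto
    then show ?thesis using assms by simp
  qed
  ultimately show ?thesis
    using tensor_sum_1[of d "\<lambda>j. if j = i then 1 else 0" x]
    by (simp add: test_norm_def coord_test_def)
qed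

definition lincombs :: "nat \<Rightarrow> (nat \<Rightarrow> 'a::complex_vector) \<Rightarrow> 'a set"
  where "lincombs m f = {\<Sum>k<m. c k *\<^sub>C f k | c. True}"

section \<open>From approximate to exact equality of norms\<close>

lemma norm_preserving_tuple:
  fixes e :: "nat \<Rightarrow> 'a::matricial_cstar_algebra" and f :: "nat \<Rightarrow> 'b::matricial_cstar_algebra"
  assumes d: "d \<ge> 1"
    and approx: "\<And>F \<epsilon>. finite F \<Longrightarrow> \<epsilon> > 0 \<Longrightarrow> \<exists>y. y 0 = 1 \<and> (\<forall>i<d. y i \<in> lincombs m f) \<and>
      (\<forall>\<tau>\<in>F. \<bar>test_norm d \<tau> y - test_norm d \<tau> e\<bar> < \<epsilon>)"
  shows "\<exists>y. y 0 = 1 \<and> (\<forall>i<d. y i \<in> lincombs m f) \<and>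
    (\<forall>n\<ge>1. \<forall>a. mat_norm (tensor_sum n d a y) = mat_norm (tensor_sum n d a e))"
proof -
  \<comment> \<open>Stage N takes the first N + 1 tests of an enumeration, with tolerance 1 / (N +
    1). The coordinate tests occur at every stage and bound all the tuples \<open>Y N\<close> at
    once.\<close>
  define F :: "nat \<Rightarrow> test set" where "F N = from_nat ` {..N} \<union> coord_test d ` {..<d}" for N
  have "\<forall>N. \<exists>y. y 0 = 1 \<and> (\<forall>i<d. y i \<in> lincombs m f) \<and>
      (\<forall>\<tau>\<in>F N. \<bar>test_norm d \<tau> y - test_norm d \<tau> e\<bar> < 1 / real (Suc N))"
    by (intro allI approx) (simp_all add: F_def)
  from choice[OF this] obtain Y where Y: "\<forall>N. Y N 0 = 1 \<and> (\<forall>i<d. Y N i \<in> lincombs m f) \<and>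
      (\<forall>\<tau>\<in>F N. \<bar>test_norm d \<tau> (Y N) - test_norm d \<tau> e\<bar> < 1 / real (Suc N))" ..
  have Y0: "Y N 0 = 1" and Ym: "i < d \<Longrightarrow> Y N i \<in> lincombs m f"
    and Yt: "\<tau> \<in> F N \<Longrightarrow> \<bar>test_norm d \<tau> (Y N) - test_norm d \<tau> e\<bar> < 1 / real (Suc N)" for N i \<tau>
    using Y by simp_all
  obtain K where K: "K \<ge> 0" "\<And>c. \<exists>c'. (\<Sum>k<m. c k *\<^sub>C f k) = (\<Sum>k<m. c' k *\<^sub>C f k) \<and>
      (\<forall>k<m. cmod (c' k) \<le> K * norm (\<Sum>k<m. c k *\<^sub>C f k))"
    using bounded_coefficients[where m = m and f = f] by blast
  have "\<exists>c. Y N i = (\<Sum>k<m. c k *\<^sub>C f k) \<and> (\<forall>k<m. cmod (c k) \<le> K * norm (Y N i))" if i: "i < d" for N i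
  proof -
    obtain c where c: "Y N i = (\<Sum>k<m. c k *\<^sub>C f k)"
      using Ym[OF i, of N] by (auto simp: lincombs_def)
    show ?thesis using K(2)[of c] unfolding c .
  qed
  then have "\<forall>t. \<exists>c. snd t < d \<longrightarrow> Y (fst t) (snd t) = (\<Sum>k<m. c k *\<^sub>C f k) \<and>
      (\<forall>k<m. cmod (c k) \<le> K * norm (Y (fst t) (snd t)))"
    by simp
  from choice[OF this] obtain c0 where c0: "\<forall>t. snd t < d \<longrightarrow> Y (fst t) (snd t) = (\<Sum>k<m. c0 t k *\<^sub>C f k) \<and>
      (\<forall>k<m. cmod (c0 t k) \<le> K * norm (Y (fst t) (snd t)))" ..
  define c where "c N i = c0 (N, i)" for N i
  have c: "i < d \<Longrightarrow> Y N i = (\<Sum>k<m. c N i k *\<^sub>C f k)"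
    and cK: "i < d \<Longrightarrow> k < m \<Longrightarrow> cmod (c N i k) \<le> K * norm (Y N i)" for N i k
    using c0[rule_format, of "(N, i)"] unfolding c_def fst_conv snd_conv by blast+
  \<comment> \<open>The summand 1 absorbs the tolerance 1 / (N + 1) of the coordinate tests.\<close>
  define R where "R = (\<Sum>i<d. norm (e i)) + 1"
  have YR: "norm (Y N i) \<le> R" if i: "i < d" for N i
  proof -
    have "\<bar>test_norm d (coord_test d i) (Y N) - test_norm d (coord_test d i) e\<bar> < 1 / real (Suc N)"
      by (rule Yt) (use i in \<open>simp add: F_def\<close>)
    moreover have "1 / real (Suc N) \<le> 1" by simp
    moreover have "norm (e i) \<le> (\<Sum>i<d. norm (e i))"
      using i by (intro member_le_sum) auto
    ultimately show ?thesis
      unfolding test_norm_coord_test[OF i] R_def by linarith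
  qed
  have "cmod (case t of (i, k) \<Rightarrow> c N i k) \<le> K * R" if "t \<in> {..<d} \<times> {..<m}" for N t
  proof -
    from that obtain i k where t: "t = (i, k)" "i < d" "k < m" by auto
    have "K * norm (Y N i) \<le> K * R" by (rule mult_left_mono[OF YR[OF t(2)] K(1)])
    with cK[OF t(2,3), of N] show ?thesis by (simp add: t(1))
  qed
  from finite_family_convergent_subseq[of "{..<d} \<times> {..<m}" "\<lambda>N t. case t of (i, k) \<Rightarrow> c N i k" "K * R",
      OF finite_cartesian_product[OF finite_lessThan finite_lessThan] this]
  obtain r l where r: "strict_mono (r :: nat \<Rightarrow> nat)"
    and l: "\<And>t. t \<in> {..<d} \<times> {..<m} \<Longrightarrow> (\<lambda>N. case t of (i, k) \<Rightarrow> c (r N) i k) \<longlonglongrightarrow> l t"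
    by blast
  have l: "(\<lambda>N. c (r N) i k) \<longlonglongrightarrow> l (i, k)" if "i < d" "k < m" for i k
    using l[of "(i, k)"] that by simp
  define y where "y i = (\<Sum>k<m. l (i, k) *\<^sub>C f k)" for i
  have "y 0 = 1"
  proof -
    have "(\<lambda>N. \<Sum>k<m. c (r N) 0 k *\<^sub>C f k) \<longlonglongrightarrow> y 0"
      unfolding y_def by (intro tendsto_sum tendsto_scaleC_left l) (use d in auto)
    moreover have "(\<Sum>k<m. c (r N) 0 k *\<^sub>C f k) = 1" for N
      using c[of 0 "r N"] Y0[of "r N"] d by simp
    ultimately show ?thesis by (simp add: LIMSEQ_const_iff)
  qed
  moreover have "\<forall>i<d. y i \<in> lincombs m f"
    by (auto simp: y_def lincombs_def)
  moreover have tests: "test_norm d \<tau> y = test_norm d \<tau> e" for \<tau>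
  proof (rule LIMSEQ_unique)
    have "(\<lambda>N. test_norm d \<tau> (\<lambda>i. \<Sum>k<m. c (r N) i k *\<^sub>C f k)) \<longlonglongrightarrow> test_norm d \<tau> y"
      unfolding y_def test_norm_def by (rule tendsto_tensor_sum_vec) (rule l)
    moreover have "test_norm d \<tau> (\<lambda>i. \<Sum>k<m. c (r N) i k *\<^sub>C f k) = test_norm d \<tau> (Y (r N))" for N
      by (rule test_norm_cong) (simp add: c)
    ultimately show "(\<lambda>N. test_norm d \<tau> (Y (r N))) \<longlonglongrightarrow> test_norm d \<tau> y" by simp
    have "(\<lambda>N. test_norm d \<tau> (Y N)) \<longlonglongrightarrow> test_norm d \<tau> e"
    proof (rule metric_tendsto_imp_tendsto[OF lim_1_over_n[THEN LIMSEQ_Suc]])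
      \<comment> \<open>The sets \<open>F N\<close> increase, so each test belongs to all stages
        from its code number on.\<close>
      have "\<tau> \<in> F N" if "to_nat \<tau> \<le> N" for N
        using that unfolding F_def by (intro UnI1 image_eqI[of _ _ "to_nat \<tau>"]) auto
      then have "dist (test_norm d \<tau> (Y N)) (test_norm d \<tau> e) \<le> dist (1 / real (Suc N)) 0" if "to_nat \<tau> \<le> N" for N
        using Yt[of \<tau> N] that by (simp add: dist_real_def less_imp_le)
      then show "\<forall>\<^sub>F N in sequentially. dist (test_norm d \<tau> (Y N)) (test_norm d \<tau> e) \<le> dist (1 / real (Suc N)) 0"
        by (intro eventually_sequentiallyI)
    qed
    from LIMSEQ_subseq_LIMSEQ[OF this r]
    show "(\<lambda>N. test_norm d \<tau> (Y (r N))) \<longlonglongrightarrow> test_norm d \<tau> e" by (simp add: comp_def)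
  qed
  moreover have "mat_norm (tensor_sum n d a y) = mat_norm (tensor_sum n d a e)" if n: "n \<ge> 1" for n a
  proof -
    obtain L where L: "\<forall>i<d. \<forall>p<n. \<forall>q<n. (\<lambda>N. coeffs (L N) i p q) \<longlonglongrightarrow> a i p q"
      using coeffs_dense ..
    show ?thesis
    proof (rule LIMSEQ_unique)
    show "(\<lambda>N. mat_norm (tensor_sum n d (coeffs (L N)) y)) \<longlonglongrightarrow> mat_norm (tensor_sum n d a y)"
      by (rule tendsto_tensor_sum_coeff) (rule L[rule_format])
    have "mat_norm (tensor_sum n d (coeffs (L N)) y) = mat_norm (tensor_sum n d (coeffs (L N)) e)" for N
      using tests[of "(n - 1, L N)"] n by (simp add: test_norm_def)
    moreover have "(\<lambda>N. mat_norm (tensor_sum n d (coeffs (L N)) e)) \<longlonglongrightarrow> mat_norm (tensor_sum n d a e)"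
      by (rule tendsto_tensor_sum_coeff) (rule L[rule_format])
    ultimately show "(\<lambda>N. mat_norm (tensor_sum n d (coeffs (L N)) y)) \<longlonglongrightarrow> mat_norm (tensor_sum n d a e)"
      by simp
    qed
  qed
  ultimately show ?thesis by (intro exI[of _ y]) simp
qed

section \<open>Embeddings determined by norm-preserving tuples\<close>

text \<open>What the norms of one tuple yield: everything in a unital complete isometry except
  surjectivity, which needs embeddings in both directions.\<close>

definition complete_embedding ::
    "'a::matricial_cstar_algebra set \<Rightarrow> 'b::matricial_cstar_algebra set \<Rightarrow> ('a \<Rightarrow> 'b) \<Rightarrow> bool"
  where "complete_embedding X Y u \<longleftrightarrow> u ` X \<subseteq> Y \<and>
    (\<forall>x\<in>X. \<forall>y\<in>X. u (x + y) = u x + u y) \<and> (\<forall>c. \<forall>x\<in>X. u (c *\<^sub>C x) = c *\<^sub>C u x) \<and> u 1 = 1 \<and>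
    (\<forall>n\<ge>1. \<forall>x\<in>matrices_over X n. mat_norm (map_mat u x) = mat_norm x)"

lemma unitally_completely_isometric_iff_embedding:
  "unitally_completely_isometric X Y \<longleftrightarrow> (\<exists>u. bij_betw u X Y \<and> complete_embedding X Y u)"
  unfolding unitally_completely_isometric_def complete_embedding_def
  by (rule arg_cong[of _ _ Ex], rule ext) (simp add: bij_betw_def cong: conj_cong)

lemma complete_embedding_of_tuple:
  fixes e :: "nat \<Rightarrow> 'a::matricial_cstar_algebra" and y :: "nat \<Rightarrow> 'b::matricial_cstar_algebra"
  assumes X: "X = lincombs d e" and d: "d \<ge> 1" and e0: "e 0 = 1" and y0: "y 0 = 1"
    and Y: "csubspace Y" "\<And>i. i < d \<Longrightarrow> y i \<in> Y"
    and iso: "\<And>n a. n \<ge> 1 \<Longrightarrow> mat_norm (tensor_sum n d a y) = mat_norm (tensor_sum n d a e)"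
  shows "\<exists>u. complete_embedding X Y u"
proof -
  define cf where "cf x = (SOME c. x = (\<Sum>i<d. c i *\<^sub>C e i))" for x
  have cf: "(\<Sum>i<d. cf x i *\<^sub>C e i) = x" if "x \<in> X" for x
  proof -
    have "\<exists>c. x = (\<Sum>i<d. c i *\<^sub>C e i)" using that by (auto simp: X lincombs_def)
    from someI_ex[OF this] show ?thesis unfolding cf_def ..
  qed
  define u where "u x = (\<Sum>i<d. cf x i *\<^sub>C y i)" for x
  have u: "u x = (\<Sum>i<d. c i *\<^sub>C y i)" if x: "x = (\<Sum>i<d. c i *\<^sub>C e i)" for x c
  proof -
    have "x \<in> X" unfolding X lincombs_def mem_Collect_eq using x by (intro exI[of _ c]) simp
    have sub: "(\<Sum>i<d. (cf x i - c i) *\<^sub>C g i) = (\<Sum>i<d. cf x i *\<^sub>C g i) - (\<Sum>i<d. c i *\<^sub>C g i)"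
      for g :: "nat \<Rightarrow> 'c::complex_vector"
      by (simp add: complex_vector.scale_left_diff_distrib sum_subtractf)
    \<comment> \<open>Two representations of x differ by a linear relation among the e_i; the 1 x 1
      case of \<open>iso\<close> turns it into the same relation among the y_i, so u does not depend
      on the choice made in \<open>cf\<close>.\<close>
    have "norm (u x - (\<Sum>i<d. c i *\<^sub>C y i)) = norm (\<Sum>i<d. (cf x i - c i) *\<^sub>C y i)"
      by (simp only: sub u_def)
    also have "\<dots> = norm (\<Sum>i<d. (cf x i - c i) *\<^sub>C e i)"
      using iso[of 1 "\<lambda>i p q. cf x i - c i"] by (simp only: tensor_sum_1)
    also have "(\<Sum>i<d. (cf x i - c i) *\<^sub>C e i) = 0"
      unfolding sub cf[OF \<open>x \<in> X\<close>] using x by (simp only: diff_self)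
    finally show ?thesis by simp
  qed
  have "u x \<in> Y" for x
    unfolding u_def by (intro complex_vector.subspace_sum[OF Y(1)] complex_vector.subspace_scale[OF Y(1)] Y(2)) simp
  moreover have "u (x + z) = u x + u z" if "x \<in> X" "z \<in> X" for x z
  proof -
    have s: "(\<Sum>i<d. (cf x i + cf z i) *\<^sub>C g i) = (\<Sum>i<d. cf x i *\<^sub>C g i) + (\<Sum>i<d. cf z i *\<^sub>C g i)"
      for g :: "nat \<Rightarrow> 'c::complex_vector"
      by (simp add: scaleC_add_left sum.distrib)
    from u[of "x + z" "\<lambda>i. cf x i + cf z i"] show ?thesis
      unfolding s cf[OF that(1)] cf[OF that(2)] u_def[of x] u_def[of z] by simp
  qed
  moreover have "u (c *\<^sub>C x) = c *\<^sub>C u x" if "x \<in> X" for c x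
  proof -
    have s: "(\<Sum>i<d. (c * cf x i) *\<^sub>C g i) = c *\<^sub>C (\<Sum>i<d. cf x i *\<^sub>C g i)" for g :: "nat \<Rightarrow> 'c::complex_vector"
      by (simp add: complex_vector.scale_sum_right)
    from u[of "c *\<^sub>C x" "\<lambda>i. c * cf x i"] show ?thesis
      unfolding s cf[OF that] u_def[of x] by simp
  qed
  moreover have "u 1 = 1"
  proof -
    have s: "(\<Sum>i<d. (if i = 0 then 1 else 0) *\<^sub>C g i) = g 0" for g :: "nat \<Rightarrow> 'c::complex_vector"
    proof -
      have "(\<Sum>i<d. (if i = 0 then 1 else 0) *\<^sub>C g i) = (\<Sum>i<d. if i = 0 then g 0 else 0)"
        by (intro sum.cong) auto
      then show ?thesis using d by simp
    qed
    from u[of 1 "\<lambda>i. if i = 0 then 1 else 0"] show ?thesis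
      unfolding s e0 y0 by simp
  qed
  moreover have "\<forall>n\<ge>1. \<forall>x\<in>matrices_over X n. mat_norm (map_mat u x) = mat_norm x"
  proof (intro allI impI ballI)
    fix n :: nat and x assume n: "n \<ge> 1" and x: "x \<in> matrices_over X n"
    have c: "x \<in> carrier_mat n n" and xX: "\<And>p q. p < n \<Longrightarrow> q < n \<Longrightarrow> x $$ (p, q) \<in> X"
      using x by (auto simp: matrices_over_def intro: elements_matI)
    have "x = tensor_sum n d (\<lambda>i p q. cf (x $$ (p, q)) i) e"
      using c by (intro eq_matI) (auto simp: tensor_sum_def cf xX)
    moreover have "map_mat u x = tensor_sum n d (\<lambda>i p q. cf (x $$ (p, q)) i) y"
      using c by (intro eq_matI) (auto simp: tensor_sum_def u_def)
    ultimately show "mat_norm (map_mat u x) = mat_norm x" using iso[OF n, of "\<lambda>i p q. cf (x $$ (p, q)) i"] by simp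
  qed
  ultimately have "complete_embedding X Y u"
    unfolding complete_embedding_def by blast
  then show ?thesis by (rule exI[of _ u])
qed

section \<open>Complete embeddings\<close>

lemma subspace_lincombs: "csubspace X \<Longrightarrow> (\<And>i. i < d \<Longrightarrow> e i \<in> X) \<Longrightarrow> lincombs d e \<subseteq> X"
  unfolding lincombs_def
  by (auto intro!: complex_vector.subspace_sum complex_vector.subspace_scale)

text \<open>The prescribed vector is put in front of a finite spanning set. This may create a
  dependence, which does no harm because all later arguments allow redundant spanning
  tuples.\<close>

lemma finitely_generated_lincombs:
  assumes "finitely_generated X" "x0 \<in> X"
  shows "\<exists>d e. d \<ge> 1 \<and> e 0 = x0 \<and> X = lincombs d e"
proof -
  obtain B where B: "finite B" "X = cspan B"
    using assms by (auto simp: finitely_generated_def)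
  obtain h where h: "bij_betw h {0..<card B} B"
    using ex_bij_betw_nat_finite[OF B(1)] ..
  define e where "e i = (case i of 0 \<Rightarrow> x0 | Suc j \<Rightarrow> h j)" for i
  have sub: "csubspace X" unfolding B by (rule complex_vector.subspace_span)
  have "e i \<in> X" if "i < Suc (card B)" for i
    using that assms(2) bij_betwE[OF h] complex_vector.span_superset[of B]
    by (auto simp: e_def B(2) split: nat.split)
  then have "lincombs (Suc (card B)) e \<subseteq> X"
    by (rule subspace_lincombs[OF sub])
  moreover have "x \<in> lincombs (Suc (card B)) e" if "x \<in> X" for x
  proof -
    from that have "x \<in> range (\<lambda>u. \<Sum>v\<in>B. u v *\<^sub>C v)"
      unfolding B(2) complex_vector.span_finite[OF B(1)] .
    then obtain u where u: "x = (\<Sum>v\<in>B. u v *\<^sub>C v)" ..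
    also have "\<dots> = (\<Sum>j\<in>{0..<card B}. u (h j) *\<^sub>C h j)"
      by (rule sum.reindex_bij_betw[OF h, symmetric])
    also have "\<dots> = (\<Sum>i<Suc (card B). (case i of 0 \<Rightarrow> 0 | Suc j \<Rightarrow> u (h j)) *\<^sub>C e i)"
      unfolding sum.lessThan_Suc_shift by (simp add: e_def atLeast0LessThan)
    finally show ?thesis unfolding lincombs_def mem_Collect_eq by (intro exI conjI) auto
  qed
  ultimately have "X = lincombs (Suc (card B)) e" by blast
  then show ?thesis by (intro exI[of _ "Suc (card B)"] exI[of _ e]) (simp add: e_def)
qed

lemma injective_imp_surjective_on_span:
  fixes T :: "'a::complex_vector \<Rightarrow> 'a"
  assumes "finite S" and Y: "Y = cspan S"
    and into: "\<And>y. y \<in> Y \<Longrightarrow> T y \<in> Y"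
    and add: "\<And>x y. x \<in> Y \<Longrightarrow> y \<in> Y \<Longrightarrow> T (x + y) = T x + T y"
    and scale: "\<And>c y. y \<in> Y \<Longrightarrow> T (c *\<^sub>C y) = c *\<^sub>C T y"
    and inj: "\<And>y. y \<in> Y \<Longrightarrow> T y = 0 \<Longrightarrow> y = 0"
  shows "Y \<subseteq> T ` Y"
proof -
  have sub: "csubspace Y" unfolding Y by (rule complex_vector.subspace_span)
  obtain B where B: "B \<subseteq> Y" "complex_vector.independent B" "Y \<subseteq> cspan B"
    by (rule complex_vector.maximal_independent_subset)
  have "B \<subseteq> cspan S" using B(1) Y by simp
  from complex_vector.independent_span_bound[OF assms(1) B(2) this] have fB: "finite B" ..
  have T0: "T 0 = 0"
    using scale[OF complex_vector.subspace_0[OF sub], of 0] by simp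
  have Tsum: "T (\<Sum>b\<in>A. c b *\<^sub>C b) = (\<Sum>b\<in>A. c b *\<^sub>C T b)" if "A \<subseteq> Y" for A c
    using that
  proof (induction A rule: infinite_finite_induct)
    case (insert b A)
    then have "(\<Sum>b\<in>A. c b *\<^sub>C b) \<in> Y"
      by (intro complex_vector.subspace_sum[OF sub] complex_vector.subspace_scale[OF sub]) auto
    then show ?case
      using insert by (simp add: add scale complex_vector.subspace_scale[OF sub])
  qed (simp_all add: T0)
  have injB: "inj_on T B"
  proof (rule inj_onI)
    fix x y assume xy: "x \<in> B" "y \<in> B" "T x = T y"
    then have Y': "x \<in> Y" "y \<in> Y" using B(1) by auto
    have m: "(-1) *\<^sub>C z = - z" for z :: 'a
      by (metis complex_vector.scale_minus_left complex_vector.scale_one)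
    have "T (x + (-1) *\<^sub>C y) = T x + (-1) *\<^sub>C T y"
      by (simp only: add[OF Y'(1) complex_vector.subspace_scale[OF sub Y'(2)]] scale[OF Y'(2)])
    also have "\<dots> = 0" using xy(3) by (simp only: m add.right_inverse)
    finally have "T (x + (-1) *\<^sub>C y) = 0" .
    from inj[OF _ this] have "x + (-1) *\<^sub>C y = 0"
      by (simp only: complex_vector.subspace_add[OF sub Y'(1) complex_vector.subspace_scale[OF sub Y'(2)]])
    then show "x = y" by (simp only: m add_uminus_conv_diff right_minus_eq)
  qed
  have indT: "complex_vector.independent (T ` B)"
  proof (rule complex_vector.independent_if_scalars_zero)
    fix f w assume f: "(\<Sum>x\<in>T ` B. f x *\<^sub>C x) = 0" and w: "w \<in> T ` B"
    have "T (\<Sum>b\<in>B. f (T b) *\<^sub>C b) = 0"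
      using f by (simp add: Tsum[OF B(1)] sum.reindex[OF injB])
    moreover have "(\<Sum>b\<in>B. f (T b) *\<^sub>C b) \<in> Y"
      by (intro complex_vector.subspace_sum[OF sub] complex_vector.subspace_scale[OF sub] subsetD[OF B(1)])
    ultimately have "(\<Sum>b\<in>B. f (T b) *\<^sub>C b) = 0"
      by (rule inj[rotated])
    from complex_vector.independentD[OF B(2) fB order_refl this]
    show "f w = 0" using w by auto
  qed (use fB in simp)
  have span: "Y \<subseteq> cspan (T ` B)"
  proof (rule subsetI, rule ccontr)
    fix y assume y: "y \<in> Y" and ny: "y \<notin> cspan (T ` B)"
    have ind: "complex_vector.independent (insert y (T ` B))"
      by (rule complex_vector.independent_insertI[OF ny indT])
    have "T ` B \<subseteq> Y" using into B(1) by (intro image_subsetI) (rule into, erule subsetD)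
    then have "insert y (T ` B) \<subseteq> cspan B"
      using y B(3) by (simp add: subset_trans[OF _ B(3)] subsetD[OF B(3)])
    from complex_vector.independent_span_bound[OF fB ind this]
    have "card (insert y (T ` B)) \<le> card B" ..
    moreover have "y \<notin> T ` B"
      using ny complex_vector.span_superset[of "T ` B"] by (rule contra_subsetD[rotated])
    ultimately show False
      using fB card_image[OF injB] by simp
  qed
  have "cspan (T ` B) \<subseteq> T ` Y"
  proof
    fix z assume "z \<in> cspan (T ` B)"
    then have "z \<in> range (\<lambda>u. \<Sum>v\<in>T ` B. u v *\<^sub>C v)"
      unfolding complex_vector.span_finite[OF finite_imageI[OF fB]] .
    then obtain u where "z = (\<Sum>v\<in>T ` B. u v *\<^sub>C v)" ..
    then have "z = T (\<Sum>b\<in>B. u (T b) *\<^sub>C b)"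
      by (simp add: Tsum[OF B(1)] sum.reindex[OF injB])
    moreover have "(\<Sum>b\<in>B. u (T b) *\<^sub>C b) \<in> Y"
      by (intro complex_vector.subspace_sum[OF sub] complex_vector.subspace_scale[OF sub] subsetD[OF B(1)])
    ultimately show "z \<in> T ` Y" by (rule image_eqI)
  qed
  with span show ?thesis by (rule subset_trans)
qed

lemma
  assumes u: "complete_embedding X Y u"
  shows complete_embedding_into: "x \<in> X \<Longrightarrow> u x \<in> Y"
    and complete_embedding_add: "x \<in> X \<Longrightarrow> y \<in> X \<Longrightarrow> u (x + y) = u x + u y"
    and complete_embedding_scale: "x \<in> X \<Longrightarrow> u (c *\<^sub>C x) = c *\<^sub>C u x"
    and complete_embedding_one: "u 1 = 1"
    and complete_embedding_mat_norm: "n \<ge> 1 \<Longrightarrow> A \<in> matrices_over X n \<Longrightarrow> mat_norm (map_mat u A) = mat_norm A"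
  using u by (auto simp: complete_embedding_def)

lemma complete_embedding_norm:
  assumes u: "complete_embedding X Y u" and x: "x \<in> X"
  shows "norm (u x) = norm x"
proof -
  have "mat 1 1 (\<lambda>_. x) \<in> matrices_over X 1"
    using x by (auto simp: matrices_over_def elements_mat_def)
  from complete_embedding_mat_norm[OF u order_refl this]
  have "mat_norm (map_mat u (mat 1 1 (\<lambda>_. x))) = mat_norm (mat 1 1 (\<lambda>_. x))" .
  moreover have "map_mat u (mat 1 1 (\<lambda>_. x)) = mat 1 1 (\<lambda>_. u x)"
    by (intro eq_matI) auto
  ultimately show ?thesis by (simp only: mat_norm_1x1)
qed

lemma complete_embedding_zero:
  assumes u: "complete_embedding X Y u" and X: "csubspace X"
  shows "u 0 = 0"
  using complete_embedding_norm[OF u complex_vector.subspace_0[OF X]] by simp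

lemma complete_embedding_sum:
  assumes u: "complete_embedding X Y u" and X: "csubspace X" and f: "\<And>i. i \<in> I \<Longrightarrow> f i \<in> X"
  shows "u (\<Sum>i\<in>I. f i) = (\<Sum>i\<in>I. u (f i))"
  using f
proof (induction I rule: infinite_finite_induct)
  case (insert i I)
  then have "(\<Sum>i\<in>I. f i) \<in> X" by (intro complex_vector.subspace_sum[OF X]) auto
  with insert show ?case by (simp add: complete_embedding_add[OF u])
qed (simp_all add: complete_embedding_zero[OF u X])

lemma complete_embedding_inj:
  fixes X :: "'a::matricial_cstar_algebra set" and Y :: "'b::matricial_cstar_algebra set"
  assumes u: "complete_embedding X Y u" and X: "csubspace X"
  shows "inj_on u X"
proof (rule inj_onI)
  fix x y assume xy: "x \<in> X" "y \<in> X" "u x = u y"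
  have m: "(-1) *\<^sub>C z = - z" for z :: 'b
    by (metis complex_vector.scale_minus_left complex_vector.scale_one)
  have m': "(-1) *\<^sub>C z = - z" for z :: 'a
    by (metis complex_vector.scale_minus_left complex_vector.scale_one)
  have s: "(-1) *\<^sub>C y \<in> X" by (rule complex_vector.subspace_scale[OF X xy(2)])
  \<comment> \<open>The difference is written as x + (-1) y because additivity and homogeneity of u
    are given only on X.\<close>
  have "u (x + (-1) *\<^sub>C y) = u x + (-1) *\<^sub>C u y"
    by (simp only: complete_embedding_add[OF u xy(1) s] complete_embedding_scale[OF u xy(2)])
  also have "\<dots> = 0" using xy(3) m by (simp only: add.right_inverse)
  finally have "norm (x + (-1) *\<^sub>C y) = 0"
    using complete_embedding_norm[OF u complex_vector.subspace_add[OF X xy(1) s]] by simp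
  then show "x = y" by (simp only: m' norm_eq_zero add_uminus_conv_diff right_minus_eq)
qed

text \<open>The composite of w and u is an injective linear map of the finite-dimensional space Y
  into itself, hence onto Y; therefore u is already onto.\<close>

lemma unitally_completely_isometric_of_embeddings:
  fixes X :: "'a::matricial_cstar_algebra set" and Y :: "'b::matricial_cstar_algebra set"
  assumes X: "csubspace X" and Y: "csubspace Y" "finitely_generated Y"
    and u: "complete_embedding X Y u" and w: "complete_embedding Y X w"
  shows "unitally_completely_isometric X Y"
proof -
  obtain S where S: "finite S" "Y = cspan S" using Y(2) by (auto simp: finitely_generated_def)
  have "Y \<subseteq> (\<lambda>y. u (w y)) ` Y"
  proof (rule injective_imp_surjective_on_span[OF S])
    fix y assume y: "y \<in> Y" "u (w y) = 0"
    then have "norm y = 0"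
      using complete_embedding_norm[OF u complete_embedding_into[OF w y(1)]] complete_embedding_norm[OF w y(1)] by simp
    then show "y = 0" by simp
  qed (simp_all add: complete_embedding_into[OF u] complete_embedding_into[OF w] complete_embedding_add[OF u]
      complete_embedding_add[OF w] complete_embedding_scale[OF u] complete_embedding_scale[OF w])
  then have "u ` X = Y"
    using complete_embedding_into[OF u] complete_embedding_into[OF w] by blast
  then have "bij_betw u X Y"
    using complete_embedding_inj[OF u X] by (simp add: bij_betw_def)
  with u show ?thesis
    unfolding unitally_completely_isometric_iff_embedding by (intro exI[of _ u] conjI)
qed

text \<open>The common target of the sentences and of the Borel invariant. The witness y may depend
  on F and \<epsilon>; a bound on y is implied as soon as F contains the coordinate tests.\<close>

definition approximately_embeds ::
    "'a::matricial_cstar_algebra set \<Rightarrow> 'b::matricial_cstar_algebra set \<Rightarrow> bool"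
  where "approximately_embeds X Y \<longleftrightarrow> (\<forall>d\<ge>1. \<forall>e F \<epsilon>. e 0 = 1 \<longrightarrow> (\<forall>i<d. e i \<in> X) \<longrightarrow> finite F \<longrightarrow> \<epsilon> > 0 \<longrightarrow>
    (\<exists>y. y 0 = 1 \<and> (\<forall>i<d. y i \<in> Y) \<and> (\<forall>\<tau>\<in>F. \<bar>test_norm d \<tau> y - test_norm d \<tau> e\<bar> < \<epsilon>)))"

lemma complete_embedding_of_approximate:
  fixes X :: "'a::matricial_cstar_algebra set" and Y :: "'b::matricial_cstar_algebra set"
  assumes X: "csubspace X" "1 \<in> X" "finitely_generated X"
    and Y: "csubspace Y" "1 \<in> Y" "finitely_generated Y"
    and XY: "approximately_embeds X Y"
  shows "\<exists>u. complete_embedding X Y u"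
proof -
  obtain d e where e: "d \<ge> 1" "e 0 = 1" "X = lincombs d e"
    using finitely_generated_lincombs[OF X(3,2)] by blast
  obtain m f where f: "Y = lincombs m f"
    using finitely_generated_lincombs[OF Y(3,2)] by blast
  have eX: "e i \<in> X" if "i < d" for i
  proof -
    have "e i = (\<Sum>j<d. if j = i then e i else 0)" using that by simp
    also have "\<dots> = (\<Sum>j<d. (if j = i then 1 else 0) *\<^sub>C e j)"
      by (intro sum.cong) auto
    finally show ?thesis unfolding e(3) lincombs_def mem_Collect_eq
      by (intro exI[of _ "\<lambda>j. if j = i then 1 else 0"] conjI TrueI)
  qed
  have "\<exists>y. y 0 = 1 \<and> (\<forall>i<d. y i \<in> lincombs m f) \<and>
      (\<forall>\<tau>\<in>F. \<bar>test_norm d \<tau> y - test_norm d \<tau> e\<bar> < \<epsilon>)" if "finite F" "\<epsilon> > 0" for F \<epsilon>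
    using XY e(1,2) eX that unfolding approximately_embeds_def f by simp
  then have "\<exists>y. y 0 = 1 \<and> (\<forall>i<d. y i \<in> lincombs m f) \<and>
      (\<forall>n\<ge>1. \<forall>a. mat_norm (tensor_sum n d a y) = mat_norm (tensor_sum n d a e))"
    by (rule norm_preserving_tuple[OF e(1)])
  then obtain y where y: "y 0 = 1" "\<forall>i<d. y i \<in> lincombs m f"
    "\<forall>n\<ge>1. \<forall>a. mat_norm (tensor_sum n d a y) = mat_norm (tensor_sum n d a e)"
    by (elim exE conjE)
  show ?thesis
    by (rule complete_embedding_of_tuple[where d = d and e = e and y = y]) (use e y Y(1) f in simp_all)
qed

lemma unitally_completely_isometricI:
  fixes X :: "'a::matricial_cstar_algebra set" and Y :: "'b::matricial_cstar_algebra set"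
  assumes X: "csubspace X" "1 \<in> X" "finitely_generated X"
    and Y: "csubspace Y" "1 \<in> Y" "finitely_generated Y"
    and "approximately_embeds X Y" "approximately_embeds Y X"
  shows "unitally_completely_isometric X Y"
proof -
  obtain u where u: "complete_embedding X Y u"
    using complete_embedding_of_approximate[OF X Y assms(7)] ..
  obtain w where w: "complete_embedding Y X w"
    using complete_embedding_of_approximate[OF Y X assms(8)] ..
  show ?thesis
    by (rule unitally_completely_isometric_of_embeddings[OF X(1) Y(1,3) u w])
qed

lemma complete_embedding_tensor_sum:
  assumes u: "complete_embedding X Y u" and X: "csubspace X" and x: "\<And>i. i < d \<Longrightarrow> x i \<in> X" and n: "n \<ge> 1"
  shows "mat_norm (tensor_sum n d a (\<lambda>i. u (x i))) = mat_norm (tensor_sum n d a x)"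
proof -
  have s: "a i p q *\<^sub>C x i \<in> X" if "i < d" for i p q
    by (rule complex_vector.subspace_scale[OF X x[OF that]])
  have "u (\<Sum>i<d. a i p q *\<^sub>C x i) = (\<Sum>i<d. a i p q *\<^sub>C u (x i))" for p q
    using s by (subst complete_embedding_sum[OF u X]) (auto simp: complete_embedding_scale[OF u x] intro!: sum.cong)
  then have "tensor_sum n d a (\<lambda>i. u (x i)) = map_mat u (tensor_sum n d a x)"
    by (intro eq_matI) (auto simp: tensor_sum_def)
  moreover have "tensor_sum n d a x \<in> matrices_over X n"
  proof -
    have "(\<Sum>i<d. a i p q *\<^sub>C x i) \<in> X" for p q
      by (intro complex_vector.subspace_sum[OF X] s) simp
    then show ?thesis
      by (auto simp: matrices_over_def tensor_sum_def dest!: elements_matD)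
  qed
  ultimately show ?thesis using complete_embedding_mat_norm[OF u n] by simp
qed

section \<open>Universal sentences\<close>

lemma mat_norm_map_mat_complete_embedding_diff:
  fixes X :: "'a::matricial_cstar_algebra set" and Y :: "'b::matricial_cstar_algebra set"
  assumes u: "complete_embedding X Y u" and X: "csubspace X" and n: "n \<ge> 1"
    and A: "A \<in> matrices_over X n" and B: "B \<in> matrices_over X n"
  shows "mat_norm (map_mat u A - map_mat u B) = mat_norm (A - B)"
proof -
  have c: "A \<in> carrier_mat n n" "B \<in> carrier_mat n n"
    using A B by (simp_all add: matrices_over_def)
  have AX: "A $$ (p, q) \<in> X" and BX: "B $$ (p, q) \<in> X" if "p < n" "q < n" for p q
    using A B that by (auto simp: matrices_over_def)
  have diff: "u (x - y) = u x - u y" if x: "x \<in> X" and y: "y \<in> X" for x y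
    using complete_embedding_add[OF u complex_vector.subspace_diff[OF X x y] y] by simp
  have "A - B \<in> matrices_over X n"
    using c complex_vector.subspace_diff[OF X AX BX]
    by (auto simp: matrices_over_def dest!: elements_matD)
  moreover have "map_mat u A - map_mat u B = map_mat u (A - B)"
    using c by (intro eq_matI) (auto simp: diff AX BX)
  ultimately show ?thesis using complete_embedding_mat_norm[OF u n] by simp
qed

text \<open>The size bound and membership in M_n(X) are carried through the induction because u is
  linear and isometric only on X and only for sizes from 1 on.\<close>

lemma term_value_complete_embedding:
  fixes X :: "'a::matricial_cstar_algebra set" and Y :: "'b::matricial_cstar_algebra set"
  assumes u: "complete_embedding X Y u" and X: "csubspace X" "1 \<in> X"
    and v: "\<And>n i. n \<ge> 1 \<Longrightarrow> v (n, i) \<in> matrices_over X n" and t: "has_sort t n"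
  shows "n \<ge> 1 \<and> term_value v t \<in> matrices_over X n \<and>
    term_value (\<lambda>p. map_mat u (v p)) t = map_mat u (term_value v t)"
  using t
proof (induction rule: has_sort.induct)
  case (1 n i)
  then show ?case using v by simp
next
  case (2 n)
  then show ?case
    using complex_vector.subspace_0[OF X(1)] complete_embedding_zero[OF u X(1)]
    by (auto simp: matrices_over_def dest!: elements_matD)
next
  case 3
  then show ?case
    using X(2) complete_embedding_one[OF u]
    by (auto simp: matrices_over_def dest!: elements_matD)
next
  case (4 s n t)
  then have c: "term_value v s \<in> carrier_mat n n" "term_value v t \<in> carrier_mat n n"
    and e: "\<And>p q. p < n \<Longrightarrow> q < n \<Longrightarrow> term_value v s $$ (p, q) \<in> X"
      "\<And>p q. p < n \<Longrightarrow> q < n \<Longrightarrow> term_value v t $$ (p, q) \<in> X"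
    by (auto simp: matrices_over_def)
  have "term_value v s + term_value v t \<in> matrices_over X n"
    using c complex_vector.subspace_add[OF X(1) e]
    by (auto simp: matrices_over_def dest!: elements_matD)
  moreover have "map_mat u (term_value v s) + map_mat u (term_value v t) = map_mat u (term_value v s + term_value v t)"
    using c by (intro eq_matI) (auto simp: complete_embedding_add[OF u] e)
  ultimately show ?case using 4 by simp
next
  case (5 q t n)
  then have c: "term_value v t \<in> carrier_mat n n"
    and e: "\<And>p q. p < n \<Longrightarrow> q < n \<Longrightarrow> term_value v t $$ (p, q) \<in> X"
    by (auto simp: matrices_over_def)
  have "mat_scaleC q (term_value v t) \<in> matrices_over X n"
    using c complex_vector.subspace_scale[OF X(1) e]
    by (auto simp: matrices_over_def mat_scaleC_def dest!: elements_matD)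
  moreover have "mat_scaleC q (map_mat u (term_value v t)) = map_mat u (mat_scaleC q (term_value v t))"
    using c by (intro eq_matI) (auto simp: mat_scaleC_def complete_embedding_scale[OF u] e)
  ultimately show ?case using 5 by simp
next
  case (6 n t k a b)
  then have c: "term_value v t \<in> carrier_mat k k"
    and e: "\<And>p q. p < k \<Longrightarrow> q < k \<Longrightarrow> term_value v t $$ (p, q) \<in> X"
    by (auto simp: matrices_over_def)
  have s: "z *\<^sub>C term_value v t $$ (p, q) \<in> X" if "p < k" "q < k" for z p q
    by (rule complex_vector.subspace_scale[OF X(1) e[OF that]])
  have s': "(\<Sum>q<k. z q *\<^sub>C term_value v t $$ (p, q)) \<in> X" if "p < k" for z p
    by (intro complex_vector.subspace_sum[OF X(1)] s that) simp
  have S: "(\<Sum>p<k. \<Sum>q<k. z p q *\<^sub>C term_value v t $$ (p, q)) \<in> X" for z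
    by (intro complex_vector.subspace_sum[OF X(1)] s') simp
  have uS: "u (\<Sum>p<k. \<Sum>q<k. z p q *\<^sub>C term_value v t $$ (p, q)) = (\<Sum>p<k. \<Sum>q<k. z p q *\<^sub>C u (term_value v t $$ (p, q)))" for z
  proof -
    have "u (\<Sum>p<k. \<Sum>q<k. z p q *\<^sub>C term_value v t $$ (p, q)) = (\<Sum>p<k. u (\<Sum>q<k. z p q *\<^sub>C term_value v t $$ (p, q)))"
      by (rule complete_embedding_sum[OF u X(1)]) (simp add: s')
    also have "\<dots> = (\<Sum>p<k. \<Sum>q<k. u (z p q *\<^sub>C term_value v t $$ (p, q)))"
      by (intro sum.cong refl complete_embedding_sum[OF u X(1)]) (simp add: s)
    also have "\<dots> = (\<Sum>p<k. \<Sum>q<k. z p q *\<^sub>C u (term_value v t $$ (p, q)))"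
      by (intro sum.cong refl complete_embedding_scale[OF u]) (simp add: e)
    finally show ?thesis .
  qed
  have "compress a (term_value v t) b \<in> matrices_over X n"
    using c 6(3,5) by (auto simp: matrices_over_def compress_def S dest!: elements_matD)
  moreover have "compress a (map_mat u (term_value v t)) b = map_mat u (compress a (term_value v t) b)"
    using c 6(3,5)
    by (intro eq_matI) (auto simp: compress_def uS)
  ultimately show ?case using 6 by simp
qed

text \<open>Here surjectivity of u enters: it makes the quantifiers of the two structures range over
  corresponding sets.\<close>

lemma dom_ball_image:
  fixes X :: "'a::matricial_cstar_algebra set" and Y :: "'b::matricial_cstar_algebra set"
  assumes u: "complete_embedding X Y u" and b: "bij_betw u X Y" and n: "n \<ge> 1"
  shows "dom_ball Y n k = map_mat u ` dom_ball X n k"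
proof
  show "map_mat u ` dom_ball X n k \<subseteq> dom_ball Y n k"
  proof (rule image_subsetI)
    fix A assume "A \<in> dom_ball X n k"
    then have A: "A \<in> matrices_over X n" and k: "mat_norm A \<le> real k" by (simp_all add: dom_ball_def)
    have c: "A \<in> carrier_mat n n" using A by (simp add: matrices_over_def)
    have e: "A $$ (p, q) \<in> X" if "p < n" "q < n" for p q
      using A that by (auto simp: matrices_over_def)
    have "map_mat u A \<in> matrices_over Y n"
      using c complete_embedding_into[OF u e] by (auto simp: matrices_over_def dest!: elements_matD)
    then show "map_mat u A \<in> dom_ball Y n k"
      using k complete_embedding_mat_norm[OF u n A] by (simp add: dom_ball_def)
  qed
  show "dom_ball Y n k \<subseteq> map_mat u ` dom_ball X n k"
  proof
    fix B assume "B \<in> dom_ball Y n k"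
    then have B: "B \<in> matrices_over Y n" and k: "mat_norm B \<le> real k" by (simp_all add: dom_ball_def)
    have c: "B \<in> carrier_mat n n" using B by (simp add: matrices_over_def)
    have e: "B $$ (p, q) \<in> Y" if "p < n" "q < n" for p q
      using B that by (auto simp: matrices_over_def)
    define A where "A = map_mat (inv_into X u) B"
    have uY: "u ` X = Y" using b by (simp add: bij_betw_def)
    have "A \<in> matrices_over X n"
      using c inv_into_into[of _ u X, unfolded uY, OF e]
      by (auto simp: A_def matrices_over_def dest!: elements_matD)
    moreover have BA: "B = map_mat u A"
      using c f_inv_into_f[of _ u X, unfolded uY, OF e] by (intro eq_matI) (auto simp: A_def)
    ultimately have "A \<in> dom_ball X n k"
      using k complete_embedding_mat_norm[OF u n] by (simp add: dom_ball_def)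
    with BA show "B \<in> map_mat u ` dom_ball X n k" by (rule image_eqI)
  qed
qed

text \<open>The values over which a quantifier is evaluated form the same set of reals in X and in
  Y, so suprema and infima agree without a discussion of boundedness. The assignment is generalized
  because quantifiers update it.\<close>

lemma formula_value_complete_isometry:
  fixes X :: "'a::matricial_cstar_algebra set" and Y :: "'b::matricial_cstar_algebra set"
  assumes u: "complete_embedding X Y u" and b: "bij_betw u X Y" and X: "csubspace X" "1 \<in> X"
    and "wf_formula \<phi>" "\<And>n i. n \<ge> 1 \<Longrightarrow> v (n, i) \<in> matrices_over X n"
  shows "formula_value Y (\<lambda>p. map_mat u (v p)) \<phi> = formula_value X v \<phi>"
  using assms(5,6)
proof (induction arbitrary: v rule: wf_formula.induct)
  case (1 s n t)
  have v: "v (m, i) \<in> matrices_over X m" if "m \<ge> 1" for m i by (rule 1(3)[OF that])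
  have s: "n \<ge> 1 \<and> term_value v s \<in> matrices_over X n \<and>
      term_value (\<lambda>p. map_mat u (v p)) s = map_mat u (term_value v s)"
    by (rule term_value_complete_embedding[OF u X v 1(1)])
  have t: "n \<ge> 1 \<and> term_value v t \<in> matrices_over X n \<and>
      term_value (\<lambda>p. map_mat u (v p)) t = map_mat u (term_value v t)"
    by (rule term_value_complete_embedding[OF u X v 1(2)])
  show ?case
    using s t mat_norm_map_mat_complete_embedding_diff[OF u X(1), of n "term_value v s" "term_value v t"]
    by simp
next
  case (2 \<phi>s f)
  have "map (formula_value Y (\<lambda>p. map_mat u (v p))) \<phi>s = map (formula_value X v) \<phi>s"
    using 2 by (intro map_cong) auto
  then show ?case by (simp only: formula_value.simps)
next
  case (3 n k \<phi> i)
  have upd: "(\<lambda>p. map_mat u (v p))((n, i) := map_mat u x) = (\<lambda>p. map_mat u ((v((n, i) := x)) p))" for x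
    by auto
  have "formula_value Y ((\<lambda>p. map_mat u (v p))((n, i) := map_mat u x)) \<phi> = formula_value X (v((n, i) := x)) \<phi>"
    if x: "x \<in> dom_ball X n k" for x
    unfolding upd
  proof (rule 3(4))
    show "(v((n, i) := x)) (m, j) \<in> matrices_over X m" if "m \<ge> 1" for m j
      using x 3(5)[OF that] by (auto simp: dom_ball_def)
  qed
  then have "(\<lambda>x. formula_value Y ((\<lambda>p. map_mat u (v p))((n, i) := x)) \<phi>) ` dom_ball Y n k =
      (\<lambda>x. formula_value X (v((n, i) := x)) \<phi>) ` dom_ball X n k"
    unfolding dom_ball_image[OF u b 3(1)] image_image by (intro image_cong refl)
  then show ?case by simp
next
  case (4 n k \<phi> i)
  have upd: "(\<lambda>p. map_mat u (v p))((n, i) := map_mat u x) = (\<lambda>p. map_mat u ((v((n, i) := x)) p))" for x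
    by auto
  have "formula_value Y ((\<lambda>p. map_mat u (v p))((n, i) := map_mat u x)) \<phi> = formula_value X (v((n, i) := x)) \<phi>"
    if x: "x \<in> dom_ball X n k" for x
    unfolding upd
  proof (rule 4(4))
    show "(v((n, i) := x)) (m, j) \<in> matrices_over X m" if "m \<ge> 1" for m j
      using x 4(5)[OF that] by (auto simp: dom_ball_def)
  qed
  then have "(\<lambda>x. formula_value Y ((\<lambda>p. map_mat u (v p))((n, i) := x)) \<phi>) ` dom_ball Y n k =
      (\<lambda>x. formula_value X (v((n, i) := x)) \<phi>) ` dom_ball X n k"
    unfolding dom_ball_image[OF u b 4(1)] image_image by (intro image_cong refl)
  then show ?case by simp
qed

lemma sentence_value_eq:
  fixes X :: "'a::matricial_cstar_algebra set" and Y :: "'b::matricial_cstar_algebra set"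
  assumes X: "csubspace X" "1 \<in> X" and "unitally_completely_isometric X Y" and \<phi>: "uosp_sentence \<phi>"
  shows "sentence_value X \<phi> = sentence_value Y \<phi>"
proof -
  obtain u where u: "bij_betw u X Y" "complete_embedding X Y u"
    using assms(3) unfolding unitally_completely_isometric_iff_embedding by (elim exE conjE)
  \<comment> \<open>The default assignment of \<open>sentence_value\<close> corresponds to itself
    under u.\<close>
  have z: "(case p of (n, i) \<Rightarrow> 0\<^sub>m n n) = map_mat u (case p of (n, i) \<Rightarrow> 0\<^sub>m n n)" for p :: "nat \<times> nat"
    using complete_embedding_zero[OF u(2) X(1)] by (intro eq_matI) (auto split: prod.split)
  have "formula_value Y (\<lambda>p. map_mat u (case p of (n, i) \<Rightarrow> 0\<^sub>m n n)) \<phi> = formula_value X (\<lambda>(n, i). 0\<^sub>m n n) \<phi>"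
  proof (rule formula_value_complete_isometry[OF u(2,1) X])
    show "wf_formula \<phi>" using \<phi> by (simp add: uosp_sentence_def)
    show "(case (n, i) of (n, i) \<Rightarrow> 0\<^sub>m n n) \<in> matrices_over X n" for n i :: nat
      using complex_vector.subspace_0[OF X(1)] by (auto simp: matrices_over_def dest!: elements_matD)
  qed
  then show ?thesis unfolding sentence_value_def z[symmetric] by simp
qed

section \<open>Tensor sums as terms of the language\<close>

fun sum_terms :: "nat \<Rightarrow> uosp_term list \<Rightarrow> uosp_term" where
  "sum_terms n [] = Zero n"
| "sum_terms n (t # ts) = Plus t (sum_terms n ts)"

definition column :: "nat \<Rightarrow> (nat \<Rightarrow> complex) \<Rightarrow> complex mat"
  where "column n c = mat n 1 (\<lambda>(p, _). c p)"

definition unit_row :: "nat \<Rightarrow> nat \<Rightarrow> complex mat"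
  where "unit_row n q = mat 1 n (\<lambda>(_, j). if j = q then 1 else 0)"

text \<open>Using the constant for index 0 forces the first entry of every tuple described by the
  term to be exactly the unit, in every structure.\<close>

definition variable :: "nat \<Rightarrow> uosp_term"
  where "variable i = (if i = 0 then Unit else Var 1 i)"

text \<open>Splits a_i into its columns: a_i \<otimes> x_i is the sum over q of (q-th column of a_i)
  x_i (q-th unit row). Each summand is a compression from sort 1 to sort n with Gaussian rational
  factors whenever the entries of a_i are Gaussian rational.\<close>

definition tensor_term :: "nat \<Rightarrow> nat \<Rightarrow> (nat \<Rightarrow> nat \<Rightarrow> nat \<Rightarrow> complex) \<Rightarrow> uosp_term"
  where "tensor_term n d a = sum_terms n (map (\<lambda>(i, q). Compr (column n (\<lambda>p. a i p q)) (variable i) (unit_row n q))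
    (List.product [0..<d] [0..<n]))"

text \<open>The tuple that an assignment gives to the terms \<open>variable i\<close>, with 1 x 1
  matrices identified with their entries.\<close>

definition valuation :: "(nat \<times> nat \<Rightarrow> 'a::matricial_cstar_algebra mat) \<Rightarrow> nat \<Rightarrow> 'a"
  where "valuation v i = (if i = 0 then 1 else v (1, i) $$ (0, 0))"

lemma term_value_sum_terms:
  assumes "\<And>t. t \<in> set ts \<Longrightarrow> term_value v t \<in> carrier_mat n n"
  shows "term_value v (sum_terms n ts) = mat n n (\<lambda>(p, q). \<Sum>t\<leftarrow>ts. term_value v t $$ (p, q))"
  using assms
proof (induction ts)
  case (Cons t ts)
  then have "term_value v t \<in> carrier_mat n n" by simp
  with Cons show ?case by (intro eq_matI) auto
qed (auto intro!: eq_matI)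

lemma compress_1x1:
  assumes "x \<in> carrier_mat 1 1"
  shows "compress (column n c) x (unit_row n q) = mat n n (\<lambda>(p, j). if j = q then c p *\<^sub>C x $$ (0, 0) else 0)"
  using assms by (intro eq_matI) (auto simp: compress_def column_def unit_row_def)

lemma term_value_tensor_term:
  fixes v :: "nat \<times> nat \<Rightarrow> 'a::matricial_cstar_algebra mat"
  assumes v: "\<And>i. 1 \<le> i \<Longrightarrow> i < d \<Longrightarrow> v (1, i) \<in> carrier_mat 1 1"
  shows "term_value v (tensor_term n d a) = tensor_sum n d a (valuation v)"
proof -
  let ?t = "\<lambda>(i, q). Compr (column n (\<lambda>p. a i p q)) (variable i) (unit_row n q)"
  let ?g = "\<lambda>p j (i, q). if j = q then a i p q *\<^sub>C valuation v i else 0"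
  have t: "term_value v (?t (i, q)) = mat n n (\<lambda>(p, j). ?g p j (i, q))" if "i < d" for i q
  proof -
    have c: "term_value v (variable i) \<in> carrier_mat 1 1" and e: "term_value v (variable i) $$ (0, 0) = valuation v i"
      using v[of i] that by (auto simp: variable_def valuation_def)
    show ?thesis by (simp only: prod.case term_value.simps compress_1x1[OF c] e)
  qed
  have "term_value v (tensor_term n d a) =
      mat n n (\<lambda>(p, j). \<Sum>x\<leftarrow>List.product [0..<d] [0..<n]. term_value v (?t x) $$ (p, j))"
    unfolding tensor_term_def
    by (subst term_value_sum_terms) (auto simp: t[simplified] comp_def)
  also have "\<dots> = tensor_sum n d a (valuation v)"
    unfolding tensor_sum_def
  proof (intro cong_mat refl)
    fix p j assume pj: "p < n" "j < n"
    have "(\<Sum>x\<leftarrow>List.product [0..<d] [0..<n]. term_value v (?t x) $$ (p, j)) =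
        (\<Sum>x\<leftarrow>List.product [0..<d] [0..<n]. ?g p j x)"
      by (intro arg_cong[of _ _ sum_list] map_cong refl) (use pj in \<open>auto simp: t[simplified]\<close>)
    also have "\<dots> = (\<Sum>x\<in>{..<d} \<times> {..<n}. ?g p j x)"
      by (subst sum_list_distinct_conv_sum_set) (auto simp: distinct_product atLeast0LessThan)
    \<comment> \<open>In column j only the summand with q = j survives for each i.\<close>
    also have "\<dots> = (\<Sum>i<d. a i p j *\<^sub>C valuation v i)"
      unfolding sum.cartesian_product' using pj by (intro sum.cong refl) simp
    finally show "(case (p, j) of (p, j) \<Rightarrow> \<Sum>x\<leftarrow>List.product [0..<d] [0..<n]. term_value v (?t x) $$ (p, j)) =
        (case (p, j) of (p, q) \<Rightarrow> \<Sum>i<d. a i p q *\<^sub>C valuation v i)"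
      by simp
  qed
  finally show ?thesis .
qed

lemma has_sort_sum_terms: "n \<ge> 1 \<Longrightarrow> (\<And>t. t \<in> set ts \<Longrightarrow> has_sort t n) \<Longrightarrow> has_sort (sum_terms n ts) n"
  by (induction ts) (auto intro: has_sort.intros)

lemma has_sort_tensor_term:
  assumes "n \<ge> 1" "\<And>i p q. a i p q \<in> gauss_rat"
  shows "has_sort (tensor_term n d a) n"
  unfolding tensor_term_def
proof (intro has_sort_sum_terms assms(1))
  fix t assume "t \<in> set (map (\<lambda>(i, q). Compr (column n (\<lambda>p. a i p q)) (variable i) (unit_row n q)) (List.product [0..<d] [0..<n]))"
  then obtain i q where t: "t = Compr (column n (\<lambda>p. a i p q)) (variable i) (unit_row n q)" by auto
  show "has_sort t n"
    unfolding t
  proof (rule has_sort.intros(6)[OF assms(1)])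
    show "has_sort (variable i) 1"
      by (cases "i = 0")
        (simp_all only: variable_def if_True if_False simp_thms has_sort.intros(3) has_sort.intros(1)[OF order_refl])
    show "elements_mat (column n (\<lambda>p. a i p q)) \<subseteq> gauss_rat" "elements_mat (unit_row n q) \<subseteq> gauss_rat"
      using assms(2) by (auto simp: column_def unit_row_def gauss_rat_def dest!: elements_matD)
  qed (simp_all add: column_def unit_row_def)
qed

lemma term_vars_sum_terms: "term_vars (sum_terms n ts) = (\<Union>t\<in>set ts. term_vars t)"
  by (induction ts) auto

lemma term_vars_tensor_term: "term_vars (tensor_term n d a) \<subseteq> {1} \<times> {1..<d}"
  by (auto simp: tensor_term_def term_vars_sum_terms variable_def split: if_splits)

lemma coeffs_gauss_rat: "coeffs l i p q \<in> gauss_rat"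
  by (simp add: coeffs_def gauss_def gauss_rat_def)

section \<open>Prefixes of suprema\<close>

text \<open>The largest index is bound outermost, and the recursion stops before index 0, which
  stands for the unit and not for a variable.\<close>

fun sups :: "nat \<Rightarrow> nat \<Rightarrow> uosp_formula \<Rightarrow> uosp_formula" where
  "sups k 0 \<phi> = \<phi>"
| "sups k (Suc i) \<phi> = SupQ 1 k (Suc i) (sups k i \<phi>)"

lemma wf_sups: "k \<ge> 1 \<Longrightarrow> wf_formula \<phi> \<Longrightarrow> wf_formula (sups k i \<phi>)"
  by (induction i) (auto intro: wf_formula.intros)

lemma universal_sups: "universal (sups k i \<phi>) = universal \<phi>"
  by (induction i) auto

lemma free_vars_sups: "free_vars (sups k i \<phi>) = free_vars \<phi> - {1} \<times> {1..i}"
proof (induction i)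
  case (Suc i)
  have "{1..Suc i} = insert (Suc i) {1..i}" by (simp add: atLeastAtMostSuc_conv)
  then show ?case unfolding sups.simps free_vars.simps Suc by blast
qed simp

text \<open>Makes the quantifier ranges nonempty, as the order laws for real suprema
  require.\<close>

lemma zero_in_dom_ball:
  assumes "csubspace X"
  shows "0\<^sub>m n n \<in> dom_ball X n k"
proof -
  have "mat_norm (0\<^sub>m n n :: 'a mat) = 0"
    using mat_norm_eq_0_iff[of "0\<^sub>m n n" n] by simp
  then show ?thesis
    using complex_vector.subspace_0[OF assms] by (auto simp: dom_ball_def matrices_over_def dest!: elements_matD)
qed

context
  fixes X :: "'a::matricial_cstar_algebra set" and \<phi> :: uosp_formula and k :: nat
  assumes X: "csubspace X" and nonpos: "\<And>v. formula_value X v \<phi> \<le> 0"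
begin

text \<open>Real suprema obey the usual laws only over sets bounded above; the constant bound 0
  supplies this for every nested quantifier and every assignment.\<close>

lemma formula_value_sups_nonpos: "formula_value X v (sups k i \<phi>) \<le> 0"
proof (induction i arbitrary: v)
  case (Suc i)
  show ?case unfolding sups.simps formula_value.simps
    by (rule cSUP_least) (use zero_in_dom_ball[OF X] Suc in auto)
qed (simp add: nonpos)

lemma bdd_above_sups:
  "bdd_above ((\<lambda>x. formula_value X (v((1, j) := x)) (sups k i \<phi>)) ` S)"
  by (rule bdd_aboveI2) (rule formula_value_sups_nonpos)

lemma formula_value_sups_ge:
  assumes "\<And>j. 1 \<le> j \<Longrightarrow> j \<le> i \<Longrightarrow> w j \<in> dom_ball X 1 k"
  shows "formula_value X (\<lambda>(n, j). if n = 1 \<and> 1 \<le> j \<and> j \<le> i then w j else v (n, j)) \<phi> \<le> formula_value X v (sups k i \<phi>)"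
  using assms
proof (induction i arbitrary: v)
  case 0
  have "(\<lambda>(n, j). if n = 1 \<and> 1 \<le> j \<and> j \<le> 0 then w j else v (n, j)) = v" by auto
  then show ?case by simp
next
  case (Suc i)
  \<comment> \<open>The outermost supremum is bounded below by its value at
    \<open>w (Suc i)\<close>; the remaining quantifiers then start from the assignment updated
    there.\<close>
  have eq: "(\<lambda>(n, j). if n = 1 \<and> 1 \<le> j \<and> j \<le> Suc i then w j else v (n, j)) =
      (\<lambda>(n, j). if n = 1 \<and> 1 \<le> j \<and> j \<le> i then w j else (v((1, Suc i) := w (Suc i))) (n, j))"
    by (auto simp: fun_eq_iff le_Suc_eq)
  have "formula_value X (\<lambda>(n, j). if n = 1 \<and> 1 \<le> j \<and> j \<le> Suc i then w j else v (n, j)) \<phi> \<le> formula_value X (v((1, Suc i) := w (Suc i))) (sups k i \<phi>)"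
    unfolding eq by (rule Suc.IH) (use Suc.prems in simp)
  also have "\<dots> \<le> formula_value X v (sups k (Suc i) \<phi>)"
    unfolding sups.simps formula_value.simps
    by (rule cSUP_upper[OF _ bdd_above_sups]) (use Suc.prems in simp)
  finally show ?case .
qed

text \<open>Since c is strictly below the value, each supremum can be replaced by a single point
  without falling to c. The clause on j > i preserves the point chosen for the outer quantifier
  through the induction.\<close>

lemma formula_value_sups_witness:
  assumes "c < formula_value X v (sups k i \<phi>)"
  shows "\<exists>v'. (\<forall>j. 1 \<le> j \<and> j \<le> i \<longrightarrow> v' (1, j) \<in> dom_ball X 1 k) \<and>
    (\<forall>j>i. v' (1, j) = v (1, j)) \<and> c < formula_value X v' \<phi>"
  using assms
proof (induction i arbitrary: v)
  case 0
  then show ?case by (intro exI[of _ v]) auto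
next
  case (Suc i)
  have ne: "dom_ball X 1 k \<noteq> {}" using zero_in_dom_ball[OF X] by blast
  from Suc.prems have "\<exists>x\<in>dom_ball X 1 k. c < formula_value X (v((1, Suc i) := x)) (sups k i \<phi>)"
    unfolding sups.simps formula_value.simps less_cSUP_iff[OF ne bdd_above_sups] .
  then obtain x where x: "x \<in> dom_ball X 1 k" "c < formula_value X (v((1, Suc i) := x)) (sups k i \<phi>)" ..
  obtain v' where v': "\<forall>j. 1 \<le> j \<and> j \<le> i \<longrightarrow> v' (1, j) \<in> dom_ball X 1 k"
    "\<forall>j>i. v' (1, j) = (v((1, Suc i) := x)) (1, j)" "c < formula_value X v' \<phi>"
    using Suc.IH[OF x(2)] by (elim exE conjE)
  then show ?case using x(1) by (intro exI[of _ v']) (auto simp: le_Suc_eq)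
qed

end

section \<open>Sentences that measure the distance from given norms\<close>

text \<open>Distance to \<open>Zero\<close> expresses the norm of the matrix. The targets
  \<open>r\<close> may be arbitrary reals because every continuous function is a connective.\<close>

definition deviation :: "nat \<Rightarrow> test list \<Rightarrow> (nat \<Rightarrow> real) \<Rightarrow> uosp_formula"
  where "deviation d \<tau>s r = Conn (\<lambda>x. - (\<Sum>j<length \<tau>s. \<bar>x j - r j\<bar>))
    (map (\<lambda>\<tau>. Dist (tensor_term (Suc (fst \<tau>)) d (coeffs (snd \<tau>))) (Zero (Suc (fst \<tau>)))) \<tau>s)"

lemma wf_deviation: "wf_formula (deviation d \<tau>s r)"
  unfolding deviation_def
proof (rule wf_formula.intros)
  show "continuous_map (powertop_real {..<length (map (\<lambda>\<tau>. Dist (tensor_term (Suc (fst \<tau>)) d (coeffs (snd \<tau>))) (Zero (Suc (fst \<tau>)))) \<tau>s)})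
      euclideanreal (\<lambda>x. - (\<Sum>j<length \<tau>s. \<bar>x j - r j\<bar>))"
    by (intro continuous_intros) (auto intro!: continuous_map_product_projection)
  show "wf_formula \<psi>" if "\<psi> \<in> set (map (\<lambda>\<tau>. Dist (tensor_term (Suc (fst \<tau>)) d (coeffs (snd \<tau>))) (Zero (Suc (fst \<tau>)))) \<tau>s)" for \<psi>
    using that by (auto intro!: wf_formula.intros(1) has_sort_tensor_term has_sort.intros coeffs_gauss_rat)
qed

lemma formula_value_deviation:
  assumes "\<And>i. 1 \<le> i \<Longrightarrow> i < d \<Longrightarrow> v (1, i) \<in> carrier_mat 1 1"
  shows "formula_value X v (deviation d \<tau>s r) = - (\<Sum>j<length \<tau>s. \<bar>test_norm d (\<tau>s ! j) (valuation v) - r j\<bar>)"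
proof -
  have "A - 0\<^sub>m n n = A" if "A \<in> carrier_mat n n" for n and A :: "'a mat"
    using that by (intro eq_matI) auto
  then show ?thesis
    by (simp add: deviation_def term_value_tensor_term[of d v, OF assms] test_norm_def)
qed

text \<open>The tuple e makes the deviation vanish, so the nonpositive sentence has value 0 in X and
  hence in Y. An assignment in Y with value above -\<epsilon> keeps a sum of nonnegative errors
  below \<epsilon>, and thus every single error.\<close>

lemma approximately_embeds_of_sentences:
  fixes X :: "'a::matricial_cstar_algebra set" and Y :: "'b::matricial_cstar_algebra set"
  assumes X: "csubspace X" "1 \<in> X" and Y: "csubspace Y" "1 \<in> Y"
    and eq: "\<And>\<phi>. uosp_sentence \<phi> \<Longrightarrow> universal \<phi> \<Longrightarrow> sentence_value X \<phi> = sentence_value Y \<phi>"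
  shows "approximately_embeds X Y"
  unfolding approximately_embeds_def
proof (intro allI impI)
  fix d :: nat and e :: "nat \<Rightarrow> 'a" and F :: "test set" and \<epsilon> :: real
  assume d: "d \<ge> 1" and e: "e 0 = 1" "\<forall>i<d. e i \<in> X" and F: "finite F" and \<epsilon>: "\<epsilon> > 0"
  obtain \<tau>s where \<tau>s: "set \<tau>s = F" using finite_list[OF F] ..
  \<comment> \<open>The quantifiers range over balls, so a radius is chosen that contains all
    entries of e; the successor makes it at least 1.\<close>
  obtain k0 :: nat where k0: "(\<Sum>i<d. norm (e i)) < real k0" using reals_Archimedean2 ..
  define k where "k = Suc k0"
  define r where "r j = test_norm d (\<tau>s ! j) e" for j
  define \<psi> where "\<psi> = deviation d \<tau>s r"
  \<comment> \<open>The d - 1 quantifiers bind the coordinates 1, ..., d - 1; coordinate 0 is the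
    unit.\<close>
  define \<phi> where "\<phi> = sups k (d - 1) \<psi>"
  have nonposX: "formula_value X v \<psi> \<le> 0" for v
    by (simp add: \<psi>_def deviation_def sum_nonneg)
  have nonposY: "formula_value Y v \<psi> \<le> 0" for v
    by (simp add: \<psi>_def deviation_def sum_nonneg)
  have "free_vars \<psi> \<subseteq> {1} \<times> {1..<d}"
    using term_vars_tensor_term by (fastforce simp: \<psi>_def deviation_def)
  moreover have "{1..<d} = {1..d - 1}" using d by auto
  ultimately have "free_vars \<phi> = {}"
    unfolding \<phi>_def free_vars_sups by (simp only: Diff_eq_empty_iff)
  then have "uosp_sentence \<phi>"
    using wf_sups[of k \<psi> "d - 1"] wf_deviation[of d \<tau>s r]
    by (simp add: uosp_sentence_def \<phi>_def k_def \<psi>_def)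
  moreover have "universal \<phi>"
    by (simp add: \<phi>_def universal_sups \<psi>_def deviation_def)
  ultimately have XY: "sentence_value X \<phi> = sentence_value Y \<phi>" by (rule eq)
  define w where "w j = mat 1 1 (\<lambda>_. e j)" for j
  define v where "v = (\<lambda>(n, j). if n = 1 \<and> 1 \<le> j \<and> j \<le> d - 1 then w j else 0\<^sub>m n n)"
  have w: "w j \<in> dom_ball X 1 k" if "1 \<le> j" "j \<le> d - 1" for j
  proof -
    have "j < d" using that d by simp
    have "norm (e j) \<le> (\<Sum>i<d. norm (e i))" using \<open>j < d\<close> by (intro member_le_sum) auto
    then have "mat_norm (w j) \<le> real k"
      using k0 unfolding w_def mat_norm_1x1 by (simp add: k_def)
    then show ?thesis using e(2) \<open>j < d\<close>
      by (auto simp: dom_ball_def matrices_over_def w_def dest!: elements_matD)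
  qed
  have "formula_value X v \<psi> \<le> sentence_value X \<phi>"
    unfolding v_def sentence_value_def \<phi>_def
    using formula_value_sups_ge[OF X(1) nonposX, where i = "d - 1" and w = w and k = k and v = "\<lambda>(n, i). 0\<^sub>m n n", OF w]
    by (simp cong: if_cong)
  moreover have "formula_value X v \<psi> = 0"
  proof -
    have "test_norm d \<tau> (valuation v) = test_norm d \<tau> e" for \<tau>
      using d by (intro test_norm_cong) (auto simp: valuation_def v_def w_def e(1))
    moreover have "v (1, i) \<in> carrier_mat 1 1" if "1 \<le> i" "i < d" for i
      using that by (simp add: v_def w_def)
    ultimately show ?thesis unfolding \<psi>_def by (subst formula_value_deviation) (simp_all add: r_def)
  qed
  ultimately have "- \<epsilon> < sentence_value Y \<phi>" using \<epsilon> XY by simp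
  then obtain v' where v': "\<forall>j. 1 \<le> j \<and> j \<le> d - 1 \<longrightarrow> v' (1, j) \<in> dom_ball Y 1 k" "- \<epsilon> < formula_value Y v' \<psi>"
    unfolding sentence_value_def \<phi>_def
    using formula_value_sups_witness[OF Y(1) nonposY] by blast
  have m: "v' (1, i) \<in> matrices_over Y 1" if "1 \<le> i" "i < d" for i
    using v'(1) that by (simp add: dom_ball_def)
  have c: "v' (1, i) \<in> carrier_mat 1 1" if "1 \<le> i" "i < d" for i
    using m[OF that] by (simp add: matrices_over_def)
  have "(\<Sum>j<length \<tau>s. \<bar>test_norm d (\<tau>s ! j) (valuation v') - r j\<bar>) < \<epsilon>"
  proof -
    have "formula_value Y v' \<psi> = - (\<Sum>j<length \<tau>s. \<bar>test_norm d (\<tau>s ! j) (valuation v') - r j\<bar>)"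
      unfolding \<psi>_def by (rule formula_value_deviation) (rule c)
    with v'(2) show ?thesis by linarith
  qed
  then have dev: "\<bar>test_norm d (\<tau>s ! j) (valuation v') - r j\<bar> < \<epsilon>" if "j < length \<tau>s" for j
    using member_le_sum[of j "{..<length \<tau>s}" "\<lambda>j. \<bar>test_norm d (\<tau>s ! j) (valuation v') - r j\<bar>"] that by simp
  show "\<exists>y. y 0 = 1 \<and> (\<forall>i<d. y i \<in> Y) \<and> (\<forall>\<tau>\<in>F. \<bar>test_norm d \<tau> y - test_norm d \<tau> e\<bar> < \<epsilon>)"
  proof (intro exI[of _ "valuation v'"] conjI allI impI ballI)
    show "valuation v' 0 = 1" by (simp add: valuation_def)
    show "valuation v' i \<in> Y" if "i < d" for i
    proof (cases "i = 0")
      case False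
      then have i: "1 \<le> i" by simp
      have "v' (1, i) $$ (0, 0) \<in> elements_mat (v' (1, i))"
        by (rule elements_matI[OF c[OF i that]]) simp_all
      with m[OF i that] False show ?thesis
        by (auto simp: valuation_def matrices_over_def)
    qed (simp add: valuation_def Y(2))
    fix \<tau> assume "\<tau> \<in> F"
    then obtain j where "j < length \<tau>s" "\<tau> = \<tau>s ! j"
      unfolding \<tau>s[symmetric] in_set_conv_nth by auto
    with dev[of j] show "\<bar>test_norm d \<tau> (valuation v') - test_norm d \<tau> e\<bar> < \<epsilon>"
      by (simp add: r_def)
  qed
qed

section \<open>A Borel invariant\<close>

lemma openin_wot: "open U \<Longrightarrow> openin wot ((\<lambda>A. cinner (bop_apply A \<xi>) \<eta>) -` U)"
  unfolding wot_def by (rule topology_generated_by_Basis) blast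

text \<open>Membership in \<open>bop_borel_sets\<close> is decided on balls, and there the preimage
  of an open set is relatively open for the weak operator topology.\<close>

lemma measurable_matrix_coefficient:
  "(\<lambda>A. cinner (bop_apply A \<xi>) \<eta>) \<in> borel_measurable bop_borel"
proof (rule borel_measurableI)
  fix U :: "complex set" assume "open U"
  have "(\<lambda>A. cinner (bop_apply A \<xi>) \<eta>) -` U \<inter> cball 0 (real n) \<in> sets (borel_of (subtopology wot (cball 0 (real n))))" for n
    unfolding sets_borel_of
    by (rule sigma_sets.Basic) (simp add: openin_subtopology_Int openin_wot[OF \<open>open U\<close>])
  then show "(\<lambda>A. cinner (bop_apply A \<xi>) \<eta>) -` U \<inter> space bop_borel \<in> sets bop_borel"
    by (simp add: space_bop_borel sets_bop_borel bop_borel_sets_def)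
qed

section \<open>Measurability of norms from weak measurability\<close>

definition dense_seq :: "(nat \<Rightarrow> 'h::topological_space) \<Rightarrow> bool"
  where "dense_seq \<delta> \<longleftrightarrow> (\<forall>x. \<exists>s. (\<lambda>N. \<delta> (s N)) \<longlonglongrightarrow> x)"

lemma dense_seq_exists:
  assumes "separable_space (euclidean :: 'h::metric_space topology)"
  shows "\<exists>\<delta> :: nat \<Rightarrow> 'h. dense_seq \<delta>"
proof -
  obtain C :: "'h set" where C: "countable C" "closure C = UNIV"
    using assms by (auto simp: separable_space_def)
  have ne: "C \<noteq> {}" using C(2) by auto
  have "\<exists>s. (\<lambda>N. from_nat_into C (s N)) \<longlonglongrightarrow> x" for x
  proof -
    have "x \<in> closure C" using C(2) by simp
    then obtain c where c: "\<forall>n. c n \<in> C" "c \<longlonglongrightarrow> x"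
      unfolding closure_sequential by blast
    have "from_nat_into C (to_nat_on C (c N)) = c N" for N
      using C(1) c(1) by simp
    then show ?thesis using c(2) by (intro exI[of _ "\<lambda>N. to_nat_on C (c N)"]) simp
  qed
  then show ?thesis unfolding dense_seq_def by (intro exI[of _ "from_nat_into C"] allI)
qed

lemma cmod_cinner_le: "cmod (cinner x y) \<le> norm x * norm y"
  using cinner_tuple_le[where n = 1 and \<xi> = "\<lambda>_. x" and \<eta> = "\<lambda>_. y"] by (simp add: tuple_norm_def)

lemma bounded_linear_cinner_right: "bounded_linear (cinner v)"
  by (rule bounded_linear_intro[where K = "norm v"])
    (simp_all add: cinner_add_right scaleR_scaleC cinner_scaleC_right scaleR_conv_of_real cmod_cinner_le mult.commute[of "norm v"] order_trans[OF cmod_cinner_le])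

text \<open>The norm is not weakly continuous, but a bound on it is a countable conjunction of
  conditions on inner products. Conversely, letting the dense vectors tend to v gives ||v||^2 \<le>
  r ||v||.\<close>

lemma norm_le_iff_dense_seq:
  fixes \<delta> :: "nat \<Rightarrow> 'h::complex_hilbert_space"
  assumes \<delta>: "dense_seq \<delta>" and r: "r \<ge> 0"
  shows "norm v \<le> r \<longleftrightarrow> (\<forall>k. cmod (cinner v (\<delta> k)) \<le> r * norm (\<delta> k))"
proof
  assume "norm v \<le> r"
  then show "\<forall>k. cmod (cinner v (\<delta> k)) \<le> r * norm (\<delta> k)"
    by (intro allI order_trans[OF cmod_cinner_le] mult_right_mono) simp_all
next
  assume le: "\<forall>k. cmod (cinner v (\<delta> k)) \<le> r * norm (\<delta> k)"
  obtain s where s: "(\<lambda>N. \<delta> (s N)) \<longlonglongrightarrow> v" using \<delta> unfolding dense_seq_def by blast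
  have "cmod (cinner v v) \<le> r * norm v"
  proof (rule LIMSEQ_le)
    show "(\<lambda>N. cmod (cinner v (\<delta> (s N)))) \<longlonglongrightarrow> cmod (cinner v v)"
      by (intro tendsto_norm bounded_linear.tendsto[OF bounded_linear_cinner_right] s)
    show "(\<lambda>N. r * norm (\<delta> (s N))) \<longlonglongrightarrow> r * norm v"
      by (intro tendsto_intros s)
  qed (use le in blast)
  then have "norm v * norm v \<le> r * norm v"
    by (simp add: cinner_self power2_eq_square norm_mult)
  then show "norm v \<le> r"
    using r by (cases "norm v = 0") auto
qed

lemma borel_measurable_norm_weak:
  fixes f :: "'z \<Rightarrow> 'h::complex_hilbert_space"
  assumes \<delta>: "dense_seq (\<delta> :: nat \<Rightarrow> 'h)"
    and f: "\<And>\<eta>. (\<lambda>\<omega>. cinner (f \<omega>) \<eta>) \<in> borel_measurable M"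
  shows "(\<lambda>\<omega>. norm (f \<omega>)) \<in> borel_measurable M"
  unfolding borel_measurable_iff_le
proof
  fix a :: real
  show "{\<omega> \<in> space M. norm (f \<omega>) \<le> a} \<in> sets M"
  proof (cases "a \<ge> 0")
    case True
    have "{\<omega> \<in> space M. cmod (cinner (f \<omega>) (\<delta> k)) \<le> a * norm (\<delta> k)} \<in> sets M" for k
      using measurable_compose[OF f[of "\<delta> k"] borel_measurable_norm] unfolding borel_measurable_iff_le by blast
    then show ?thesis
      unfolding norm_le_iff_dense_seq[OF \<delta> True] by (rule sets.sets_Collect_countable_All)
  next
    case False
    then have "\<not> norm (f \<omega>) \<le> a" for \<omega>
      using norm_ge_zero[of "f \<omega>"] by linarith
    then show ?thesis by simp
  qed
qed

text \<open>Lists of naturals serve as a countable index set for n-tuples of dense vectors. A list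
  that is too short reads unspecified indices, which still select members of the sequence, so the
  quantifier over all lists is harmless.\<close>

lemma bop_mat_norm_le_iff_dense_seq:
  fixes \<delta> :: "nat \<Rightarrow> 'h::complex_hilbert_space"
  assumes \<delta>: "dense_seq \<delta>" and r: "r \<ge> 0" and A: "A \<in> carrier_mat n n"
  shows "bop_mat_norm A \<le> r \<longleftrightarrow>
    (\<forall>l. tuple_norm n (bop_mat_apply A (\<lambda>j. \<delta> (l ! j))) \<le> r * tuple_norm n (\<lambda>j. \<delta> (l ! j)))"
proof
  assume le: "bop_mat_norm A \<le> r"
  show "\<forall>l. tuple_norm n (bop_mat_apply A (\<lambda>j. \<delta> (l ! j))) \<le> r * tuple_norm n (\<lambda>j. \<delta> (l ! j))"
  proof
    fix l
    have "tuple_norm n (bop_mat_apply A (\<lambda>j. \<delta> (l ! j))) \<le> bop_mat_norm A * tuple_norm n (\<lambda>j. \<delta> (l ! j))"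
      using bop_mat_norm_apply[of A "\<lambda>j. \<delta> (l ! j)"] A by simp
    also have "\<dots> \<le> r * tuple_norm n (\<lambda>j. \<delta> (l ! j))"
      using le by (rule mult_right_mono) (rule tuple_norm_ge_zero)
    finally show "tuple_norm n (bop_mat_apply A (\<lambda>j. \<delta> (l ! j))) \<le> r * tuple_norm n (\<lambda>j. \<delta> (l ! j))" .
  qed
next
  assume le: "\<forall>l. tuple_norm n (bop_mat_apply A (\<lambda>j. \<delta> (l ! j))) \<le> r * tuple_norm n (\<lambda>j. \<delta> (l ! j))"
  show "bop_mat_norm A \<le> r"
  proof (rule bop_mat_norm_le[OF r])
    fix \<xi> :: "nat \<Rightarrow> 'h"
    have "\<forall>x. \<exists>s. (\<lambda>N. \<delta> (s N)) \<longlonglongrightarrow> x" using \<delta> unfolding dense_seq_def .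
    from choice[OF this] obtain S where S: "\<forall>x. (\<lambda>N. \<delta> (S x N)) \<longlonglongrightarrow> x" ..
    define l where "l N = map (\<lambda>j. S (\<xi> j) N) [0..<n]" for N
    have l: "(\<lambda>N. \<delta> (l N ! j)) \<longlonglongrightarrow> \<xi> j" if "j < n" for j
      using S that by (simp add: l_def)
    have "tuple_norm n (bop_mat_apply A \<xi>) \<le> r * tuple_norm n \<xi>"
    proof (rule LIMSEQ_le)
      show "(\<lambda>N. tuple_norm n (bop_mat_apply A (\<lambda>j. \<delta> (l N ! j)))) \<longlonglongrightarrow> tuple_norm n (bop_mat_apply A \<xi>)"
        unfolding tuple_norm_def bop_mat_apply_def
        by (intro tendsto_intros bounded_linear.tendsto[OF bop_apply_bounded_linear] l) (use A in simp)
      show "(\<lambda>N. r * tuple_norm n (\<lambda>j. \<delta> (l N ! j))) \<longlonglongrightarrow> r * tuple_norm n \<xi>"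
        unfolding tuple_norm_def by (intro tendsto_intros l) simp
    qed (use le in simp)
    then show "tuple_norm (dim_row A) (bop_mat_apply A \<xi>) \<le> r * tuple_norm (dim_col A) \<xi>"
      using A by simp
  qed
qed

text \<open>Two countable reductions: norms of single vectors through inner products, and then the
  operator norm through the images of countably many tuples.\<close>

lemma borel_measurable_mat_norm_weak:
  fixes B :: "'z \<Rightarrow> 'h::complex_hilbert_space bop mat"
  assumes \<delta>: "dense_seq (\<delta> :: nat \<Rightarrow> 'h)" and B: "\<And>\<omega>. B \<omega> \<in> carrier_mat n n"
    and m: "\<And>p q \<xi> \<eta>. p < n \<Longrightarrow> q < n \<Longrightarrow> (\<lambda>\<omega>. cinner (bop_apply (B \<omega> $$ (p, q)) \<xi>) \<eta>) \<in> borel_measurable M"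
  shows "(\<lambda>\<omega>. mat_norm (B \<omega>)) \<in> borel_measurable M"
  unfolding borel_measurable_iff_le mat_norm_bop_def
proof
  fix a :: real
  have col: "dim_col (B \<omega>) = n" for \<omega> using B[of \<omega>] by simp
  have "(\<lambda>\<omega>. norm (bop_mat_apply (B \<omega>) \<xi> i)) \<in> borel_measurable M" if "i < n" for \<xi> i
    unfolding bop_mat_apply_def col
    by (rule borel_measurable_norm_weak[OF \<delta>]) (unfold cinner_sum_left, intro borel_measurable_sum m that, simp)
  then have t: "(\<lambda>\<omega>. tuple_norm n (bop_mat_apply (B \<omega>) \<xi>)) \<in> borel_measurable M" for \<xi>
    unfolding tuple_norm_def
    by (intro borel_measurable_sqrt[THEN measurable_compose_rev] borel_measurable_sum borel_measurable_power) simp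
  show "{\<omega> \<in> space M. bop_mat_norm (B \<omega>) \<le> a} \<in> sets M"
  proof (cases "a \<ge> 0")
    case True
    have "{\<omega> \<in> space M. tuple_norm n (bop_mat_apply (B \<omega>) (\<lambda>j. \<delta> (l ! j))) \<le> a * tuple_norm n (\<lambda>j. \<delta> (l ! j))} \<in> sets M"
      for l :: "nat list"
      using t unfolding borel_measurable_iff_le by blast
    then show ?thesis
      unfolding bop_mat_norm_le_iff_dense_seq[OF \<delta> True B] by (rule sets.sets_Collect_countable_All)
  next
    case False
    then have "\<not> bop_mat_norm (B \<omega>) \<le> a" for \<omega>
      using bop_mat_norm_ge_zero[of "B \<omega>"] by linarith
    then show ?thesis by simp
  qed
qed

section \<open>Rational tuples in a coded space\<close>

definition generators :: "(nat \<Rightarrow> 'h::complex_hilbert_space bop) \<Rightarrow> nat \<Rightarrow> 'h bop"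
  where "generators \<gamma> k = (case k of 0 \<Rightarrow> 1 | Suc j \<Rightarrow> \<gamma> j)"

lemma coded_space_generators: "coded_space \<gamma> = cspan (range (generators \<gamma>))"
proof -
  have "range (generators \<gamma>) = {1} \<union> range \<gamma>"
    by (auto simp: generators_def image_iff split: nat.splits)
  then show ?thesis by (simp add: coded_space_def)
qed

lemma subspace_coded_space: "csubspace (coded_space \<gamma>)"
  unfolding coded_space_def by (rule complex_vector.subspace_span)

lemma one_in_coded_space: "1 \<in> coded_space \<gamma>"
  unfolding coded_space_def by (rule complex_vector.span_base) simp

text \<open>The conclusion holds for all large K, so that one K can serve finitely many vectors at
  once.\<close>

lemma span_range_lincombs:
  assumes "x \<in> cspan (range g)"
  shows "\<exists>K0. \<forall>K\<ge>K0. x \<in> lincombs K g"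
  using assms
proof (induction rule: complex_vector.span_induct_alt)
  case base
  have "0 \<in> lincombs K g" for K
    unfolding lincombs_def mem_Collect_eq by (intro exI[of _ "\<lambda>_. 0"]) simp
  then show ?case by blast
next
  case (step c x y)
  then obtain K0 j where K0: "\<forall>K\<ge>K0. y \<in> lincombs K g" and j: "x = g j" by blast
  have "c *\<^sub>C x + y \<in> lincombs K g" if K: "K \<ge> max K0 (Suc j)" for K
  proof -
    have "y \<in> lincombs K g" using K0 K by simp
    then obtain b where b: "y = (\<Sum>k<K. b k *\<^sub>C g k)" by (auto simp: lincombs_def)
    have "c *\<^sub>C x = (\<Sum>k<K. if k = j then c *\<^sub>C g j else 0)" using K by (simp add: j)
    also have "\<dots> = (\<Sum>k<K. (if k = j then c else 0) *\<^sub>C g k)" by (intro sum.cong) auto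
    finally have "c *\<^sub>C x + y = (\<Sum>k<K. ((if k = j then c else 0) + b k) *\<^sub>C g k)"
      by (simp add: b scaleC_add_left sum.distrib)
    then show ?thesis
      unfolding lincombs_def mem_Collect_eq by (intro exI[of _ "\<lambda>k. (if k = j then c else 0) + b k"] conjI TrueI)
  qed
  then show ?case by (intro exI[of _ "max K0 (Suc j)"] allI impI)
qed

text \<open>The strict inequality makes the condition open in \<open>x\<close>, so that it can be tested on a dense set of tuples.\<close>

definition realizes :: "nat \<Rightarrow> (test \<times> rat) list \<Rightarrow> nat \<Rightarrow> 'a::matricial_cstar_algebra set \<Rightarrow> bool"
  where "realizes d cs N X \<longleftrightarrow> (\<exists>x. x 0 = 1 \<and> (\<forall>i<d. x i \<in> X) \<and>
    (\<forall>(\<tau>, \<rho>)\<in>set cs. \<bar>test_norm d \<tau> x - of_rat \<rho>\<bar> < 1 / real (Suc N)))"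

text \<open>Row 0 is fixed rather than read from the list: approximating the other coefficients must
  leave x_0 = 1 exact.\<close>

definition rational_coeff :: "(rat \<times> rat) list list \<Rightarrow> nat \<Rightarrow> nat \<Rightarrow> complex"
  where "rational_coeff l i k = (if i = 0 then if k = 0 then 1 else 0 else gauss (l ! i ! k))"

text \<open>Summing over \<open>Suc K\<close> generators keeps the unit, generator 0, available for
  every K.\<close>

definition rational_tuple ::
    "nat \<Rightarrow> (rat \<times> rat) list list \<Rightarrow> (nat \<Rightarrow> 'h::complex_hilbert_space bop) \<Rightarrow> nat \<Rightarrow> 'h bop"
  where "rational_tuple K l \<gamma> i = (\<Sum>k<Suc K. rational_coeff l i k *\<^sub>C generators \<gamma> k)"

lemma sum_unit_coeff:
  fixes g :: "nat \<Rightarrow> 'a::complex_vector"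
  shows "(\<Sum>k<Suc K. (if k = 0 then 1 else 0) *\<^sub>C g k) = g 0"
proof -
  have "(\<Sum>k<Suc K. (if k = 0 then 1 else 0) *\<^sub>C g k) = (\<Sum>k<Suc K. if k = 0 then g 0 else 0)"
    by (intro sum.cong) auto
  then show ?thesis by simp
qed

lemma rational_tuple_0: "rational_tuple K l \<gamma> 0 = 1"
  unfolding rational_tuple_def rational_coeff_def if_True simp_thms sum_unit_coeff generators_def by simp

lemma rational_tuple_in: "rational_tuple K l \<gamma> i \<in> coded_space \<gamma>"
proof -
  have "generators \<gamma> k \<in> coded_space \<gamma>" for k
    unfolding coded_space_generators by (rule complex_vector.span_base) simp
  then show ?thesis
    unfolding rational_tuple_def
    by (intro complex_vector.subspace_sum complex_vector.subspace_scale subspace_coded_space)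
qed

text \<open>Test norms are continuous in the coefficients and finitely many strict inequalities
  survive a small perturbation. K and l range over countable types, so the right-hand side is a
  countable union of finite intersections of conditions on the code.\<close>

lemma realizes_iff_rational:
  "realizes d cs N (coded_space \<gamma>) \<longleftrightarrow>
    (\<exists>K l. \<forall>(\<tau>, \<rho>)\<in>set cs. \<bar>test_norm d \<tau> (rational_tuple K l \<gamma>) - of_rat \<rho>\<bar> < 1 / real (Suc N))"
proof
  assume "\<exists>K l. \<forall>(\<tau>, \<rho>)\<in>set cs. \<bar>test_norm d \<tau> (rational_tuple K l \<gamma>) - of_rat \<rho>\<bar> < 1 / real (Suc N)"
  then obtain K l where "\<forall>(\<tau>, \<rho>)\<in>set cs. \<bar>test_norm d \<tau> (rational_tuple K l \<gamma>) - of_rat \<rho>\<bar> < 1 / real (Suc N)"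
    by (elim exE)
  then show "realizes d cs N (coded_space \<gamma>)"
    unfolding realizes_def
    by (intro exI[of _ "rational_tuple K l \<gamma>"] conjI allI impI rational_tuple_0 rational_tuple_in)
next
  assume "realizes d cs N (coded_space \<gamma>)"
  then obtain x where x: "x 0 = 1" "\<forall>i<d. x i \<in> coded_space \<gamma>"
    "\<forall>(\<tau>, \<rho>)\<in>set cs. \<bar>test_norm d \<tau> x - of_rat \<rho>\<bar> < 1 / real (Suc N)"
    unfolding realizes_def by (elim exE conjE)
  let ?g = "generators \<gamma>"
  have "\<forall>i. \<exists>K0. i < d \<longrightarrow> (\<forall>K\<ge>K0. x i \<in> lincombs K ?g)"
    using span_range_lincombs x(2) unfolding coded_space_generators by blast
  from choice[OF this] obtain K0 where K0: "\<forall>i. i < d \<longrightarrow> (\<forall>K\<ge>K0 i. x i \<in> lincombs K ?g)" ..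
  define K where "K = (\<Sum>i<d. K0 i)"
  have "K0 i \<le> Suc K" if "i < d" for i
    using member_le_sum[of i "{..<d}" K0] that by (simp add: K_def)
  with K0 have lin: "x i \<in> lincombs (Suc K) ?g" if "i < d" for i
    using that by simp
  \<comment> \<open>Generators may be dependent, so 1 can have many representations; coordinate 0 is
    given the one prescribed by \<open>rational_coeff\<close>.\<close>
  have "\<exists>c. i < d \<longrightarrow> x i = (\<Sum>k<Suc K. c k *\<^sub>C ?g k) \<and> (i = 0 \<longrightarrow> c = (\<lambda>k. if k = 0 then 1 else 0))" for i
  proof (cases "i = 0")
    case True
    then show ?thesis
      by (intro exI[of _ "\<lambda>k. if k = 0 then 1 else 0"]) (simp only: sum_unit_coeff x(1), simp add: generators_def)
  next
    case False
    show ?thesis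
    proof (cases "i < d")
      case True
      obtain c where "x i = (\<Sum>k<Suc K. c k *\<^sub>C ?g k)"
        using lin[OF True] unfolding lincombs_def by blast
      with False show ?thesis by (intro exI[of _ c]) simp
    qed simp
  qed
  then have "\<forall>i. \<exists>c. i < d \<longrightarrow> x i = (\<Sum>k<Suc K. c k *\<^sub>C ?g k) \<and> (i = 0 \<longrightarrow> c = (\<lambda>k. if k = 0 then 1 else 0))" ..
  from choice[OF this] obtain c where
    c: "\<forall>i. i < d \<longrightarrow> x i = (\<Sum>k<Suc K. c i k *\<^sub>C ?g k) \<and> (i = 0 \<longrightarrow> c i = (\<lambda>k. if k = 0 then 1 else 0))" ..
  have "\<forall>z. \<exists>s. (\<lambda>N. gauss (s N)) \<longlonglongrightarrow> z" by (intro allI gauss_dense)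
  from choice[OF this] obtain S where S: "\<forall>z. (\<lambda>N. gauss (S z N)) \<longlonglongrightarrow> z" ..
  define l where "l n = map (\<lambda>i. map (\<lambda>k. S (c i k) n) [0..<Suc K]) [0..<d]" for n
  have lim: "(\<lambda>n. rational_coeff (l n) i k) \<longlonglongrightarrow> c i k" if "i < d" "k < Suc K" for i k
  proof (cases "i = 0")
    case True
    then show ?thesis using c that by (simp add: rational_coeff_def)
  next
    case False
    have "l n ! i ! k = S (c i k) n" for n
      using that by (simp add: l_def del: upt_Suc)
    then show ?thesis using False S by (simp add: rational_coeff_def)
  qed
  have tn: "(\<lambda>n. test_norm d \<tau> (rational_tuple K (l n) \<gamma>)) \<longlonglongrightarrow> test_norm d \<tau> x" for \<tau>
  proof -
    have "test_norm d \<tau> x = test_norm d \<tau> (\<lambda>i. \<Sum>k<Suc K. c i k *\<^sub>C ?g k)"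
      by (rule test_norm_cong) (use c in simp)
    then show ?thesis
      unfolding rational_tuple_def test_norm_def
      by (simp only:) (rule tendsto_tensor_sum_vec, rule lim)
  qed
  have "\<forall>\<^sub>F n in sequentially. \<bar>test_norm d \<tau> (rational_tuple K (l n) \<gamma>) - of_rat \<rho>\<bar> < 1 / real (Suc N)"
    if "(\<tau>, \<rho>) \<in> set cs" for \<tau> \<rho>
  proof (rule order_tendstoD(2))
    show "(\<lambda>n. \<bar>test_norm d \<tau> (rational_tuple K (l n) \<gamma>) - of_rat \<rho>\<bar>) \<longlonglongrightarrow> \<bar>test_norm d \<tau> x - of_rat \<rho>\<bar>"
      by (intro tendsto_rabs tendsto_diff tendsto_const tn)
    show "\<bar>test_norm d \<tau> x - of_rat \<rho>\<bar> < 1 / real (Suc N)"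
      using x(3) that by fastforce
  qed
  then have "\<forall>\<^sub>F n in sequentially. \<forall>c\<in>set cs. case c of (\<tau>, \<rho>) \<Rightarrow>
      \<bar>test_norm d \<tau> (rational_tuple K (l n) \<gamma>) - of_rat \<rho>\<bar> < 1 / real (Suc N)"
    by (intro eventually_ball_finite) (auto split: prod.split)
  then obtain n where "\<forall>c\<in>set cs. case c of (\<tau>, \<rho>) \<Rightarrow>
      \<bar>test_norm d \<tau> (rational_tuple K (l n) \<gamma>) - of_rat \<rho>\<bar> < 1 / real (Suc N)"
    using eventually_happens'[OF sequentially_bot] by blast
  then show "\<exists>K l. \<forall>(\<tau>, \<rho>)\<in>set cs. \<bar>test_norm d \<tau> (rational_tuple K l \<gamma>) - of_rat \<rho>\<bar> < 1 / real (Suc N)"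
    by (intro exI[of _ K] exI[of _ "l n"])
qed

lemma measurable_generator_coefficient:
  "(\<lambda>\<gamma>. cinner (bop_apply (generators \<gamma> k) \<xi>) \<eta>) \<in> borel_measurable (\<Pi>\<^sub>M i\<in>UNIV. bop_borel)"
proof (cases k)
  case 0
  then show ?thesis by (simp add: generators_def)
next
  case (Suc j)
  have "(\<lambda>\<gamma>. \<gamma> j) \<in> (\<Pi>\<^sub>M i\<in>UNIV. bop_borel) \<rightarrow>\<^sub>M bop_borel"
    by (rule measurable_component_singleton) simp
  from measurable_compose[OF this measurable_matrix_coefficient] show ?thesis
    by (simp add: Suc generators_def)
qed

lemma borel_measurable_test_norm_rational_tuple:
  assumes "dense_seq (\<delta> :: nat \<Rightarrow> 'h::complex_hilbert_space)"
  shows "(\<lambda>\<gamma> :: nat \<Rightarrow> 'h bop. test_norm d \<tau> (rational_tuple K l \<gamma>)) \<in> borel_measurable (\<Pi>\<^sub>M i\<in>UNIV. bop_borel)"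
  unfolding test_norm_def
proof (rule borel_measurable_mat_norm_weak[OF assms tensor_sum_carrier])
  fix p q \<xi> \<eta> assume pq: "p < Suc (fst \<tau>)" "q < Suc (fst \<tau>)"
  have "cinner (bop_apply (tensor_sum (Suc (fst \<tau>)) d (coeffs (snd \<tau>)) (rational_tuple K l \<gamma>) $$ (p, q)) \<xi>) \<eta> =
      (\<Sum>i<d. \<Sum>k<Suc K. coeffs (snd \<tau>) i p q * (rational_coeff l i k * cinner (bop_apply (generators \<gamma> k) \<xi>) \<eta>))"
    for \<gamma> :: "nat \<Rightarrow> 'h bop"
    using pq unfolding tensor_sum_def rational_tuple_def
    by (simp only: index_mat bop_apply_sum bop_apply_simps cinner_sum_left cinner_scaleC_left sum_distrib_left prod.case)
  then show "(\<lambda>\<gamma> :: nat \<Rightarrow> 'h bop. cinner (bop_apply (tensor_sum (Suc (fst \<tau>)) d (coeffs (snd \<tau>)) (rational_tuple K l \<gamma>) $$ (p, q)) \<xi>) \<eta>)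
      \<in> borel_measurable (\<Pi>\<^sub>M i\<in>UNIV. bop_borel)"
    by (simp only:) (intro borel_measurable_sum borel_measurable_times borel_measurable_const measurable_generator_coefficient)
qed

lemma measurable_realizes:
  assumes \<delta>: "dense_seq (\<delta> :: nat \<Rightarrow> 'h::complex_hilbert_space)"
  shows "{\<gamma> \<in> space (\<Pi>\<^sub>M i\<in>UNIV. bop_borel). realizes d cs N (coded_space (\<gamma> :: nat \<Rightarrow> 'h bop))} \<in> sets (\<Pi>\<^sub>M i\<in>UNIV. bop_borel)"
  (is "?S \<in> sets ?M")
proof -
  have "{\<gamma> \<in> space ?M. \<bar>test_norm d \<tau> (rational_tuple K l \<gamma>) - of_rat \<rho>\<bar> < 1 / real (Suc N)} \<in> sets ?M" for \<tau> \<rho> K l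
  proof -
    have "(\<lambda>\<gamma>. \<bar>test_norm d \<tau> (rational_tuple K l \<gamma>) - of_rat \<rho>\<bar>) \<in> borel_measurable ?M"
      by (intro borel_measurable_abs borel_measurable_diff borel_measurable_const
          borel_measurable_test_norm_rational_tuple[OF \<delta>])
    then show ?thesis unfolding borel_measurable_iff_less by blast
  qed
  then have "{\<gamma> \<in> space ?M. case c of (\<tau>, \<rho>) \<Rightarrow> \<bar>test_norm d \<tau> (rational_tuple K l \<gamma>) - of_rat \<rho>\<bar> < 1 / real (Suc N)} \<in> sets ?M"
    for c K l by (simp split: prod.split)
  then show ?thesis
    unfolding realizes_iff_rational
    by (intro sets.sets_Collect_countable_Ex sets.sets_Collect_finite_All) simp_all
qed

text \<open>Complete isometries carry tuples to tuples with the same test norms; the inverse images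
  of a tuple in Y give the other direction.\<close>

lemma realizes_complete_isometry:
  fixes X :: "'a::matricial_cstar_algebra set" and Y :: "'b::matricial_cstar_algebra set"
  assumes X: "csubspace X" "1 \<in> X" and "unitally_completely_isometric X Y"
  shows "realizes d cs N X \<longleftrightarrow> realizes d cs N Y"
proof -
  obtain u where b: "bij_betw u X Y" and u: "complete_embedding X Y u"
    using assms(3) unfolding unitally_completely_isometric_iff_embedding by (elim exE conjE)
  have eq: "test_norm d \<tau> (\<lambda>i. u (x i)) = test_norm d \<tau> x" if "\<forall>i<d. x i \<in> X" for \<tau> x
    unfolding test_norm_def by (rule complete_embedding_tensor_sum[OF u X(1)]) (use that in simp_all)
  show ?thesis
  proof
    assume "realizes d cs N X"
    then obtain x where x: "x 0 = 1" "\<forall>i<d. x i \<in> X"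
      "\<forall>(\<tau>, \<rho>)\<in>set cs. \<bar>test_norm d \<tau> x - of_rat \<rho>\<bar> < 1 / real (Suc N)"
      unfolding realizes_def by (elim exE conjE)
    show "realizes d cs N Y"
      unfolding realizes_def
      by (rule exI[of _ "\<lambda>i. u (x i)"]) (use x complete_embedding_into[OF u] in \<open>simp add: eq complete_embedding_one[OF u]\<close>)
  next
    assume "realizes d cs N Y"
    then obtain y where y: "y 0 = 1" "\<forall>i<d. y i \<in> Y"
      "\<forall>(\<tau>, \<rho>)\<in>set cs. \<bar>test_norm d \<tau> y - of_rat \<rho>\<bar> < 1 / real (Suc N)"
      unfolding realizes_def by (elim exE conjE)
    define x where "x i = inv_into X u (y i)" for i
    have uY: "u ` X = Y" and inj: "inj_on u X" using b by (simp_all add: bij_betw_def)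
    have x: "\<forall>i<d. x i \<in> X" "\<And>i. i < d \<Longrightarrow> u (x i) = y i"
      using y(2) unfolding uY[symmetric] x_def by (simp_all add: inv_into_into f_inv_into_f)
    have "x 0 = 1"
      using inv_into_f_f[OF inj X(2)] by (simp add: x_def y(1) complete_embedding_one[OF u])
    moreover have "test_norm d \<tau> x = test_norm d \<tau> y" for \<tau>
      using eq[OF x(1)] test_norm_cong[of d "\<lambda>i. u (x i)" y \<tau>] x(2) by simp
    ultimately show "realizes d cs N X"
      unfolding realizes_def by (intro exI[of _ x]) (use x(1) y(3) in simp)
  qed
qed

lemma approximately_embeds_of_realizes:
  fixes X :: "'a::matricial_cstar_algebra set" and Y :: "'b::matricial_cstar_algebra set"
  assumes XY: "\<And>d cs N. realizes d cs N X \<Longrightarrow> realizes d cs N Y"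
  shows "approximately_embeds X Y"
  unfolding approximately_embeds_def
proof (intro allI impI)
  fix d :: nat and e :: "nat \<Rightarrow> 'a" and F :: "test set" and \<epsilon> :: real
  assume e: "e 0 = 1" "\<forall>i<d. e i \<in> X" and F: "finite F" and \<epsilon>: "\<epsilon> > 0"
  obtain \<tau>s where \<tau>s: "set \<tau>s = F" using finite_list[OF F] ..
  \<comment> \<open>Two errors below \<epsilon> / 2 add up: rounding the norms of e to rationals,
    and realizing these rationals in Y.\<close>
  obtain N where N: "1 / real (Suc N) < \<epsilon> / 2"
    using nat_approx_posE[of "\<epsilon> / 2"] \<epsilon> by auto
  have "\<forall>\<tau>. \<exists>\<rho>. \<bar>test_norm d \<tau> e - real_of_rat \<rho>\<bar> < 1 / real (Suc N)"
  proof
    fix \<tau>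
    obtain \<rho> where "test_norm d \<tau> e < real_of_rat \<rho>" "real_of_rat \<rho> < test_norm d \<tau> e + 1 / real (Suc N)"
      using of_rat_dense[of "test_norm d \<tau> e" "test_norm d \<tau> e + 1 / real (Suc N)"] by auto
    then show "\<exists>\<rho>. \<bar>test_norm d \<tau> e - real_of_rat \<rho>\<bar> < 1 / real (Suc N)"
      by (intro exI[of _ \<rho>]) linarith
  qed
  from choice[OF this] obtain \<rho> where \<rho>: "\<forall>\<tau>. \<bar>test_norm d \<tau> e - real_of_rat (\<rho> \<tau>)\<bar> < 1 / real (Suc N)" ..
  have "realizes d (map (\<lambda>\<tau>. (\<tau>, \<rho> \<tau>)) \<tau>s) N X"
    unfolding realizes_def using e \<rho> by (intro exI[of _ e]) auto
  then have "realizes d (map (\<lambda>\<tau>. (\<tau>, \<rho> \<tau>)) \<tau>s) N Y" by (rule XY)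
  then obtain y where y: "y 0 = 1" "\<forall>i<d. y i \<in> Y"
    "\<forall>\<tau>\<in>F. \<bar>test_norm d \<tau> y - real_of_rat (\<rho> \<tau>)\<bar> < 1 / real (Suc N)"
    unfolding realizes_def using \<tau>s by auto
  have "\<bar>test_norm d \<tau> y - test_norm d \<tau> e\<bar> < \<epsilon>" if "\<tau> \<in> F" for \<tau>
    using bspec[OF y(3) that] \<rho>[rule_format, of \<tau>] N by linarith
  with y(1,2) show "\<exists>y. y 0 = 1 \<and> (\<forall>i<d. y i \<in> Y) \<and> (\<forall>\<tau>\<in>F. \<bar>test_norm d \<tau> y - test_norm d \<tau> e\<bar> < \<epsilon>)"
    by (intro exI[of _ y] conjI ballI)
qed

section \<open>The invariant and smoothness\<close>

text \<open>The characteristic function of the set of realized conditions, enumerated by their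
  codes; its values are real so that it lands in the Polish space of real sequences.\<close>

definition invariant :: "(nat \<Rightarrow> 'h::complex_hilbert_space bop) \<Rightarrow> nat \<Rightarrow> real"
  where "invariant \<gamma> m = (case from_nat m of (d, cs, N) \<Rightarrow> if realizes d cs N (coded_space \<gamma>) then 1 else 0)"

lemma invariant_eq_iff:
  "invariant \<gamma> = invariant \<gamma>' \<longleftrightarrow>
    (\<forall>d cs N. realizes d cs N (coded_space \<gamma>) \<longleftrightarrow> realizes d cs N (coded_space \<gamma>'))"
proof
  assume eq: "invariant \<gamma> = invariant \<gamma>'"
  show "\<forall>d cs N. realizes d cs N (coded_space \<gamma>) \<longleftrightarrow> realizes d cs N (coded_space \<gamma>')"
  proof (intro allI)
    fix d cs N
    show "realizes d cs N (coded_space \<gamma>) \<longleftrightarrow> realizes d cs N (coded_space \<gamma>')"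
      using fun_cong[OF eq, of "to_nat (d, cs, N)"] by (simp add: invariant_def split: if_splits)
  qed
next
  assume eq: "\<forall>d cs N. realizes d cs N (coded_space \<gamma>) \<longleftrightarrow> realizes d cs N (coded_space \<gamma>')"
  show "invariant \<gamma> = invariant \<gamma>'"
    by (rule ext) (simp add: invariant_def eq split: prod.split)
qed

lemma measurable_invariant:
  assumes "dense_seq (\<delta> :: nat \<Rightarrow> 'h::complex_hilbert_space)"
  shows "(invariant :: (nat \<Rightarrow> 'h bop) \<Rightarrow> _) \<in> fg_code_space \<rightarrow>\<^sub>M borel_of euclidean"
proof -
  have "(\<lambda>\<gamma> :: nat \<Rightarrow> 'h bop. invariant \<gamma> m) \<in> borel_measurable (\<Pi>\<^sub>M i\<in>UNIV. bop_borel)" for m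
  proof -
    obtain d N :: nat and cs :: "(test \<times> rat) list" where m: "from_nat m = (d, cs, N)" by (metis prod_cases3)
    show ?thesis unfolding invariant_def m prod.case
      by (intro measurable_If measurable_const measurable_realizes[OF assms]) simp_all
  qed
  then have "(invariant :: (nat \<Rightarrow> 'h bop) \<Rightarrow> _) \<in> borel_measurable (\<Pi>\<^sub>M i\<in>UNIV. bop_borel)"
    by (rule measurable_coordinatewise_then_product)
  then have "(invariant :: (nat \<Rightarrow> 'h bop) \<Rightarrow> _) \<in> borel_measurable fg_code_space"
    unfolding fg_code_space_def by (rule measurable_restrict_space1)
  moreover have "sets (borel_of euclidean) = sets (borel :: (nat \<Rightarrow> real) measure)"
    by (simp add: sets_borel_of borel_def)
  ultimately show ?thesis
    using measurable_cong_sets[OF refl] by blast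
qed

lemma Polish_space_euclidean: "Polish_space (euclidean :: 'a::polish_space topology)"
proof -
  obtain D :: "'a set" where D: "countable D" "\<And>U. open U \<Longrightarrow> U \<noteq> {} \<Longrightarrow> \<exists>d\<in>D. d \<in> U"
    using countable_dense_setE by blast
  have "closure D = UNIV"
    using D(2)[of "- closure D"] closure_subset[of D] by blast
  then show ?thesis
    using D(1) completely_metrizable_space_euclidean
    by (auto simp: Polish_space_def separable_space_def)
qed

lemma space_fg_code_space: "space fg_code_space = fg_codes"
  by (simp add: fg_code_space_def space_restrict_space space_PiM space_bop_borel)

lemma uci_relation_iff_invariant:
  assumes "\<gamma> \<in> fg_codes" "\<gamma>' \<in> fg_codes"
  shows "(\<gamma>, \<gamma>') \<in> uci_relation \<longleftrightarrow> invariant \<gamma> = invariant \<gamma>'"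
proof -
  have "unitally_completely_isometric (coded_space \<gamma>) (coded_space \<gamma>') \<longleftrightarrow> invariant \<gamma> = invariant \<gamma>'"
  proof
    assume "unitally_completely_isometric (coded_space \<gamma>) (coded_space \<gamma>')"
    from realizes_complete_isometry[OF subspace_coded_space one_in_coded_space this]
    show "invariant \<gamma> = invariant \<gamma>'" unfolding invariant_eq_iff by (intro allI)
  next
    assume eq: "invariant \<gamma> = invariant \<gamma>'"
    show "unitally_completely_isometric (coded_space \<gamma>) (coded_space \<gamma>')"
      by (intro unitally_completely_isometricI subspace_coded_space one_in_coded_space approximately_embeds_of_realizes)
        (use assms eq in \<open>simp_all add: fg_codes_def invariant_eq_iff\<close>)
  qed
  with assms show ?thesis by (simp add: uci_relation_def)
qed

lemma smooth_uci_relation: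
  assumes "separable_space (euclidean :: 'h::complex_hilbert_space topology)"
  shows "smooth_relation (fg_code_space :: (nat \<Rightarrow> 'h bop) measure) uci_relation"
proof -
  obtain \<delta> :: "nat \<Rightarrow> 'h" where \<delta>: "dense_seq \<delta>" using dense_seq_exists[OF assms] ..
  have sub: "(uci_relation :: ((nat \<Rightarrow> 'h bop) \<times> _) set) \<subseteq> fg_codes \<times> fg_codes"
    by (auto simp: uci_relation_def)
  \<comment> \<open>The relation is the kernel of \<open>invariant\<close> on
    \<open>fg_codes\<close>, so it inherits the laws of an equivalence from equality instead of from
    inverting and composing isometries.\<close>
  have iff: "(\<gamma>, \<gamma>') \<in> uci_relation \<longleftrightarrow> \<gamma> \<in> fg_codes \<and> \<gamma>' \<in> fg_codes \<and> invariant \<gamma> = invariant \<gamma>'"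
    for \<gamma> \<gamma>' :: "nat \<Rightarrow> 'h bop"
    using sub uci_relation_iff_invariant[of \<gamma> \<gamma>'] by blast
  have "equiv (fg_codes :: (nat \<Rightarrow> 'h bop) set) uci_relation"
    by (intro equivI sub refl_onI symI transI) (simp_all add: iff)
  then show ?thesis
    unfolding smooth_relation_def space_fg_code_space
    by (intro conjI exI[of _ euclidean] exI[of _ invariant] ballI Polish_space_euclidean
        measurable_invariant[OF \<delta>] uci_relation_iff_invariant)
qed

theorem corollary5p7:
  shows "(\<forall>(X :: 'a::matricial_cstar_algebra set) (Y :: 'b::matricial_cstar_algebra set).
      unital_operator_space X \<longrightarrow> unital_operator_space Y \<longrightarrow>
      finitely_generated X \<longrightarrow> finitely_generated Y \<longrightarrow>
      (unitally_completely_isometric X Y \<longleftrightarrow>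
        (\<forall>\<phi>. uosp_sentence \<phi> \<and> universal \<phi> \<longrightarrow> sentence_value X \<phi> = sentence_value Y \<phi>)))
    \<and> (separable_infinite_dimensional TYPE('h::complex_hilbert_space) \<longrightarrow>
      smooth_relation (fg_code_space :: (nat \<Rightarrow> 'h bop) measure) uci_relation)"
proof (intro conjI allI impI)
  fix X :: "'a set" and Y :: "'b set"
  assume "unital_operator_space X" "unital_operator_space Y" and fg: "finitely_generated X" "finitely_generated Y"
  then have X: "csubspace X" "1 \<in> X" and Y: "csubspace Y" "1 \<in> Y"
    by (simp_all add: unital_operator_space_def)
  show "unitally_completely_isometric X Y \<longleftrightarrow>
      (\<forall>\<phi>. uosp_sentence \<phi> \<and> universal \<phi> \<longrightarrow> sentence_value X \<phi> = sentence_value Y \<phi>)"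
  proof
    assume "unitally_completely_isometric X Y"
    from sentence_value_eq[OF X this] show "\<forall>\<phi>. uosp_sentence \<phi> \<and> universal \<phi> \<longrightarrow> sentence_value X \<phi> = sentence_value Y \<phi>"
      by simp
  next
    assume eq: "\<forall>\<phi>. uosp_sentence \<phi> \<and> universal \<phi> \<longrightarrow> sentence_value X \<phi> = sentence_value Y \<phi>"
    show "unitally_completely_isometric X Y"
      by (intro unitally_completely_isometricI X Y fg approximately_embeds_of_sentences) (use eq in simp_all)
  qed
next
  assume "separable_infinite_dimensional TYPE('h)"
  then show "smooth_relation (fg_code_space :: (nat \<Rightarrow> 'h bop) measure) uci_relation"
    by (intro smooth_uci_relation) (simp add: separable_infinite_dimensional_def)
qed

end
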